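(* Let $M=I\times_{\phi^{p_1}}F_1\times_{\phi^{p_2}}F_2\cdots\times_{\phi^{p_m}}F_m$ be a generalized Kasner space-time with $\dim M=\overline n$, $\dim F_i=l_i$, and put $\zeta=\sum_{i=1}^ml_ip_i$, $\eta=\sum_{i=1}^ml_ip_i^2$. Let $\lambda_1,\lambda_2$ be nonzero real constants, $P=\frac{\partial}{\partial t}$, and let $\overline\nabla$ be the quarter-symmetric connection on $M$ determined by $P,\lambda_1,\lambda_2$. Then $(M,\overline\nabla)$ has constant scalar curvature $\overline S$ if and only if each $(F_i,\nabla^{F_i})$ has constant scalar curvature $S^{F_i}$ and $$\overline S=\sum_{i=1}^m\frac{S^{F_i}}{\phi^{2p_i}}-2\zeta\frac{\phi''}{\phi}-(\eta+\zeta^2-2\zeta)\frac{(\phi')^2}{\phi^2}+(\lambda_1+\lambda_2)\zeta(\overline n-1)\frac{\phi'}{\phi}+(\overline n-1)(\lambda_1^2+\lambda_2^2-\overline n\lambda_1\lambda_2).$$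
   Context: A generalized Kasner space-time is a Lorentzian multiply warped product $M=I\times_{\phi^{p_1}}F_1\cdots\times_{\phi^{p_m}}F_m$, i.e. the product manifold $I\times F_1\times\cdots\times F_m$ with metric $g=-dt^2\oplus\phi^{2p_1}g_{F_1}\oplus\cdots\oplus\phi^{2p_m}g_{F_m}$, where $I=(t_1,t_2)$ is an open interval, $\phi:I\to(0,\infty)$ is smooth, $p_i\in\mathbb{R}$, and $(F_i,g_{F_i})$ are Riemannian manifolds. On a pseudo-Riemannian manifold $(M,g)$ with Levi-Civita connection $\nabla$, a vector field $P$, the 1-form $\pi(X)=g(X,P)$ and nonzero real constants $\lambda_1,\lambda_2$, the quarter-symmetric connection is $\overline\nabla_XY=\nabla_XY+\lambda_1\pi(Y)X-\lambda_2g(X,Y)P$. Its curvature is $\overline R(X,Y)=\overline\nabla_X\overline\nabla_Y-\overline\nabla_Y\overline\nabla_X-\overline\nabla_{[X,Y]}$, its Ricci tensor is $\overline{Ric}(X,Y)=\sum_k\varepsilon_k\,g(\overline R(X,E_k)Y,E_k)$ and its scalar curvature is $\overline S=\sum_k\varepsilon_k\overline{Ric}(E_k,E_k)$, where $(E_k)$ is a local orthonormal frame with $g(E_k,E_k)=\varepsilon_k=\pm1$ (note the sign convention). $S^{F_i}$ is the scalar curvature of the Levi-Civita connection $\nabla^{F_i}$ of $(F_i,g_{F_i})$, with the same convention. In the right-hand condition $\overline S$ denotes the given constant and the identity is required for all $t\in I$. Primes denote $d/dt$. *)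

theory Defs
  imports "HOL-Analysis.Analysis"
begin

section \<open>Smooth functions in coordinates\<close>

text \<open>Dimensions vary with the fibre, so coordinates live in the library topology
  \<open>Euclidean_space n\<close> on \<open>nat \<Rightarrow> real\<close> (coordinates with index \<open>\<ge> n\<close> vanish).\<close>

definition partial :: "nat \<Rightarrow> ((nat \<Rightarrow> real) \<Rightarrow> real) \<Rightarrow> (nat \<Rightarrow> real) \<Rightarrow> real" where
  "partial k f x = deriv (\<lambda>s. f (x(k := s))) (x k)"

text \<open>All iterated partial derivatives up to order \<open>r\<close> exist and are continuous on \<open>W\<close>
  (an open subset of \<open>Euclidean_space n\<close>).\<close>

primrec Ck_on :: "nat \<Rightarrow> nat \<Rightarrow> (nat \<Rightarrow> real) set \<Rightarrow> ((nat \<Rightarrow> real) \<Rightarrow> real) \<Rightarrow> bool" where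
  "Ck_on 0 n W f \<longleftrightarrow> continuous_map (subtopology (Euclidean_space n) W) euclideanreal f"
| "Ck_on (Suc r) n W f \<longleftrightarrow>
     continuous_map (subtopology (Euclidean_space n) W) euclideanreal f \<and>
     (\<forall>k<n. (\<forall>x\<in>W. (\<lambda>s. f (x(k := s))) differentiable (at (x k))) \<and>
            Ck_on r n W (partial k f))"

definition Cinf_on :: "nat \<Rightarrow> (nat \<Rightarrow> real) set \<Rightarrow> ((nat \<Rightarrow> real) \<Rightarrow> real) \<Rightarrow> bool" where
  "Cinf_on n W f \<longleftrightarrow> (\<forall>r. Ck_on r n W f)"

definition smooth_real_on :: "real set \<Rightarrow> (real \<Rightarrow> real) \<Rightarrow> bool" where
  "smooth_real_on I f \<longleftrightarrow> (\<forall>k. (deriv ^^ k) f differentiable_on I)"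


section \<open>Smooth manifolds\<close>

text \<open>The atlas need not be maximal; it determines the smooth structure.\<close>

record 'a mfd =
  mtop :: "'a topology"
  mdim :: nat
  atlas :: "('a set \<times> ('a \<Rightarrow> nat \<Rightarrow> real)) set"

definition smooth_manifold :: "'a mfd \<Rightarrow> bool" where
  "smooth_manifold M \<longleftrightarrow>
     topspace (mtop M) \<noteq> {} \<and> Hausdorff_space (mtop M) \<and> second_countable (mtop M) \<and>
     \<Union> (fst ` atlas M) = topspace (mtop M) \<and>
     (\<forall>(V, \<psi>) \<in> atlas M.
        openin (mtop M) V \<and> openin (Euclidean_space (mdim M)) (\<psi> ` V) \<and>
        homeomorphic_map (subtopology (mtop M) V)
          (subtopology (Euclidean_space (mdim M)) (\<psi> ` V)) \<psi>) \<and>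
     (\<forall>(V, \<psi>) \<in> atlas M. \<forall>(V', \<psi>') \<in> atlas M. \<forall>k < mdim M.
        Cinf_on (mdim M) (\<psi> ` (V \<inter> V')) (\<lambda>x. \<psi>' (inv_into V \<psi> x) k))"

definition smooth_on :: "'a mfd \<Rightarrow> 'a set \<Rightarrow> ('a \<Rightarrow> real) \<Rightarrow> bool" where
  "smooth_on M U f \<longleftrightarrow> openin (mtop M) U \<and>
     (\<forall>(V, \<psi>) \<in> atlas M. Cinf_on (mdim M) (\<psi> ` (U \<inter> V)) (f \<circ> inv_into V \<psi>))"

definition smooth_at :: "'a mfd \<Rightarrow> 'a \<Rightarrow> ('a \<Rightarrow> real) \<Rightarrow> bool" where
  "smooth_at M p f \<longleftrightarrow> (\<exists>U. p \<in> U \<and> smooth_on M U f)"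


section \<open>Tangent vectors and vector fields\<close>

type_synonym 'a tvec = "('a \<Rightarrow> real) \<Rightarrow> real"
type_synonym 'a vfield = "'a \<Rightarrow> 'a tvec"

text \<open>Tangent vectors at \<open>p\<close> are the derivations of the functions that are smooth near \<open>p\<close>.
  The value on other functions is fixed to be \<open>0\<close>, so that a tangent vector is determined by
  its values on smooth functions.  Since the functions are total, taking \<open>h\<close> below to be the
  indicator function of a neighbourhood of \<open>p\<close> shows that \<open>v f\<close> depends only on
  the germ of \<open>f\<close> at \<open>p\<close>.\<close>

definition tangent_space :: "'a mfd \<Rightarrow> 'a \<Rightarrow> 'a tvec set" where
  "tangent_space M p = {v.
     (\<forall>f h a b. smooth_at M p f \<and> smooth_at M p h \<longrightarrow>
        v (\<lambda>q. a * f q + b * h q) = a * v f + b * v h) \<and>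
     (\<forall>f h. smooth_at M p f \<and> smooth_at M p h \<longrightarrow>
        v (\<lambda>q. f q * h q) = f p * v h + h p * v f) \<and>
     (\<forall>f. \<not> smooth_at M p f \<longrightarrow> v f = 0)}"

definition tangent_map :: "'b mfd \<Rightarrow> ('a \<Rightarrow> 'b) \<Rightarrow> 'a \<Rightarrow> 'a tvec \<Rightarrow> 'b tvec" where
  "tangent_map N s p v = (\<lambda>f. if smooth_at N (s p) f then v (f \<circ> s) else 0)"

definition smooth_vfield_on :: "'a mfd \<Rightarrow> 'a set \<Rightarrow> 'a vfield \<Rightarrow> bool" where
  "smooth_vfield_on M U X \<longleftrightarrow> openin (mtop M) U \<and> (\<forall>p\<in>U. X p \<in> tangent_space M p) \<and>
     (\<forall>W f. W \<subseteq> U \<and> smooth_on M W f \<longrightarrow> smooth_on M W (\<lambda>p. X p f))"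

definition lie_bracket :: "'a mfd \<Rightarrow> 'a vfield \<Rightarrow> 'a vfield \<Rightarrow> 'a vfield" where
  "lie_bracket M X Y = (\<lambda>p f. if smooth_at M p f
     then X p (\<lambda>q. Y q f) - Y p (\<lambda>q. X q f) else 0)"


section \<open>Metrics and connections\<close>

type_synonym 'a metric = "'a \<Rightarrow> 'a tvec \<Rightarrow> 'a tvec \<Rightarrow> real"
type_synonym 'a conn = "'a vfield \<Rightarrow> 'a vfield \<Rightarrow> 'a vfield"

definition riemannian_metric :: "'a mfd \<Rightarrow> 'a metric \<Rightarrow> bool" where
  "riemannian_metric M g \<longleftrightarrow>
     (\<forall>p \<in> topspace (mtop M). \<forall>u \<in> tangent_space M p. \<forall>v \<in> tangent_space M p.
        g p u v = g p v u \<and>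
        (\<forall>w \<in> tangent_space M p. \<forall>a b.
           g p (\<lambda>f. a * u f + b * v f) w = a * g p u w + b * g p v w) \<and>
        (u \<noteq> (\<lambda>f. 0) \<longrightarrow> g p u u > 0)) \<and>
     (\<forall>U X Y. smooth_vfield_on M U X \<and> smooth_vfield_on M U Y \<longrightarrow>
        smooth_on M U (\<lambda>p. g p (X p) (Y p)))"

text \<open>A connection acts on the vector fields that are smooth on some open set \<open>U\<close>, and only
  its values there matter (the usual extension of a connection to local sections).
  As for tangent vectors, the Leibniz rule for indicator functions makes
  \<open>D X Y p\<close> depend only on the germs of \<open>X\<close> and \<open>Y\<close> at \<open>p\<close>, so the
  operators for different \<open>U\<close> are compatible.\<close>

definition affine_connection :: "'a mfd \<Rightarrow> 'a conn \<Rightarrow> bool" where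
  "affine_connection M D \<longleftrightarrow>
     (\<forall>U X Y. smooth_vfield_on M U X \<and> smooth_vfield_on M U Y \<longrightarrow>
        smooth_vfield_on M U (D X Y)) \<and>
     (\<forall>U X Y Z f. smooth_vfield_on M U X \<and> smooth_vfield_on M U Y \<and>
        smooth_vfield_on M U Z \<and> smooth_on M U f \<longrightarrow>
        (\<forall>p\<in>U.
           D (\<lambda>q h. X q h + Y q h) Z p = (\<lambda>h. D X Z p h + D Y Z p h) \<and>
           D (\<lambda>q h. f q * X q h) Z p = (\<lambda>h. f p * D X Z p h) \<and>
           D X (\<lambda>q h. Y q h + Z q h) p = (\<lambda>h. D X Y p h + D X Z p h) \<and>
           D X (\<lambda>q h. f q * Y q h) p = (\<lambda>h. X p f * Y p h + f p * D X Y p h)))"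

definition levi_civita :: "'a mfd \<Rightarrow> 'a metric \<Rightarrow> 'a conn \<Rightarrow> bool" where
  "levi_civita M g D \<longleftrightarrow> affine_connection M D \<and>
     (\<forall>U X Y. smooth_vfield_on M U X \<and> smooth_vfield_on M U Y \<longrightarrow>
        (\<forall>p\<in>U. (\<lambda>h. D X Y p h - D Y X p h) = lie_bracket M X Y p)) \<and>
     (\<forall>U X Y Z. smooth_vfield_on M U X \<and> smooth_vfield_on M U Y \<and> smooth_vfield_on M U Z \<longrightarrow>
        (\<forall>p\<in>U. X p (\<lambda>q. g q (Y q) (Z q)) = g p (D X Y p) (Z p) + g p (Y p) (D X Z p)))"

definition quarter_symmetric ::
  "'a metric \<Rightarrow> 'a conn \<Rightarrow> 'a vfield \<Rightarrow> real \<Rightarrow> real \<Rightarrow> 'a conn" where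
  "quarter_symmetric g D P lam1 lam2 X Y = (\<lambda>p h.
     D X Y p h + lam1 * g p (Y p) (P p) * X p h - lam2 * g p (X p) (Y p) * P p h)"


section \<open>Curvature\<close>

definition curvature :: "'a mfd \<Rightarrow> 'a conn \<Rightarrow> 'a vfield \<Rightarrow> 'a vfield \<Rightarrow> 'a vfield \<Rightarrow> 'a vfield" where
  "curvature M D X Y Z = (\<lambda>p h.
     D X (D Y Z) p h - D Y (D X Z) p h - D (lie_bracket M X Y) Z p h)"

definition orthonormal_frame_on ::
  "'a mfd \<Rightarrow> 'a metric \<Rightarrow> 'a set \<Rightarrow> (nat \<Rightarrow> 'a vfield) \<Rightarrow> (nat \<Rightarrow> real) \<Rightarrow> bool" where
  "orthonormal_frame_on M g U E \<epsilon> \<longleftrightarrow>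
     (\<forall>k < mdim M. smooth_vfield_on M U (E k) \<and> \<epsilon> k \<in> {1, -1}) \<and>
     (\<forall>p\<in>U. \<forall>j < mdim M. \<forall>k < mdim M. g p (E j p) (E k p) = (if j = k then \<epsilon> k else 0))"

definition local_frame :: "'a mfd \<Rightarrow> 'a metric \<Rightarrow> 'a \<Rightarrow> (nat \<Rightarrow> 'a vfield) \<times> (nat \<Rightarrow> real)" where
  "local_frame M g p =
     (SOME F. \<exists>U. openin (mtop M) U \<and> p \<in> U \<and> orthonormal_frame_on M g U (fst F) (snd F))"

text \<open>Sign convention: the frame occupies the second slot of the curvature operator, so this is
  minus the more common Ricci tensor (round spheres have negative scalar curvature).
  The values do not depend on the frame that is chosen.\<close>

definition ricci :: "'a mfd \<Rightarrow> 'a metric \<Rightarrow> 'a conn \<Rightarrow> 'a vfield \<Rightarrow> 'a vfield \<Rightarrow> 'a \<Rightarrow> real" where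
  "ricci M g D X Y p = (let (E, \<epsilon>) = local_frame M g p in
     \<Sum>k < mdim M. \<epsilon> k * g p (curvature M D X (E k) Y p) (E k p))"

definition scalar_curvature :: "'a mfd \<Rightarrow> 'a metric \<Rightarrow> 'a conn \<Rightarrow> 'a \<Rightarrow> real" where
  "scalar_curvature M g D p = (let (E, \<epsilon>) = local_frame M g p in
     \<Sum>k < mdim M. \<epsilon> k * ricci M g D (E k) (E k) p)"

definition has_constant_scalar_curvature :: "'a mfd \<Rightarrow> 'a metric \<Rightarrow> 'a conn \<Rightarrow> real \<Rightarrow> bool" where
  "has_constant_scalar_curvature M g D S \<longleftrightarrow>
     (\<forall>p \<in> topspace (mtop M). scalar_curvature M g D p = S)"


section \<open>Generalized Kasner space-times\<close>

text \<open>Points of \<open>I \<times> F\<^sub>1 \<times> \<dots> \<times> F\<^sub>m\<close> are pairs \<open>(t, x)\<close> with \<open>x\<close> an (extensional)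
  function on \<open>{1..m}\<close>.  All fibres are carried by one type, each with its own topology,
  dimension and atlas.  In a product chart, coordinate \<open>0\<close> is \<open>t\<close> and the coordinates of the
  \<open>i\<close>-th fibre occupy the \<open>mdim (F i)\<close> indices from \<open>block_start F i\<close> on.\<close>

definition block_start :: "(nat \<Rightarrow> 'a mfd) \<Rightarrow> nat \<Rightarrow> nat" where
  "block_start F i = 1 + (\<Sum>j\<in>{1..<i}. mdim (F j))"

definition product_coords ::
  "nat \<Rightarrow> (nat \<Rightarrow> 'a mfd) \<Rightarrow> (nat \<Rightarrow> 'a \<Rightarrow> nat \<Rightarrow> real) \<Rightarrow> real \<times> (nat \<Rightarrow> 'a) \<Rightarrow> nat \<Rightarrow> real" where
  "product_coords m F \<psi> = (\<lambda>(t, x) k. if k = 0 then t else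
     (\<Sum>i\<in>{1..m}. if block_start F i \<le> k \<and> k < block_start F i + mdim (F i)
                   then \<psi> i (x i) (k - block_start F i) else 0))"

definition kasner_manifold ::
  "real set \<Rightarrow> nat \<Rightarrow> (nat \<Rightarrow> 'a mfd) \<Rightarrow> (real \<times> (nat \<Rightarrow> 'a)) mfd" where
  "kasner_manifold I m F =
     \<lparr> mtop = prod_topology (top_of_set I) (product_topology (\<lambda>i. mtop (F i)) {1..m}),
       mdim = 1 + (\<Sum>i\<in>{1..m}. mdim (F i)),
       atlas = {(I \<times> (\<Pi>\<^sub>E i\<in>{1..m}. V i), product_coords m F \<psi>) | V \<psi>.
                  \<forall>i\<in>{1..m}. (V i, \<psi> i) \<in> atlas (F i)} \<rparr>"

text \<open>\<open>v fst\<close> is \<open>dt(v)\<close>, since \<open>fst\<close> is the function \<open>t\<close> on the product.\<close>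

definition kasner_metric ::
  "nat \<Rightarrow> (nat \<Rightarrow> 'a mfd) \<Rightarrow> (nat \<Rightarrow> 'a metric) \<Rightarrow> (real \<Rightarrow> real) \<Rightarrow> (nat \<Rightarrow> real) \<Rightarrow>
   (real \<times> (nat \<Rightarrow> 'a)) metric" where
  "kasner_metric m F gF \<phi> p q u v =
     - (u fst * v fst) +
     (\<Sum>i\<in>{1..m}. \<phi> (fst q) powr (2 * p i) *
        gF i (snd q i) (tangent_map (F i) (\<lambda>q. snd q i) q u)
                       (tangent_map (F i) (\<lambda>q. snd q i) q v))"

definition d_dt :: "(real \<times> (nat \<Rightarrow> 'a)) mfd \<Rightarrow> (real \<times> (nat \<Rightarrow> 'a)) vfield" where
  "d_dt M = (\<lambda>q f. if smooth_at M q f then deriv (\<lambda>s. f (s, snd q)) (fst q) else 0)"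

end

theory Submission
  imports Defs "Jordan_Normal_Form.Determinant"
begin

text \<open>Scalar curvature is a double trace of the curvature operator over an orthogonal frame.
  Curvature is tensorial, so on the product it may be evaluated in the frame consisting of
  \<open>\<partial>/\<partial>t\<close> and the lifts of orthonormal frames of the fibres, whatever frame the definition
  chooses.  The Koszul formula determines the Levi-Civita connection on these fields; with
  \<open>H\<^sub>i = p\<^sub>i \<phi>' / \<phi>\<close> and \<open>B\<^sub>i = \<phi>\<^bsup>2 p\<^sub>i\<^esup>\<close> the quarter-symmetric connection sends lifts \<open>X, Y\<close> of
  fields on the same fibre to the lift of \<open>\<nabla>\<^sub>X Y\<close> plus \<open>(H\<^sub>i - \<lambda>\<^sub>2) B\<^sub>i g\<^sub>F(X, Y) \<partial>/\<partial>t\<close>, annihilates lifts from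
  different fibres, and is scalar multiplication in the mixed cases.  The trace becomes
  \<open>\<Sum>\<^sub>i S\<^sub>i(x\<^sub>i) / B\<^sub>i(t) + c(t)\<close>, and varying one \<open>x\<^sub>i\<close> at a fixed time shows that it is constant only if
  every \<open>S\<^sub>i\<close> is.\<close>

section \<open>Calculus in coordinates\<close>

text \<open>Smoothness is given by iterated partial derivatives and tangent vectors are derivations,
  so a derivation must be shown to be determined by its values on coordinates. This needs Hadamard's
  lemma with smooth coefficients, which also yields the chain rule. The frame inside
  \<open>scalar_curvature\<close> is a Hilbert choice, hence an orthonormal frame has to exist near
  every point: Gram-Schmidt is carried out on the definite fibres, and the Lorentzian frame is
  assembled from lifts. The constants come from the trace. With h = \<phi>'/\<phi> and k = n - 1 the
  sum of the fibre dimensions, the pairs of fibre directions contribute -(\<zeta> h - k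
  \<lambda>2)(\<zeta> h - k \<lambda>1), up to fibre curvature and a diagonal correction. Its mixed
  terms give (n - 1)(\<lambda>1 + \<lambda>2) \<zeta> h; its constant -k^2 \<lambda>1 \<lambda>2
  joins k(\<lambda>1^2 + \<lambda>2^2 - \<lambda>1 \<lambda>2) and produces the factor n in front of
  \<lambda>1 \<lambda>2. The term 2 \<zeta> h^2 stems from (\<phi>'/\<phi>)' = \<phi>''/\<phi> -
  h^2.\<close>

lemma Euclidean_space_eq_top_of_set:
  "Euclidean_space n = top_of_set (topspace (Euclidean_space n))"
  by (simp add: Euclidean_space_def euclidean_product_topology)

lemma Euclidean_subset:
  assumes "openin (Euclidean_space n) W"
  shows "W \<subseteq> topspace (Euclidean_space n)"
  using assms openin_subset by blast

lemma continuous_map_Euclidean_iff: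
  fixes f :: "(nat \<Rightarrow> real) \<Rightarrow> real"
  assumes "W \<subseteq> topspace (Euclidean_space n)"
  shows "continuous_map (subtopology (Euclidean_space n) W) euclidean f \<longleftrightarrow> continuous_on W f"
  using assms by (subst Euclidean_space_eq_top_of_set)
    (simp add: subtopology_subtopology Int_absorb1)

lemma continuous_on_fun_upd [continuous_intros]:
  fixes x :: "'i \<Rightarrow> 'b::topological_space"
  assumes "continuous_on S f"
  shows "continuous_on S (\<lambda>s. x(k := f s))"
proof (rule continuous_on_coordinatewise_then_product)
  show "continuous_on S (\<lambda>s. (x(k := f s)) i)" for i
    using assms by (cases "i = k") auto
qed

text \<open>Makes partial derivatives local: a small change of one coordinate stays inside an open
  set. The bound on \<open>k\<close> matters, since a change of a coordinate with index at least
  \<open>n\<close> leaves the space.\<close>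

lemma Euclidean_fun_upd_eventually:
  assumes "openin (Euclidean_space n) W" "x \<in> W" "k < n"
  shows "\<forall>\<^sub>F s in nhds (x k). x(k := s) \<in> W"
proof -
  obtain T where T: "open T" "W = topspace (Euclidean_space n) \<inter> T"
    using assms(1) by (subst (asm) Euclidean_space_eq_top_of_set) (auto simp: openin_open)
  have "continuous_on UNIV (\<lambda>s. x(k := s))" by (intro continuous_intros)
  then have "open ((\<lambda>s. x(k := s)) -` T)" using T(1) open_vimage by blast
  moreover have "x k \<in> (\<lambda>s. x(k := s)) -` T" using assms T by auto
  ultimately have "\<forall>\<^sub>F s in nhds (x k). s \<in> (\<lambda>s. x(k := s)) -` T" by (rule eventually_nhds_in_open)
  then show ?thesis
    by eventually_elim (use assms T in \<open>auto simp: topspace_Euclidean_space\<close>)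
qed

lemma partial_cong:
  assumes "openin (Euclidean_space n) W" "x \<in> W" "k < n" "\<And>y. y \<in> W \<Longrightarrow> f y = g y"
  shows "partial k f x = partial k g x"
    and "(\<lambda>s. f (x(k := s))) differentiable (at (x k)) \<longleftrightarrow> (\<lambda>s. g (x(k := s))) differentiable (at (x k))"
    and "((\<lambda>s. f (x(k := s))) has_field_derivative D) (at (x k)) \<longleftrightarrow>
      ((\<lambda>s. g (x(k := s))) has_field_derivative D) (at (x k))"
proof -
  have ev: "\<forall>\<^sub>F s in nhds (x k). f (x(k := s)) = g (x(k := s))"
    using Euclidean_fun_upd_eventually[OF assms(1-3)] by eventually_elim (use assms(4) in auto)
  show "partial k f x = partial k g x" unfolding partial_def
    using ev by (rule deriv_cong_ev) simp
  have *: "((\<lambda>s. f (x(k := s))) has_field_derivative D) (at (x k)) \<longleftrightarrow>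
      ((\<lambda>s. g (x(k := s))) has_field_derivative D) (at (x k))" for D
    using ev by (intro DERIV_cong_ev) auto
  then show "((\<lambda>s. f (x(k := s))) has_field_derivative D) (at (x k)) \<longleftrightarrow>
      ((\<lambda>s. g (x(k := s))) has_field_derivative D) (at (x k))" .
  from * show "(\<lambda>s. f (x(k := s))) differentiable (at (x k)) \<longleftrightarrow> (\<lambda>s. g (x(k := s))) differentiable (at (x k))"
    by (simp add: real_differentiable_def)
qed

lemma partial_DERIV:
  assumes "(\<lambda>s. f (x(k := s))) differentiable (at (x k))"
  shows "((\<lambda>s. f (x(k := s))) has_field_derivative partial k f x) (at (x k))"
  using assms unfolding partial_def by (metis DERIV_imp_deriv real_differentiable_def)

lemma partial_eqI:
  assumes "((\<lambda>s. f (x(k := s))) has_field_derivative D) (at (x k))"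
  shows "partial k f x = D"
  unfolding partial_def using assms by (rule DERIV_imp_deriv)

section \<open>Functions of class C^r on open sets of coordinates\<close>

lemma Ck_on_cong:
  assumes "openin (Euclidean_space n) W" "\<And>y. y \<in> W \<Longrightarrow> f y = g y"
  shows "Ck_on r n W f \<longleftrightarrow> Ck_on r n W g"
  using assms(2)
proof (induction r arbitrary: f g)
  case 0
  then show ?case using Euclidean_subset[OF assms(1)]
    by (simp add: continuous_map_Euclidean_iff cong: continuous_on_cong)
next
  case (Suc r)
  have c: "continuous_map (subtopology (Euclidean_space n) W) euclidean f \<longleftrightarrow>
     continuous_map (subtopology (Euclidean_space n) W) euclidean g"
    using Euclidean_subset[OF assms(1)] Suc.prems
    by (simp add: continuous_map_Euclidean_iff cong: continuous_on_cong)
  have "Ck_on r n W (partial k f) \<longleftrightarrow> Ck_on r n W (partial k g)" if "k < n" for k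
    using partial_cong(1)[OF assms(1) _ that Suc.prems] by (intro Suc.IH) auto
  moreover have "(\<lambda>s. f (x(k := s))) differentiable (at (x k)) \<longleftrightarrow> (\<lambda>s. g (x(k := s))) differentiable (at (x k))"
    if "k < n" "x \<in> W" for k x
    using partial_cong(2)[OF assms(1) that(2,1), of f g] Suc.prems by blast
  ultimately show ?case using c by auto
qed

lemma Ck_on_imp_continuous:
  assumes "openin (Euclidean_space n) W" "Ck_on r n W f"
  shows "continuous_on W f"
  using assms(2) continuous_map_Euclidean_iff[OF Euclidean_subset[OF assms(1)]] by (cases r) auto

lemma Ck_on_SucD:
  assumes "Ck_on (Suc r) n W f" "k < n"
  shows "Ck_on r n W (partial k f)"
    and "x \<in> W \<Longrightarrow> ((\<lambda>s. f (x(k := s))) has_field_derivative partial k f x) (at (x k))"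
  using assms by (auto intro: partial_DERIV)

text \<open>\<open>partial k f\<close> is a total function, whereas a computed derivative
  \<open>f' k\<close> agrees with it on \<open>W\<close> only; \<open>Ck_on_cong\<close> bridges the
  gap. Most inductions on the order below end in this step.\<close>

lemma Ck_on_SucI:
  assumes W: "openin (Euclidean_space n) W" and "continuous_on W f"
    and D: "\<And>k x. k < n \<Longrightarrow> x \<in> W \<Longrightarrow> ((\<lambda>s. f (x(k := s))) has_field_derivative f' k x) (at (x k))"
    and "\<And>k. k < n \<Longrightarrow> Ck_on r n W (f' k)"
  shows "Ck_on (Suc r) n W f"
proof -
  have "Ck_on r n W (partial k f)" if "k < n" for k
    using Ck_on_cong[OF W, of "partial k f" "f' k" r] partial_eqI[of f _ k, OF D[OF that]] assms(4)[OF that] by blast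
  then show ?thesis using assms(2) D continuous_map_Euclidean_iff[OF Euclidean_subset[OF W]]
    by (auto simp: real_differentiable_def)
qed

lemma Ck_on_mono:
  assumes "Ck_on r n W f" "s \<le> r"
  shows "Ck_on s n W f"
proof -
  have *: "Ck_on (Suc r) n W f \<Longrightarrow> Ck_on r n W f" for r f
    by (induction r arbitrary: f) auto
  show ?thesis using assms(2,1) by (induction rule: inc_induct) (auto intro: *)
qed

lemma Ck_on_subset:
  assumes "Ck_on r n W f" "W' \<subseteq> W"
  shows "Ck_on r n W' f"
  using assms(1)
proof (induction r arbitrary: f)
  case 0
  then show ?case using assms(2) by (auto intro: continuous_map_from_subtopology_mono)
next
  case (Suc r)
  then show ?case using assms(2) by (auto intro: continuous_map_from_subtopology_mono)
qed

lemma continuous_on_Euclidean_local: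
  assumes "W \<subseteq> topspace (Euclidean_space n)"
    "\<And>x. x \<in> W \<Longrightarrow> \<exists>V. openin (Euclidean_space n) V \<and> x \<in> V \<and> continuous_on (V \<inter> W) f"
  shows "continuous_on W f"
proof (subst continuous_on_eq_continuous_within, safe)
  fix x assume x: "x \<in> W"
  obtain V where V: "openin (Euclidean_space n) V" "x \<in> V" "continuous_on (V \<inter> W) f" using assms(2)[OF x] by auto
  obtain T where T: "open T" "V = topspace (Euclidean_space n) \<inter> T"
    using V(1) by (subst (asm) Euclidean_space_eq_top_of_set) (auto simp: openin_open)
  have "V \<inter> W = W \<inter> T" using T assms(1) by auto
  then have "continuous (at x within (W \<inter> T)) f"
    using V(2,3) x by (auto simp: continuous_on_eq_continuous_within)
  moreover have "at x within (W \<inter> T) = at x within W"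
    using T V(2) by (intro at_within_nhd[of x T]) auto
  ultimately show "continuous (at x within W) f" by (simp add: continuous_within)
qed

text \<open>Differentiability is a pointwise condition already, so only continuity has to be glued
  at each order.\<close>

lemma Ck_on_local:
  assumes "W \<subseteq> topspace (Euclidean_space n)"
    "\<And>x. x \<in> W \<Longrightarrow> \<exists>V. openin (Euclidean_space n) V \<and> x \<in> V \<and> Ck_on r n V f"
  shows "Ck_on r n W f"
  using assms(2)
proof (induction r arbitrary: f)
  case 0
  have "\<exists>V. openin (Euclidean_space n) V \<and> x \<in> V \<and> continuous_on (V \<inter> W) f" if "x \<in> W" for x
    using 0[OF that] Ck_on_imp_continuous continuous_on_subset by (metis inf_le1)
  then have "continuous_on W f" by (intro continuous_on_Euclidean_local[OF assms(1)])
  then show ?case by (simp add: continuous_map_Euclidean_iff[OF assms(1)])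
next
  case (Suc r)
  have "\<exists>V. openin (Euclidean_space n) V \<and> x \<in> V \<and> continuous_on (V \<inter> W) f" if "x \<in> W" for x
    using Suc.prems[OF that] Ck_on_imp_continuous continuous_on_subset by (metis inf_le1)
  then have c: "continuous_map (subtopology (Euclidean_space n) W) euclideanreal f"
    unfolding continuous_map_Euclidean_iff[OF assms(1)] by (intro continuous_on_Euclidean_local[OF assms(1)])
  have "Ck_on r n W (partial k f)" if "k < n" for k
    by (rule Suc.IH) (use Suc.prems that in fastforce)
  moreover have "(\<lambda>s. f (x(k := s))) differentiable (at (x k))" if "k < n" "x \<in> W" for k x
    using Suc.prems[OF that(2)] that by auto
  ultimately show ?case using c by auto
qed

lemma Ck_on_const: "Ck_on r n W (\<lambda>x. c)"
proof (induction r arbitrary: c)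
  case (Suc r)
  have "partial k (\<lambda>x. c) = (\<lambda>x. 0)" for k by (auto simp: partial_def)
  then show ?case using Suc by auto
qed simp

lemma Ck_on_coord:
  assumes "openin (Euclidean_space n) W"
  shows "Ck_on r n W (\<lambda>x. x j)"
proof -
  have c: "continuous_on W (\<lambda>x. x j)"
    by (rule continuous_on_product_then_coordinatewise[OF continuous_on_id])
  show ?thesis
  proof (cases r)
    case 0
    then show ?thesis using c continuous_map_Euclidean_iff[OF Euclidean_subset[OF assms]] by simp
  next
    case (Suc r')
    show ?thesis unfolding Suc
    proof (rule Ck_on_SucI[OF assms c, where f' = "\<lambda>k x. if k = j then 1 else 0"])
      show "Ck_on r' n W (\<lambda>x. if k = j then 1 else 0)" for k by (rule Ck_on_const)
    qed (auto intro!: derivative_eq_intros)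
  qed
qed

lemma Ck_on_add:
  assumes W: "openin (Euclidean_space n) W" and "Ck_on r n W f" "Ck_on r n W g"
  shows "Ck_on r n W (\<lambda>x. f x + g x)"
  using assms(2,3)
proof (induction r arbitrary: f g)
  case 0
  then show ?case
    using Euclidean_subset[OF W] by (simp add: continuous_map_Euclidean_iff continuous_intros)
next
  case (Suc r)
  show ?case
  proof (rule Ck_on_SucI[OF W])
    show "continuous_on W (\<lambda>x. f x + g x)"
      by (intro continuous_intros Ck_on_imp_continuous[OF W Suc.prems(1)] Ck_on_imp_continuous[OF W Suc.prems(2)])
    show "((\<lambda>s. f (x(k := s)) + g (x(k := s))) has_field_derivative partial k f x + partial k g x) (at (x k))"
      if "k < n" "x \<in> W" for k x
      by (intro DERIV_add Ck_on_SucD(2)[OF Suc.prems(1)] Ck_on_SucD(2)[OF Suc.prems(2)] that)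
    show "Ck_on r n W (\<lambda>x. partial k f x + partial k g x)" if "k < n" for k
      by (intro Suc.IH Ck_on_SucD(1)[OF Suc.prems(1)] Ck_on_SucD(1)[OF Suc.prems(2)] that)
  qed
qed

lemma Ck_on_mult:
  assumes W: "openin (Euclidean_space n) W" and "Ck_on r n W f" "Ck_on r n W g"
  shows "Ck_on r n W (\<lambda>x. f x * g x)"
  using assms(2,3)
proof (induction r arbitrary: f g)
  case 0
  then show ?case
    using Euclidean_subset[OF W] by (simp add: continuous_map_Euclidean_iff continuous_intros)
next
  case (Suc r)
  show ?case
  proof (rule Ck_on_SucI[OF W])
    show "continuous_on W (\<lambda>x. f x * g x)"
      by (intro continuous_intros Ck_on_imp_continuous[OF W Suc.prems(1)] Ck_on_imp_continuous[OF W Suc.prems(2)])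
    show "((\<lambda>s. f (x(k := s)) * g (x(k := s))) has_field_derivative partial k f x * g x + f x * partial k g x) (at (x k))"
      if "k < n" "x \<in> W" for k x
      by (rule DERIV_cong, rule DERIV_mult[OF Ck_on_SucD(2)[OF Suc.prems(1) that] Ck_on_SucD(2)[OF Suc.prems(2) that]]) simp
    have "Ck_on r n W f" "Ck_on r n W g" using Suc.prems Ck_on_mono le_SucI by blast+
    then show "Ck_on r n W (\<lambda>x. partial k f x * g x + f x * partial k g x)" if "k < n" for k
      by (intro Ck_on_add[OF W] Suc.IH Ck_on_SucD(1)[OF Suc.prems(1)] Ck_on_SucD(1)[OF Suc.prems(2)] that) auto
  qed
qed

lemma Ck_on_sum:
  assumes W: "openin (Euclidean_space n) W" and "\<And>a. a \<in> A \<Longrightarrow> Ck_on r n W (f a)"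
  shows "Ck_on r n W (\<lambda>x. \<Sum>a\<in>A. f a x)"
  using assms(2) by (induction A rule: infinite_finite_induct) (auto intro: Ck_on_add[OF W] Ck_on_const)

section \<open>Coordinate boxes and Hadamard's lemma\<close>

definition box_at :: "nat \<Rightarrow> (nat \<Rightarrow> real) \<Rightarrow> real \<Rightarrow> (nat \<Rightarrow> real) set" where
  "box_at n a e = {x \<in> topspace (Euclidean_space n). \<forall>k<n. \<bar>x k - a k\<bar> < e}"

lemma openin_box_at: "openin (Euclidean_space n) (box_at n a e)"
proof -
  have "open (\<Inter>k\<in>{..<n}. (\<lambda>x. x k - a k) -` ball 0 e)"
    by (intro open_INT open_vimage) (auto intro!: continuous_intros)
  moreover have "box_at n a e = topspace (Euclidean_space n) \<inter> (\<Inter>k\<in>{..<n}. (\<lambda>x. x k - a k) -` ball 0 e)"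
    by (auto simp: box_at_def)
  ultimately show ?thesis by (subst Euclidean_space_eq_top_of_set) (auto simp: openin_open)
qed

lemma box_at_subset:
  assumes "openin (Euclidean_space n) W" "a \<in> W"
  obtains e where "e > 0" "box_at n a e \<subseteq> W"
proof -
  obtain T where T: "open T" "W = topspace (Euclidean_space n) \<inter> T"
    using assms(1) by (subst (asm) Euclidean_space_eq_top_of_set) (auto simp: openin_open)
  obtain X where X: "a \<in> Pi\<^sub>E UNIV X" "\<And>i. open (X i)" "Pi\<^sub>E UNIV X \<subseteq> T"
    using product_topology_open_contains_basis[of "\<lambda>_. euclidean" UNIV T a] T(1) assms(2) T(2)
    by (auto simp: open_fun_def)
  have "\<forall>i. \<exists>d>0. ball (a i) d \<subseteq> X i"
    using X(1,2) by (auto simp: open_contains_ball PiE_iff)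
  then obtain d where d: "\<And>i. d i > 0" "\<And>i. ball (a i) (d i) \<subseteq> X i" by metis
  \<comment> \<open>Inserting 1 keeps the set nonempty when \<open>n\<close> is 0. Only coordinates
    below \<open>n\<close> need a margin; the others vanish at \<open>x\<close> as well as at
    \<open>a\<close>.\<close>
  define e where "e = Min (insert 1 (d ` {..<n}))"
  have "e > 0" unfolding e_def using d(1) by (subst Min_gr_iff) auto
  moreover have "e \<le> d i" if "i < n" for i unfolding e_def using that by (intro Min_le) auto
  then have "box_at n a e \<subseteq> W"
  proof (intro subsetI)
    fix x assume le: "\<And>i. i < n \<Longrightarrow> e \<le> d i" and x: "x \<in> box_at n a e"
    have "x i \<in> X i" for i
    proof (cases "i < n")
      case True
      then have "dist (a i) (x i) < d i" using x le[OF True] by (force simp: box_at_def dist_real_def)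
      then show ?thesis using d(2)[of i] by (meson mem_ball subsetD)
    next
      case False
      then have "x i = a i" using x assms(2) T(2) by (auto simp: box_at_def topspace_Euclidean_space)
      then show ?thesis using X(1) by auto
    qed
    then show "x \<in> W" using X(3) T(2) x by (auto simp: box_at_def)
  qed
  ultimately show ?thesis using that by blast
qed

text \<open>A box is a product of intervals, so every coordinate may be contracted towards the
  centre by a factor of its own. This keeps the axis-parallel paths of \<open>hadamard_coeff\<close>
  inside.\<close>

lemma box_at_contract:
  assumes "x \<in> box_at n a e" "a \<in> topspace (Euclidean_space n)" "\<And>j. 0 \<le> c j \<and> c j \<le> (1::real)"
  shows "(\<lambda>j. a j + c j * (x j - a j)) \<in> box_at n a e"
proof -
  have "\<bar>c k * (x k - a k)\<bar> < e" if "k < n" for k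
  proof -
    have "\<bar>c k * (x k - a k)\<bar> \<le> 1 * \<bar>x k - a k\<bar>"
      unfolding abs_mult by (intro mult_right_mono) (use assms(3)[of k] in auto)
    then show ?thesis using assms(1) that by (auto simp: box_at_def)
  qed
  then show ?thesis using assms(1,2) by (auto simp: box_at_def topspace_Euclidean_space)
qed

text \<open>Differentiation under the integral sign, one order at a time. The weight
  \<open>w\<close> is there for the induction: a derivative in direction \<open>k\<close> produces
  the inner factor \<open>c s k\<close>, which is absorbed into \<open>w\<close>.\<close>

lemma Ck_on_integral:
  assumes a: "a \<in> topspace (Euclidean_space n)" and "Ck_on r n (box_at n a e) f"
    and "continuous_on {0..1} w" and c: "\<And>j. continuous_on {0..1::real} (\<lambda>s. c s j)"
    and c01: "\<And>s j. s \<in> {0..1} \<Longrightarrow> 0 \<le> c s j \<and> c s j \<le> (1::real)"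
  shows "Ck_on r n (box_at n a e) (\<lambda>x. integral {0..1} (\<lambda>s. w s * f (\<lambda>j. a j + c s j * (x j - a j))))"
proof -
  let ?B = "box_at n a e"
  note B = openin_box_at[of n a e]
  have cT: "continuous_on (U \<times> {0..1}) (\<lambda>(x, s). w s * h (\<lambda>j. a j + c s j * (u x j - a j)))"
    if w: "continuous_on {0..1} w" and h: "continuous_on ?B h" and u: "\<And>j. continuous_on U (\<lambda>x. u x j)"
      "u ` U \<subseteq> ?B" for w :: "real \<Rightarrow> real" and h :: "(nat \<Rightarrow> real) \<Rightarrow> real" and U :: "'z::topological_space set" and u
  proof -
    have "continuous_on (U \<times> {0..1}) (\<lambda>p. (\<lambda>j. a j + c (snd p) j * (u (fst p) j - a j)))"
      by (intro continuous_on_coordinatewise_then_product continuous_intros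
          continuous_on_compose2[OF c] continuous_on_compose2[OF u(1)]) auto
    then have h2: "continuous_on (U \<times> {0..1}) (\<lambda>p. h (\<lambda>j. a j + c (snd p) j * (u (fst p) j - a j)))"
      by (rule continuous_on_compose2[OF h]) (use u(2) a c01 in \<open>auto intro!: box_at_contract\<close>)
    have w2: "continuous_on (U \<times> {0..1}) (\<lambda>p. w (snd p))"
      by (rule continuous_on_compose2[OF w]) (auto intro!: continuous_intros)
    show ?thesis using continuous_on_mult[OF w2 h2] by (simp add: split_beta)
  qed
  have cI: "continuous_on ?B (\<lambda>x. integral {0..1} (\<lambda>s. w s * f (\<lambda>j. a j + c s j * (x j - a j))))"
    if "Ck_on r n ?B f" "continuous_on {0..1} w" for r f w
  proof -
    have "continuous_on (?B \<times> cbox 0 1) (\<lambda>(x, s). w s * f (\<lambda>j. a j + c s j * (x j - a j)))"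
      unfolding cbox_interval
      by (rule cT[OF that(2) Ck_on_imp_continuous[OF B that(1)], of ?B "\<lambda>x. x"])
        (rule continuous_on_product_then_coordinatewise[OF continuous_on_id], simp)
    from integral_continuous_on_param[OF this] show ?thesis by (simp only: cbox_interval)
  qed
  show ?thesis using assms(2,3)
  proof (induction r arbitrary: f w)
    case (Suc r)
    have cf: "continuous_on ?B f" using Ck_on_imp_continuous[OF B Suc.prems(1)] .
    show ?case
    proof (rule Ck_on_SucI[OF B])
      show "continuous_on ?B (\<lambda>x. integral {0..1} (\<lambda>s. w s * f (\<lambda>j. a j + c s j * (x j - a j))))"
        by (rule cI[OF Suc.prems])
    next
      fix k x assume k: "k < n" and x: "x \<in> ?B"
      \<comment> \<open>The values of coordinate \<open>k\<close> for which \<open>x(k := u)\<close>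
        stays in the box. They form an interval, hence a convex set, as the Leibniz rule for
        parameter integrals demands.\<close>
      define U where "U = {u. \<bar>u - a k\<bar> < e}"
      have U: "open U" "convex U" "x k \<in> U"
      proof -
        have "U = ball (a k) e" by (auto simp: U_def dist_real_def)
        then show "open U" "convex U" by auto
        show "x k \<in> U" using x k by (auto simp: U_def box_at_def)
      qed
      have xu: "x(k := u) \<in> ?B" if "u \<in> U" for u
        using x k that by (auto simp: box_at_def U_def topspace_Euclidean_space)
      have cu: "continuous_on U (\<lambda>u. (x(k := u)) j)" for j by (cases "j = k") (auto intro!: continuous_intros)
      have w': "continuous_on {0..1} (\<lambda>s. w s * c s k)" by (intro continuous_intros Suc.prems(2) c)
      have cp: "continuous_on ?B (partial k f)" using Ck_on_imp_continuous[OF B Ck_on_SucD(1)[OF Suc.prems(1) k]] .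
      have "((\<lambda>u. integral (cbox 0 1) (\<lambda>s. w s * f (\<lambda>j. a j + c s j * ((x(k := u)) j - a j)))) has_field_derivative
         integral (cbox 0 1) (\<lambda>s. (w s * c s k) * partial k f (\<lambda>j. a j + c s j * ((x(k := x k)) j - a j)))) (at (x k) within U)"
      proof (rule leibniz_rule_field_derivative)
        fix u and s :: real assume u: "u \<in> U" and s: "s \<in> cbox 0 1"
        let ?y = "\<lambda>j. a j + c s j * ((x(k := u)) j - a j)"
        have y: "?y \<in> ?B" using box_at_contract[OF xu[OF u] a, of "c s"] c01 s by auto
        have "((\<lambda>v. f (?y(k := v))) has_field_derivative partial k f ?y) (at (a k + c s k * (u - a k)))"
          using Ck_on_SucD(2)[OF Suc.prems(1) k y] by (simp only: fun_upd_same)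
        then have "((\<lambda>v. f (?y(k := a k + c s k * (v - a k)))) has_field_derivative partial k f ?y * c s k) (at u)"
          by (rule DERIV_chain2) (auto intro!: derivative_eq_intros)
        moreover have "?y(k := a k + c s k * (v - a k)) = (\<lambda>j. a j + c s j * ((x(k := v)) j - a j))" for v
          by auto
        ultimately have "((\<lambda>v. w s * f (\<lambda>j. a j + c s j * ((x(k := v)) j - a j))) has_field_derivative w s * (partial k f ?y * c s k)) (at u)"
          by (intro DERIV_cmult) simp
        then show "((\<lambda>v. w s * f (\<lambda>j. a j + c s j * ((x(k := v)) j - a j))) has_field_derivative w s * c s k * partial k f ?y) (at u within U)"
          by (auto intro: has_field_derivative_at_within simp: mult_ac)
      next
        fix u assume u: "u \<in> U"
        have "continuous_on ({x(k:=u)} \<times> {0..1}) (\<lambda>(x, s). w s * f (\<lambda>j. a j + c s j * (x j - a j)))"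
          by (rule cT[OF Suc.prems(2) cf, of "{x(k:=u)}" "\<lambda>x. x"])
            (rule continuous_on_product_then_coordinatewise[OF continuous_on_id], use xu[OF u] in simp)
        then have "continuous_on {0..1} (\<lambda>s. (\<lambda>(x, s). w s * f (\<lambda>j. a j + c s j * (x j - a j))) (x(k:=u), s))"
          by (rule continuous_on_compose2) (auto intro!: continuous_intros)
        then show "(\<lambda>s. w s * f (\<lambda>j. a j + c s j * ((x(k := u)) j - a j))) integrable_on cbox 0 1"
          unfolding cbox_interval split_conv by (rule integrable_continuous_interval)
      next
        show "continuous_on (U \<times> cbox 0 1) (\<lambda>(u, s). w s * c s k * partial k f (\<lambda>j. a j + c s j * ((x(k := u)) j - a j)))"
          using cT[of "\<lambda>s. w s * c s k" "partial k f" U "\<lambda>u. x(k := u)", OF w' cp cu] xu by (simp add: image_subset_iff)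
      qed (use U in auto)
      then show "((\<lambda>u. integral {0..1} (\<lambda>s. w s * f (\<lambda>j. a j + c s j * ((x(k := u)) j - a j)))) has_field_derivative
         integral {0..1} (\<lambda>s. (w s * c s k) * partial k f (\<lambda>j. a j + c s j * (x j - a j)))) (at (x k))"
        unfolding at_within_open[OF U(3,1)] cbox_interval by (simp only: fun_upd_triv)
    next
      fix k assume k: "k < n"
      show "Ck_on r n ?B (\<lambda>x. integral {0..1} (\<lambda>s. (w s * c s k) * partial k f (\<lambda>j. a j + c s j * (x j - a j))))"
        by (rule Suc.IH[OF Ck_on_SucD(1)[OF Suc.prems(1) k] continuous_on_mult[OF Suc.prems(2) c]])
    qed
  next
    case 0
    then show ?case using cI[of 0 f w] continuous_map_Euclidean_iff[OF Euclidean_subset[OF B]] by auto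
  qed
qed

text \<open>Replacing the coordinates of \<open>a\<close> by those of \<open>x\<close> one at a time, so that only
  the fundamental theorem of calculus along coordinate axes is needed.\<close>

definition hadamard_coeff :: "((nat \<Rightarrow> real) \<Rightarrow> real) \<Rightarrow> (nat \<Rightarrow> real) \<Rightarrow> nat \<Rightarrow> (nat \<Rightarrow> real) \<Rightarrow> real" where
  "hadamard_coeff f a k x = integral {0..1} (\<lambda>s. partial k f
     (\<lambda>j. a j + (if j < k then 1 else if j = k then s else 0) * (x j - a j)))"

lemma hadamard_coeff_at: "hadamard_coeff f a k a = partial k f a"
  by (simp add: hadamard_coeff_def)

lemma Ck_on_hadamard_coeff:
  assumes "a \<in> topspace (Euclidean_space n)" "Ck_on (Suc r) n (box_at n a e) f" "k < n"
  shows "Ck_on r n (box_at n a e) (hadamard_coeff f a k)"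
proof -
  have "Ck_on r n (box_at n a e) (\<lambda>x. integral {0..1} (\<lambda>s. (\<lambda>_. 1) s * partial k f
     (\<lambda>j. a j + (if j < k then 1 else if j = k then s else 0) * (x j - a j))))"
  proof (rule Ck_on_integral[OF assms(1) Ck_on_SucD(1)[OF assms(2,3)]])
    show "continuous_on {0..1::real} (\<lambda>s. if j < k then 1 else if j = k then s else 0)" for j
      by (cases "j < k"; cases "j = k") (auto intro: continuous_intros)
  qed auto
  then show ?thesis by (simp add: hadamard_coeff_def[abs_def])
qed

lemma hadamard:
  assumes a: "a \<in> topspace (Euclidean_space n)" and f: "Ck_on (Suc 0) n (box_at n a e) f"
    and x: "x \<in> box_at n a e"
  shows "f x = f a + (\<Sum>k<n. (x k - a k) * hadamard_coeff f a k x)"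
proof -
  define y where "y m = (\<lambda>j. if j < m then x j else a j)" for m
  note B = openin_box_at[of n a e]
  have *: "f (y (Suc k)) - f (y k) = (x k - a k) * hadamard_coeff f a k x" if k: "k < n" for k
  proof -
    let ?T = "\<lambda>s j. a j + (if j < k then 1 else if j = k then s else 0) * (x j - a j)"
    have T: "?T s = (y k)(k := a k + s * (x k - a k))" for s by (auto simp: y_def)
    have TB: "?T s \<in> box_at n a e" if "s \<in> {0..1}" for s
      by (rule box_at_contract[OF x a]) (use that in auto)
    have "((\<lambda>s. f (?T s)) has_vector_derivative (x k - a k) * partial k f (?T s)) (at s within {0..1})"
      if s: "s \<in> {0..1}" for s
    proof -
      have "((\<lambda>v. f ((?T s)(k := v))) has_field_derivative partial k f (?T s)) (at (a k + s * (x k - a k)))"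
        using Ck_on_SucD(2)[OF f k TB[OF s]] by simp
      then have "((\<lambda>v. f ((?T s)(k := a k + v * (x k - a k)))) has_field_derivative partial k f (?T s) * (x k - a k)) (at s)"
        by (rule DERIV_chain2) (auto intro!: derivative_eq_intros)
      moreover have "(?T s)(k := a k + v * (x k - a k)) = ?T v" for v
        by auto
      ultimately show ?thesis
        by (simp add: has_real_derivative_iff_has_vector_derivative[symmetric] mult.commute has_field_derivative_at_within)
    qed
    then have "((\<lambda>s. (x k - a k) * partial k f (?T s)) has_integral f (?T 1) - f (?T 0)) {0..1}"
      by (intro fundamental_theorem_of_calculus) auto
    then have "f (?T 1) - f (?T 0) = integral {0..1} (\<lambda>s. (x k - a k) * partial k f (?T s))"
      by (rule integral_unique[symmetric])
    also have "\<dots> = (x k - a k) * integral {0..1} (\<lambda>s. partial k f (?T s))"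
      by (rule integral_mult_right)
    finally have "f (?T 1) - f (?T 0) = (x k - a k) * integral {0..1} (\<lambda>s. partial k f (?T s))" .
    moreover have "?T 1 = y (Suc k)" "?T 0 = y k" by (auto simp: y_def less_Suc_eq)
    ultimately show ?thesis by (simp add: hadamard_coeff_def)
  qed
  have "y n = x" using x a by (auto simp: y_def box_at_def topspace_Euclidean_space)
  moreover have "y 0 = a" by (auto simp: y_def)
  ultimately have "f x - f a = (\<Sum>k<n. f (y (Suc k)) - f (y k))"
    using sum_lessThan_telescope[of "\<lambda>k. f (y k)" n] by simp
  also have "\<dots> = (\<Sum>k<n. (x k - a k) * hadamard_coeff f a k x)" using * by (intro sum.cong) auto
  finally show ?thesis by simp
qed

text \<open>At a zero of \<open>u\<close> the product rule asks only continuity of \<open>v\<close>.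
  The Hadamard coefficients of a C^1 function are merely continuous, so this form is the one that
  applies to them.\<close>

lemma DERIV_mult_vanishing:
  fixes u v :: "real \<Rightarrow> real"
  assumes "(u has_field_derivative d) (at s)" "u s = 0" "(v \<longlongrightarrow> v s) (at s)"
  shows "((\<lambda>x. u x * v x) has_field_derivative d * v s) (at s)"
proof -
  have "((\<lambda>y. (u y - u s) / (y - s) * v y) \<longlongrightarrow> d * v s) (at s)"
    using assms by (intro tendsto_mult) (auto simp: has_field_derivative_iff)
  then show ?thesis using assms(2) by (simp add: has_field_derivative_iff field_simps)
qed

text \<open>By \<open>hadamard\<close>, the increment of \<open>f\<close> along the curve is a sum
  of products, each with a factor that vanishes at \<open>s0\<close>, and
  \<open>DERIV_mult_vanishing\<close> differentiates it. Continuous partial derivatives suffice, and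
  no total derivative is introduced.\<close>

lemma chain_rule_coords:
  assumes W: "openin (Euclidean_space n) W" and f: "Ck_on (Suc 0) n W f"
    and \<gamma>: "\<And>s. \<gamma> s \<in> topspace (Euclidean_space n)" "\<gamma> s0 \<in> W"
    and d: "\<And>k. k < n \<Longrightarrow> ((\<lambda>s. \<gamma> s k) has_field_derivative d k) (at s0)"
  shows "((\<lambda>s. f (\<gamma> s)) has_field_derivative (\<Sum>k<n. d k * partial k f (\<gamma> s0))) (at s0)"
proof -
  let ?a = "\<gamma> s0"
  obtain e where e: "e > 0" "box_at n ?a e \<subseteq> W" using box_at_subset[OF W \<gamma>(2)] .
  let ?B = "box_at n ?a e"
  note B = openin_box_at[of n ?a e]
  have fB: "Ck_on (Suc 0) n ?B f" using f e(2) by (rule Ck_on_subset)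
  have aB: "?a \<in> ?B" using e(1) \<gamma>(1) by (auto simp: box_at_def)
  have tk: "((\<lambda>s. \<gamma> s k) \<longlongrightarrow> ?a k) (nhds s0)" for k
  proof (cases "k < n")
    case True
    show ?thesis using DERIV_isCont[OF d[OF True]] tendsto_at_iff_tendsto_nhds[of "\<lambda>s. \<gamma> s k" s0]
      by (simp add: isCont_def)
  next
    case False
    then have "\<gamma> s k = 0" for s using \<gamma>(1)[of s] by (simp add: topspace_Euclidean_space)
    then show ?thesis by simp
  qed
  have ev: "\<forall>\<^sub>F s in nhds s0. \<gamma> s \<in> ?B"
  proof -
    have "\<forall>\<^sub>F s in nhds s0. \<forall>k\<in>{..<n}. \<bar>\<gamma> s k - ?a k\<bar> < e"
    proof (rule eventually_ball_finite, simp, rule ballI)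
      fix k assume "k \<in> {..<n}"
      have "\<forall>\<^sub>F s in nhds s0. dist (\<gamma> s k) (?a k) < e" using tk e(1) by (rule tendstoD)
      then show "\<forall>\<^sub>F s in nhds s0. \<bar>\<gamma> s k - ?a k\<bar> < e" by (simp add: dist_real_def)
    qed
    then show ?thesis by eventually_elim (use \<gamma>(1) in \<open>auto simp: box_at_def\<close>)
  qed
  have t: "(\<gamma> \<longlongrightarrow> ?a) (nhds s0)"
    using tk limitin_componentwise[of "\<lambda>_. euclidean" UNIV \<gamma> ?a "nhds s0"]
    by (simp add: euclidean_product_topology)
  have h: "((\<lambda>s. hadamard_coeff f ?a k (\<gamma> s)) \<longlongrightarrow> hadamard_coeff f ?a k ?a) (at s0)" if k: "k < n" for k
  proof -
    have "continuous_on ?B (hadamard_coeff f ?a k)"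
      using Ck_on_imp_continuous[OF B Ck_on_hadamard_coeff[OF \<gamma>(1) fB k]] .
    then have "((\<lambda>s. hadamard_coeff f ?a k (\<gamma> s)) \<longlongrightarrow> hadamard_coeff f ?a k ?a) (nhds s0)"
      by (rule continuous_on_tendsto_compose[OF _ t aB ev])
    then show ?thesis using tendsto_at_iff_tendsto_nhds[of "\<lambda>s. hadamard_coeff f ?a k (\<gamma> s)" s0] by simp
  qed
  have "((\<lambda>s. f ?a + (\<Sum>k<n. (\<gamma> s k - ?a k) * hadamard_coeff f ?a k (\<gamma> s))) has_field_derivative
     0 + (\<Sum>k<n. d k * hadamard_coeff f ?a k (\<gamma> s0))) (at s0)"
  proof (rule DERIV_add[OF DERIV_const], rule DERIV_sum, rule DERIV_mult_vanishing)
    show "((\<lambda>s. \<gamma> s k - ?a k) has_field_derivative d k) (at s0)" if "k \<in> {..<n}" for k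
      using DERIV_diff[OF d DERIV_const[of "?a k"]] that by simp
  qed (use h in auto)
  moreover have "\<forall>\<^sub>F s in nhds s0. f (\<gamma> s) = f ?a + (\<Sum>k<n. (\<gamma> s k - ?a k) * hadamard_coeff f ?a k (\<gamma> s))"
    using ev by eventually_elim (rule hadamard[OF \<gamma>(1) fB])
  ultimately show ?thesis
    by (subst DERIV_cong_ev[OF refl _ refl]) (auto simp: hadamard_coeff_at)
qed

lemma partial_compose:
  assumes W: "openin (Euclidean_space n) W" and W': "openin (Euclidean_space n') W'"
    and u: "\<And>k. k < n' \<Longrightarrow> Ck_on (Suc 0) n W (u k)" and G: "Ck_on (Suc 0) n' W' G"
    and WW': "\<And>x. x \<in> W \<Longrightarrow> (\<lambda>k. if k < n' then u k x else 0) \<in> W'"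
    and x: "x \<in> W" "i < n"
  shows "((\<lambda>s. G (\<lambda>k. if k < n' then u k (x(i := s)) else 0)) has_field_derivative
     (\<Sum>k<n'. partial i (u k) x * partial k G (\<lambda>k. if k < n' then u k x else 0))) (at (x i))"
proof -
  have "((\<lambda>s. G ((\<lambda>s k. if k < n' then u k (x(i := s)) else 0) s)) has_field_derivative
     (\<Sum>k<n'. partial i (u k) x * partial k G ((\<lambda>s k. if k < n' then u k (x(i := s)) else 0) (x i)))) (at (x i))"
  proof (rule chain_rule_coords[OF W' G])
    show "(\<lambda>k. if k < n' then u k (x(i := s)) else 0) \<in> topspace (Euclidean_space n')" for s
      by (auto simp: topspace_Euclidean_space)
    show "(\<lambda>k. if k < n' then u k (x(i := x i)) else 0) \<in> W'" using WW'[OF x(1)] by (simp only: fun_upd_triv)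
    show "((\<lambda>s. if k < n' then u k (x(i := s)) else 0) has_field_derivative partial i (u k) x) (at (x i))"
      if "k < n'" for k using Ck_on_SucD(2)[OF u[OF that] x(2,1)] that by simp
  qed
  then show ?thesis by (simp only: fun_upd_triv)
qed

text \<open>Induction on the order with \<open>G\<close> varying: the chain rule replaces
  \<open>G\<close> by its partial derivatives, composed with the same inner functions
  \<open>u k\<close>. Padding by zero from index \<open>n'\<close> on makes the inner value a point
  of \<open>Euclidean_space n'\<close>.\<close>

lemma Ck_on_compose:
  assumes W: "openin (Euclidean_space n) W" and W': "openin (Euclidean_space n') W'"
    and "\<And>k. k < n' \<Longrightarrow> Ck_on r n W (u k)" and "Ck_on r n' W' G"
    and WW': "\<And>x. x \<in> W \<Longrightarrow> (\<lambda>k. if k < n' then u k x else 0) \<in> W'"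
  shows "Ck_on r n W (\<lambda>x. G (\<lambda>k. if k < n' then u k x else 0))"
proof -
  have c: "continuous_on W (\<lambda>x. G (\<lambda>k. if k < n' then u k x else 0))"
    if "\<And>k. k < n' \<Longrightarrow> Ck_on r n W (u k)" and "Ck_on r n' W' G" for r G
  proof (rule continuous_on_compose2[OF Ck_on_imp_continuous[OF W' that(2)]])
    show "continuous_on W (\<lambda>x k. if k < n' then u k x else 0)"
    proof (rule continuous_on_coordinatewise_then_product)
      show "continuous_on W (\<lambda>x. if k < n' then u k x else 0)" for k
        using Ck_on_imp_continuous[OF W that(1)] by (cases "k < n'") auto
    qed
  qed (use WW' in auto)
  show ?thesis using assms(3,4)
  proof (induction r arbitrary: G)
    case 0
    then show ?case using c[of 0 G] by (auto simp: continuous_map_Euclidean_iff[OF Euclidean_subset[OF W]])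
  next
    case (Suc r)
    have u: "Ck_on r n W (u k)" "Ck_on (Suc 0) n W (u k)" if "k < n'" for k
      by (rule Ck_on_mono[OF Suc.prems(1)[OF that]]; simp)+
    have G: "Ck_on (Suc 0) n' W' G" by (rule Ck_on_mono[OF Suc.prems(2)]) simp
    show ?case
    proof (rule Ck_on_SucI[OF W])
      show "continuous_on W (\<lambda>x. G (\<lambda>k. if k < n' then u k x else 0))"
        by (rule c[OF Suc.prems])
      show "((\<lambda>s. G (\<lambda>k. if k < n' then u k (x(i := s)) else 0)) has_field_derivative
       (\<Sum>k<n'. partial i (u k) x * partial k G (\<lambda>k. if k < n' then u k x else 0))) (at (x i))"
        if "i < n" "x \<in> W" for i x
        by (rule partial_compose[OF W W' u(2) G WW' that(2,1)])
      show "Ck_on r n W (\<lambda>x. \<Sum>k<n'. partial i (u k) x * partial k G (\<lambda>k. if k < n' then u k x else 0))"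
        if "i < n" for i
      proof (rule Ck_on_sum[OF W], rule Ck_on_mult[OF W])
        fix k assume "k \<in> {..<n'}"
        then have k: "k < n'" by simp
        show "Ck_on r n W (partial i (u k))" by (rule Ck_on_SucD(1)[OF Suc.prems(1)[OF k] that])
        show "Ck_on r n W (\<lambda>x. partial k G (\<lambda>k. if k < n' then u k x else 0))"
          by (rule Suc.IH[OF u(1) Ck_on_SucD(1)[OF Suc.prems(2) k]])
      qed
    qed
  qed
qed

section \<open>Functions of one real variable as functions of coordinate 0\<close>

lemma openin_Euclidean_1:
  assumes "open I"
  shows "openin (Euclidean_space (Suc 0)) {x \<in> topspace (Euclidean_space (Suc 0)). x 0 \<in> I}"
proof -
  have "open ((\<lambda>x::nat\<Rightarrow>real. x 0) -` I)"
    using assms by (rule open_vimage) (rule continuous_on_product_then_coordinatewise[OF continuous_on_id])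
  then show ?thesis
    by (subst Euclidean_space_eq_top_of_set) (auto simp: openin_open)
qed

text \<open>Puts \<phi> and its derivatives in the form that \<open>Ck_on_compose\<close> accepts.
  Since \<open>I\<close> is open, \<open>differentiable_on\<close> yields two-sided derivatives; the
  induction passes from \<open>h\<close> to \<open>deriv h\<close>, which is again smooth on
  \<open>I\<close>.\<close>

lemma Ck_on_real_function:
  assumes I: "open I" and "smooth_real_on I h"
  shows "Ck_on r (Suc 0) {x \<in> topspace (Euclidean_space (Suc 0)). x 0 \<in> I} (\<lambda>x. h (x 0))"
proof -
  let ?W = "{x \<in> topspace (Euclidean_space (Suc 0)). x 0 \<in> I}"
  note W = openin_Euclidean_1[OF I]
  have D: "(h has_field_derivative deriv h t) (at t)" if "smooth_real_on I h" "t \<in> I" for h t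
  proof -
    have "h differentiable_on I" using that(1)[unfolded smooth_real_on_def, rule_format, of 0] by simp
    then have "h differentiable (at t within I)"
      using that(2) unfolding differentiable_on_def by blast
    then have "h differentiable (at t)" by (simp only: at_within_open[OF that(2) I])
    then obtain d where d: "(h has_field_derivative d) (at t)"
      by (rule real_differentiable_def[THEN iffD1, THEN exE])
    show ?thesis using d unfolding DERIV_imp_deriv[OF d] .
  qed
  have c: "continuous_on ?W (\<lambda>x. h (x 0))" if "smooth_real_on I h" for h
  proof (rule continuous_on_compose2[of I h ?W "\<lambda>x. x 0"])
    show "continuous_on I h"
      by (rule continuous_at_imp_continuous_on) (use DERIV_isCont[OF D[OF that]] in simp)
    show "continuous_on ?W (\<lambda>x. x 0)" by (rule continuous_on_product_then_coordinatewise[OF continuous_on_id])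
  qed auto
  show ?thesis using assms(2)
  proof (induction r arbitrary: h)
    case 0
    then show ?case using c[of h] unfolding Ck_on.simps continuous_map_Euclidean_iff[OF Euclidean_subset[OF W]] by blast
  next
    case (Suc r)
    have "smooth_real_on I (deriv h)"
      unfolding smooth_real_on_def
    proof
      fix k show "(deriv ^^ k) (deriv h) differentiable_on I"
        using Suc.prems[unfolded smooth_real_on_def, rule_format, of "Suc k"] by (simp add: funpow_swap1)
    qed
    then have "Ck_on r (Suc 0) ?W (\<lambda>x. deriv h (x 0))" by (rule Suc.IH)
    moreover have "((\<lambda>s. h ((x(k := s)) 0)) has_field_derivative deriv h (x 0)) (at (x k))"
      if "k < Suc 0" "x \<in> ?W" for k x
      using that D[OF Suc.prems, of "x 0"] by simp
    ultimately show ?case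
      using Ck_on_SucI[OF W c[OF Suc.prems], where f' = "\<lambda>k x. deriv h (x 0)"] by blast
  qed
qed

lemma Ck_on_powr:
  "Ck_on r (Suc 0) {x \<in> topspace (Euclidean_space (Suc 0)). x 0 \<in> {0<..}} (\<lambda>x. x 0 powr a)"
proof -
  let ?W = "{x \<in> topspace (Euclidean_space (Suc 0)). x 0 \<in> {0<..}}"
  note W = openin_Euclidean_1[OF open_greaterThan[of "0::real"]]
  have c: "continuous_on ?W (\<lambda>x. x 0 powr a)" for a
    by (intro continuous_intros continuous_on_product_then_coordinatewise[OF continuous_on_id]) auto
  show ?thesis
  proof (induction r arbitrary: a)
    case 0
    then show ?case using c[of a] unfolding Ck_on.simps continuous_map_Euclidean_iff[OF Euclidean_subset[OF W]] by blast
  next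
    case (Suc r)
    have "Ck_on r (Suc 0) ?W (\<lambda>x. a * x 0 powr (a - 1))" by (intro Ck_on_mult[OF W] Ck_on_const Suc.IH)
    moreover have "((\<lambda>s. (x(k := s)) 0 powr a) has_field_derivative a * x 0 powr (a - 1)) (at (x k))"
      if "k < Suc 0" "x \<in> ?W" for k x
      using that has_real_derivative_powr[of "x 0" a] by simp
    ultimately show ?case
      using Ck_on_SucI[OF W c[of a], where f' = "\<lambda>k x. a * x 0 powr (a - 1)"] by blast
  qed
qed

section \<open>Charts, smooth functions and tangent vectors\<close>

text \<open>What an atlas provides, in a form that the fibres and their product both instantiate, so
  that the same lemmas serve for all of them.\<close>

locale charted =
  fixes M :: "'a mfd"
  assumes atlas_cover: "\<Union> (fst ` atlas M) = topspace (mtop M)"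
    and chart_open: "(V, \<psi>) \<in> atlas M \<Longrightarrow> openin (mtop M) V"
    and chart_image: "(V, \<psi>) \<in> atlas M \<Longrightarrow> openin (Euclidean_space (mdim M)) (\<psi> ` V)"
    and chart_homeo: "(V, \<psi>) \<in> atlas M \<Longrightarrow> homeomorphic_map (subtopology (mtop M) V)
          (subtopology (Euclidean_space (mdim M)) (\<psi> ` V)) \<psi>"
    and transition: "(V, \<psi>) \<in> atlas M \<Longrightarrow> (V', \<psi>') \<in> atlas M \<Longrightarrow> k < mdim M \<Longrightarrow>
        Cinf_on (mdim M) (\<psi> ` (V \<inter> V')) (\<lambda>x. \<psi>' (inv_into V \<psi> x) k)"

lemma smooth_manifold_charted:
  assumes "smooth_manifold M"
  shows "charted M"
proof
  note * = assms[unfolded smooth_manifold_def]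
  show "\<Union> (fst ` atlas M) = topspace (mtop M)" using * by simp
  show "openin (mtop M) V" "openin (Euclidean_space (mdim M)) (\<psi> ` V)"
    "homeomorphic_map (subtopology (mtop M) V) (subtopology (Euclidean_space (mdim M)) (\<psi> ` V)) \<psi>"
    if "(V, \<psi>) \<in> atlas M" for V \<psi>
  proof -
    have "\<forall>(V, \<psi>) \<in> atlas M.
        openin (mtop M) V \<and> openin (Euclidean_space (mdim M)) (\<psi> ` V) \<and>
        homeomorphic_map (subtopology (mtop M) V)
          (subtopology (Euclidean_space (mdim M)) (\<psi> ` V)) \<psi>" using * by simp
    from bspec[OF this that] show "openin (mtop M) V" "openin (Euclidean_space (mdim M)) (\<psi> ` V)"
      "homeomorphic_map (subtopology (mtop M) V) (subtopology (Euclidean_space (mdim M)) (\<psi> ` V)) \<psi>"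
      by (simp_all only: split_conv)
  qed
  show "Cinf_on (mdim M) (\<psi> ` (V \<inter> V')) (\<lambda>x. \<psi>' (inv_into V \<psi> x) k)"
    if "(V, \<psi>) \<in> atlas M" "(V', \<psi>') \<in> atlas M" "k < mdim M" for V \<psi> V' \<psi>' k
  proof -
    have "\<forall>(V, \<psi>) \<in> atlas M. \<forall>(V', \<psi>') \<in> atlas M. \<forall>k < mdim M.
        Cinf_on (mdim M) (\<psi> ` (V \<inter> V')) (\<lambda>x. \<psi>' (inv_into V \<psi> x) k)" using * by simp
    from bspec[OF this that(1)] have "\<forall>(V', \<psi>') \<in> atlas M. \<forall>k < mdim M.
        Cinf_on (mdim M) (\<psi> ` (V \<inter> V')) (\<lambda>x. \<psi>' (inv_into V \<psi> x) k)" by (simp only: split_conv)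
    from bspec[OF this that(2)] show ?thesis using that(3) by (simp only: split_conv)
  qed
qed

context charted
begin

abbreviation "n \<equiv> mdim M"
abbreviation "opn \<equiv> openin (mtop M)"
abbreviation "E \<equiv> Euclidean_space (mdim M)"

lemma chart_subset: "(V, \<psi>) \<in> atlas M \<Longrightarrow> V \<subseteq> topspace (mtop M)"
  using chart_open openin_subset by blast

lemma chart_inj:
  assumes "(V, \<psi>) \<in> atlas M"
  shows "inj_on \<psi> V"
proof -
  have "inj_on \<psi> (topspace (subtopology (mtop M) V))"
    using homeomorphic_imp_injective_map[OF chart_homeo[OF assms]] .
  then show ?thesis using chart_subset[OF assms] by (simp add: Int_absorb1)
qed

lemma chart_inv [simp]: "(V, \<psi>) \<in> atlas M \<Longrightarrow> p \<in> V \<Longrightarrow> inv_into V \<psi> (\<psi> p) = p"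
  using chart_inj by simp

lemma chart_image_open:
  assumes "(V, \<psi>) \<in> atlas M" "opn U"
  shows "openin E (\<psi> ` (U \<inter> V))"
proof -
  have "openin (subtopology (mtop M) V) (U \<inter> V)"
    using assms(2) by (auto simp: openin_subtopology)
  then have "openin (subtopology E (\<psi> ` V)) (\<psi> ` (U \<inter> V))"
    using homeomorphic_map_openness_eq[OF chart_homeo[OF assms(1)]] by blast
  then show ?thesis using chart_image[OF assms(1)] by (rule openin_trans_full)
qed

lemma chart_preimage_open:
  assumes "(V, \<psi>) \<in> atlas M" "openin E B"
  shows "opn {p \<in> V. \<psi> p \<in> B}"
proof -
  have "continuous_map (subtopology (mtop M) V) (subtopology E (\<psi> ` V)) \<psi>"
    using chart_homeo[OF assms(1)] by (rule homeomorphic_imp_continuous_map)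
  then have "continuous_map (subtopology (mtop M) V) E \<psi>"
    using continuous_map_into_fulltopology by blast
  then have "openin (subtopology (mtop M) V) {p \<in> topspace (subtopology (mtop M) V). \<psi> p \<in> B}"
    using assms(2) by (rule openin_continuous_map_preimage)
  moreover have "topspace (subtopology (mtop M) V) = V"
    using chart_subset[OF assms(1)] by auto
  ultimately show ?thesis using chart_open[OF assms(1)] openin_trans_full by metis
qed

lemma chart_at:
  assumes "p \<in> topspace (mtop M)"
  obtains V \<psi> where "(V, \<psi>) \<in> atlas M" "p \<in> V"
proof -
  have "p \<in> \<Union> (fst ` atlas M)" using assms by (simp only: atlas_cover)
  then obtain z where "z \<in> atlas M" "p \<in> fst z" by blast
  then show ?thesis using that[of "fst z" "snd z"] by simp
qed

section \<open>Smooth functions on a charted space\<close>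

lemma smooth_on_openin: "smooth_on M U f \<Longrightarrow> opn U"
  by (simp add: smooth_on_def)

lemma smooth_on_Cinf: "smooth_on M U f \<Longrightarrow> (V, \<psi>) \<in> atlas M \<Longrightarrow>
    Cinf_on n (\<psi> ` (U \<inter> V)) (f \<circ> inv_into V \<psi>)"
  by (auto simp: smooth_on_def)

lemma smooth_onI:
  assumes "opn U" "\<And>V \<psi>. (V, \<psi>) \<in> atlas M \<Longrightarrow> Cinf_on n (\<psi> ` (U \<inter> V)) (f \<circ> inv_into V \<psi>)"
  shows "smooth_on M U f"
  using assms by (auto simp: smooth_on_def)

lemma smooth_on_subset:
  assumes "smooth_on M U f" "opn W" "W \<subseteq> U"
  shows "smooth_on M W f"
proof (rule smooth_onI[OF assms(2)])
  fix V \<psi> assume "(V, \<psi>) \<in> atlas M"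
  then have "Cinf_on n (\<psi> ` (U \<inter> V)) (f \<circ> inv_into V \<psi>)" using assms(1) smooth_on_Cinf by blast
  moreover have "\<psi> ` (W \<inter> V) \<subseteq> \<psi> ` (U \<inter> V)" using assms(3) by auto
  ultimately show "Cinf_on n (\<psi> ` (W \<inter> V)) (f \<circ> inv_into V \<psi>)"
    unfolding Cinf_on_def using Ck_on_subset by blast
qed

lemma smooth_on_local:
  assumes "\<And>p. p \<in> U \<Longrightarrow> \<exists>W. p \<in> W \<and> W \<subseteq> U \<and> smooth_on M W f"
  shows "smooth_on M U f"
proof (rule smooth_onI)
  show U: "opn U"
    using assms smooth_on_openin openin_subopen[of "mtop M" U] by meson
  fix V \<psi> assume V: "(V, \<psi>) \<in> atlas M"
  show "Cinf_on n (\<psi> ` (U \<inter> V)) (f \<circ> inv_into V \<psi>)" unfolding Cinf_on_def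
  proof (intro allI Ck_on_local)
    show "\<psi> ` (U \<inter> V) \<subseteq> topspace E" using chart_image_open[OF V U] openin_subset by blast
    fix r x assume "x \<in> \<psi> ` (U \<inter> V)"
    then obtain p where p: "p \<in> U" "p \<in> V" "x = \<psi> p" by auto
    obtain W where W: "p \<in> W" "smooth_on M W f" using assms[OF p(1)] by auto
    have "openin E (\<psi> ` (W \<inter> V))" "x \<in> \<psi> ` (W \<inter> V)" "Ck_on r n (\<psi> ` (W \<inter> V)) (f \<circ> inv_into V \<psi>)"
      using chart_image_open[OF V smooth_on_openin[OF W(2)]] p W smooth_on_Cinf[OF W(2) V]
      by (auto simp: Cinf_on_def)
    then show "\<exists>T. openin E T \<and> x \<in> T \<and> Ck_on r n T (f \<circ> inv_into V \<psi>)" by blast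
  qed
qed

lemma smooth_on_cong:
  assumes "smooth_on M U f" "\<And>p. p \<in> U \<Longrightarrow> f p = g p"
  shows "smooth_on M U g"
proof (rule smooth_onI)
  show U: "opn U" using assms(1) by (rule smooth_on_openin)
  fix V \<psi> assume V: "(V, \<psi>) \<in> atlas M"
  have "(f \<circ> inv_into V \<psi>) y = (g \<circ> inv_into V \<psi>) y" if "y \<in> \<psi> ` (U \<inter> V)" for y
    using that assms(2) V by auto
  then show "Cinf_on n (\<psi> ` (U \<inter> V)) (g \<circ> inv_into V \<psi>)"
    using Ck_on_cong[OF chart_image_open[OF V U]] smooth_on_Cinf[OF assms(1) V]
    unfolding Cinf_on_def by blast
qed

text \<open>Closure under smooth functions of several variables. Composition with \<phi>, with real
  powers and with functions of chart coordinates are the instances used later.\<close>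

lemma smooth_on_compose:
  assumes U: "opn U" and W': "openin (Euclidean_space n') W'" and u: "\<And>k. k < n' \<Longrightarrow> smooth_on M U (u k)"
    and G: "Cinf_on n' W' G" and UW: "\<And>p. p \<in> U \<Longrightarrow> (\<lambda>k. if k < n' then u k p else 0) \<in> W'"
  shows "smooth_on M U (\<lambda>p. G (\<lambda>k. if k < n' then u k p else 0))"
proof (rule smooth_onI[OF U])
  fix V \<psi> assume V: "(V, \<psi>) \<in> atlas M"
  have "Ck_on r n (\<psi> ` (U \<inter> V)) (\<lambda>x. G (\<lambda>k. if k < n' then (u k \<circ> inv_into V \<psi>) x else 0))" for r
  proof (rule Ck_on_compose[OF chart_image_open[OF V U] W'])
    show "Ck_on r n (\<psi> ` (U \<inter> V)) (u k \<circ> inv_into V \<psi>)" if "k < n'" for k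
      using smooth_on_Cinf[OF u[OF that] V] by (simp add: Cinf_on_def)
    show "Ck_on r n' W' G" using G by (simp add: Cinf_on_def)
    show "(\<lambda>k. if k < n' then (u k \<circ> inv_into V \<psi>) x else 0) \<in> W'" if x: "x \<in> \<psi> ` (U \<inter> V)" for x
    proof -
      obtain p where "p \<in> U" "inv_into V \<psi> x = p" using x V by auto
      then show ?thesis using UW[of p] by (simp add: o_def cong: if_cong)
    qed
  qed
  then show "Cinf_on n (\<psi> ` (U \<inter> V)) ((\<lambda>p. G (\<lambda>k. if k < n' then u k p else 0)) \<circ> inv_into V \<psi>)"
    unfolding Cinf_on_def o_def by blast
qed

lemma smooth_on_const: "opn U \<Longrightarrow> smooth_on M U (\<lambda>p. c)"
  by (rule smooth_onI) (auto simp: Cinf_on_def o_def Ck_on_const)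

lemma smooth_on_add:
  assumes "smooth_on M U f" "smooth_on M U g"
  shows "smooth_on M U (\<lambda>p. f p + g p)"
proof (rule smooth_onI)
  show U: "opn U" using assms(1) by (rule smooth_on_openin)
  fix V \<psi> assume V: "(V, \<psi>) \<in> atlas M"
  show "Cinf_on n (\<psi> ` (U \<inter> V)) ((\<lambda>p. f p + g p) \<circ> inv_into V \<psi>)"
    using smooth_on_Cinf[OF assms(1) V] smooth_on_Cinf[OF assms(2) V]
      Ck_on_add[OF chart_image_open[OF V U], where f = "f \<circ> inv_into V \<psi>" and g = "g \<circ> inv_into V \<psi>"]
    by (simp add: Cinf_on_def o_def)
qed

lemma smooth_on_mult:
  assumes "smooth_on M U f" "smooth_on M U g"
  shows "smooth_on M U (\<lambda>p. f p * g p)"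
proof (rule smooth_onI)
  show U: "opn U" using assms(1) by (rule smooth_on_openin)
  fix V \<psi> assume V: "(V, \<psi>) \<in> atlas M"
  show "Cinf_on n (\<psi> ` (U \<inter> V)) ((\<lambda>p. f p * g p) \<circ> inv_into V \<psi>)"
    using smooth_on_Cinf[OF assms(1) V] smooth_on_Cinf[OF assms(2) V]
      Ck_on_mult[OF chart_image_open[OF V U], where f = "f \<circ> inv_into V \<psi>" and g = "g \<circ> inv_into V \<psi>"]
    by (simp add: Cinf_on_def o_def)
qed

lemma smooth_on_cmult: "smooth_on M U f \<Longrightarrow> smooth_on M U (\<lambda>p. c * f p)"
  by (intro smooth_on_mult smooth_on_const smooth_on_openin)

lemma smooth_on_minus: "smooth_on M U f \<Longrightarrow> smooth_on M U (\<lambda>p. - f p)"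
  using smooth_on_cmult[of U f "- 1"] by simp

lemma smooth_on_diff:
  assumes "smooth_on M U f" "smooth_on M U g"
  shows "smooth_on M U (\<lambda>p. f p - g p)"
  using smooth_on_add[OF assms(1) smooth_on_minus[OF assms(2)]] by simp

lemma smooth_on_sum:
  assumes "opn U" "\<And>a. a \<in> A \<Longrightarrow> smooth_on M U (f a)"
  shows "smooth_on M U (\<lambda>p. \<Sum>a\<in>A. f a p)"
  using assms(2) by (induction A rule: infinite_finite_induct)
    (simp_all add: smooth_on_const[OF assms(1)] smooth_on_add)

lemma smooth_on_real_compose:
  assumes f: "smooth_on M U f" and I: "open I" "smooth_real_on I h" "\<And>p. p \<in> U \<Longrightarrow> f p \<in> I"
  shows "smooth_on M U (\<lambda>p. h (f p))"
proof -
  have "smooth_on M U (\<lambda>p. (\<lambda>x. h (x 0)) (\<lambda>k. if k < Suc 0 then (\<lambda>_. f) k p else 0))"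
  proof (rule smooth_on_compose[OF smooth_on_openin[OF f] openin_Euclidean_1[OF I(1)]])
    show "Cinf_on (Suc 0) {x \<in> topspace (Euclidean_space (Suc 0)). x 0 \<in> I} (\<lambda>x. h (x 0))"
      using Ck_on_real_function[OF I(1,2)] by (simp add: Cinf_on_def)
  qed (use f I(3) in \<open>auto simp: topspace_Euclidean_space\<close>)
  then show ?thesis by simp
qed

lemma smooth_on_powr:
  assumes f: "smooth_on M U f" and "\<And>p. p \<in> U \<Longrightarrow> f p > 0"
  shows "smooth_on M U (\<lambda>p. f p powr a)"
proof -
  have "smooth_on M U (\<lambda>p. (\<lambda>x. x 0 powr a) (\<lambda>k. if k < Suc 0 then (\<lambda>_. f) k p else 0))"
  proof (rule smooth_on_compose[OF smooth_on_openin[OF f] openin_Euclidean_1[OF open_greaterThan[of 0]]])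
    show "Cinf_on (Suc 0) {x \<in> topspace (Euclidean_space (Suc 0)). x 0 \<in> {0<..}} (\<lambda>x. x 0 powr a)"
      using Ck_on_powr by (simp add: Cinf_on_def)
  qed (use assms in \<open>auto simp: topspace_Euclidean_space\<close>)
  then show ?thesis by simp
qed

text \<open>The coordinates of one chart are smooth when read in any other chart: this is exactly
  the condition on transition maps.\<close>

lemma smooth_on_chart_coord:
  assumes "(V, \<psi>) \<in> atlas M" "k < n"
  shows "smooth_on M V (\<lambda>p. \<psi> p k)"
proof (rule smooth_onI)
  show "opn V" using assms(1) by (rule chart_open)
  fix V' \<psi>' assume "(V', \<psi>') \<in> atlas M"
  from transition[OF this assms] show "Cinf_on n (\<psi>' ` (V \<inter> V')) ((\<lambda>p. \<psi> p k) \<circ> inv_into V' \<psi>')"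
    by (simp add: o_def Int_commute)
qed

lemma chart_restrict: 
  assumes "(V, \<psi>) \<in> atlas M" "p \<in> V"
  shows "(\<lambda>k. if k < n then \<psi> p k else 0) = \<psi> p"
proof -
  have "\<psi> p \<in> topspace E" using chart_image[OF assms(1)] assms(2) openin_subset by blast
  then show ?thesis by (auto simp: topspace_Euclidean_space)
qed

lemma smooth_on_chart_compose:
  assumes V: "(V, \<psi>) \<in> atlas M" and U: "opn U" "U \<subseteq> V" and B: "openin E B" "\<psi> ` U \<subseteq> B" and G: "Cinf_on n B G"
  shows "smooth_on M U (\<lambda>p. G (\<psi> p))"
proof -
  have "smooth_on M U (\<lambda>p. G (\<lambda>k. if k < n then (\<lambda>k p. \<psi> p k) k p else 0))"
  proof (rule smooth_on_compose[OF U(1) B(1) _ G])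
    show "smooth_on M U (\<lambda>p. \<psi> p k)" if "k < n" for k
      using smooth_on_subset[OF smooth_on_chart_coord[OF V that] U] .
  qed (use B(2) U(2) chart_restrict[OF V] in auto)
  then show ?thesis
    by (rule smooth_on_cong) (use U(2) chart_restrict[OF V] in auto)
qed

lemma smooth_on_partial:
  assumes f: "smooth_on M U f" and V: "(V, \<psi>) \<in> atlas M" and k: "k < n"
  shows "smooth_on M (U \<inter> V) (\<lambda>p. partial k (f \<circ> inv_into V \<psi>) (\<psi> p))"
proof (rule smooth_on_chart_compose[OF V])
  note U = smooth_on_openin[OF f]
  show "opn (U \<inter> V)" using U chart_open[OF V] by blast
  show "openin E (\<psi> ` (U \<inter> V))" by (rule chart_image_open[OF V U])
  have "Ck_on (Suc r) n (\<psi> ` (U \<inter> V)) (f \<circ> inv_into V \<psi>)" for r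
    using smooth_on_Cinf[OF f V] unfolding Cinf_on_def ..
  then show "Cinf_on n (\<psi> ` (U \<inter> V)) (partial k (f \<circ> inv_into V \<psi>))"
    using Ck_on_SucD(1) k by (simp add: Cinf_on_def)
qed auto

section \<open>Smoothness at a point, and tangent vectors as derivations\<close>

lemma smooth_at_on: "smooth_on M U f \<Longrightarrow> p \<in> U \<Longrightarrow> smooth_at M p f"
  by (auto simp: smooth_at_def)

lemma smooth_at_cong:
  assumes "smooth_at M p f" "opn U" "p \<in> U" "\<And>q. q \<in> U \<Longrightarrow> f q = g q"
  shows "smooth_at M p g"
proof -
  obtain W where W: "p \<in> W" "smooth_on M W f" using assms(1) by (auto simp: smooth_at_def)
  have "smooth_on M (W \<inter> U) f"
    using smooth_on_subset[OF W(2)] smooth_on_openin[OF W(2)] assms(2) by auto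
  then have "smooth_on M (W \<inter> U) g" by (rule smooth_on_cong) (use assms(4) in auto)
  then show ?thesis using W(1) assms(3) by (auto simp: smooth_at_def)
qed

lemma smooth_at_binary:
  assumes "smooth_at M p f" "smooth_at M p g"
    and "\<And>U. smooth_on M U f \<Longrightarrow> smooth_on M U g \<Longrightarrow> smooth_on M U h"
  shows "smooth_at M p h"
proof -
  obtain W W' where W: "p \<in> W" "smooth_on M W f" "p \<in> W'" "smooth_on M W' g"
    using assms(1,2) by (auto simp: smooth_at_def)
  have "smooth_on M (W \<inter> W') f" "smooth_on M (W \<inter> W') g"
    using smooth_on_subset[OF W(2)] smooth_on_subset[OF W(4)] smooth_on_openin[OF W(2)] smooth_on_openin[OF W(4)] by auto
  from assms(3)[OF this] show ?thesis using W by (auto simp: smooth_at_def)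
qed

lemma smooth_at_add: "smooth_at M p f \<Longrightarrow> smooth_at M p g \<Longrightarrow> smooth_at M p (\<lambda>q. f q + g q)"
  by (rule smooth_at_binary[of p f g]) (auto intro: smooth_on_add)

lemma smooth_at_mult: "smooth_at M p f \<Longrightarrow> smooth_at M p g \<Longrightarrow> smooth_at M p (\<lambda>q. f q * g q)"
  by (rule smooth_at_binary[of p f g]) (auto intro: smooth_on_mult)

lemma smooth_at_const: "p \<in> topspace (mtop M) \<Longrightarrow> smooth_at M p (\<lambda>q. c)"
  by (rule smooth_at_on[OF smooth_on_const[OF openin_topspace]])

lemma smooth_at_sum:
  assumes "p \<in> topspace (mtop M)" "\<And>a. a \<in> A \<Longrightarrow> smooth_at M p (f a)"
  shows "smooth_at M p (\<lambda>q. \<Sum>a\<in>A. f a q)"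
  using assms(2) by (induction A rule: infinite_finite_induct)
    (simp_all add: smooth_at_const[OF assms(1)] smooth_at_add)

lemma smooth_at_topspace: "smooth_at M p f \<Longrightarrow> p \<in> topspace (mtop M)"
  unfolding smooth_at_def using smooth_on_openin openin_subset by blast

lemma tv_lin: "v \<in> tangent_space M p \<Longrightarrow> smooth_at M p f \<Longrightarrow> smooth_at M p h \<Longrightarrow>
    v (\<lambda>q. a * f q + b * h q) = a * v f + b * v h"
  by (simp add: tangent_space_def)

lemma tv_add: "v \<in> tangent_space M p \<Longrightarrow> smooth_at M p f \<Longrightarrow> smooth_at M p h \<Longrightarrow>
    v (\<lambda>q. f q + h q) = v f + v h"
  using tv_lin[of v p f h 1 1] by simp

lemma tv_cmult: "v \<in> tangent_space M p \<Longrightarrow> smooth_at M p f \<Longrightarrow> v (\<lambda>q. a * f q) = a * v f"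
  using tv_lin[of v p f f a 0] by simp

lemma tv_mult: "v \<in> tangent_space M p \<Longrightarrow> smooth_at M p f \<Longrightarrow> smooth_at M p h \<Longrightarrow>
    v (\<lambda>q. f q * h q) = f p * v h + h p * v f"
  by (simp add: tangent_space_def)

lemma tv_not_smooth: "v \<in> tangent_space M p \<Longrightarrow> \<not> smooth_at M p f \<Longrightarrow> v f = 0"
  by (simp add: tangent_space_def)

text \<open>The product rule for 1 = 1 * 1 gives v(1) = 2 v(1). At a point outside the space no
  function is smooth, so the default value 0 of tangent vectors applies.\<close>

lemma tv_const:
  assumes "v \<in> tangent_space M p"
  shows "v (\<lambda>q. c) = 0"
proof (cases "p \<in> topspace (mtop M)")
  case True
  have "v (\<lambda>q. 1) = 0" using tv_mult[OF assms smooth_at_const[OF True, of 1] smooth_at_const[OF True, of 1]] by simp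
  then show ?thesis using tv_cmult[OF assms smooth_at_const[OF True, of 1], of c] by simp
next
  case False
  then show ?thesis using tv_not_smooth[OF assms] smooth_at_topspace by blast
qed

lemma tv_diff: "v \<in> tangent_space M p \<Longrightarrow> smooth_at M p f \<Longrightarrow> smooth_at M p h \<Longrightarrow>
    v (\<lambda>q. f q - h q) = v f - v h"
  using tv_lin[of v p f h 1 "- 1"] by simp

lemma tv_sum:
  assumes v: "v \<in> tangent_space M p" and f: "\<And>a. a \<in> A \<Longrightarrow> smooth_at M p (f a)"
  shows "v (\<lambda>q. \<Sum>a\<in>A. f a q) = (\<Sum>a\<in>A. v (f a))"
proof (cases "p \<in> topspace (mtop M)")
  case True
  show ?thesis using f
  proof (induction A rule: infinite_finite_induct)
    case (insert x A)
    then show ?case using tv_add[OF v, of "f x" "\<lambda>q. \<Sum>a\<in>A. f a q"] smooth_at_sum[OF True, of A f] by simp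
  qed (simp_all add: tv_const[OF v])
next
  case False
  then have "\<not> smooth_at M p h" for h using smooth_at_topspace by blast
  then show ?thesis using tv_not_smooth[OF v] by simp
qed

text \<open>For the indicator \<open>h\<close> of \<open>U\<close>, the equations
  \<open>h * h = h\<close> and \<open>h p = 1\<close> force v(h) = 0; the product rule for
  \<open>h * f = h * g\<close> then gives v(f) = v(g).\<close>

lemma tv_cong:
  assumes v: "v \<in> tangent_space M p" and U: "opn U" "p \<in> U" and fg: "\<And>q. q \<in> U \<Longrightarrow> f q = g q"
  shows "v f = v g"
proof (cases "smooth_at M p f")
  case True
  then have g: "smooth_at M p g" using smooth_at_cong[OF True U fg] by blast
  define h where "h = (\<lambda>q. if q \<in> U then 1 else 0 :: real)"
  have "smooth_on M U h" using smooth_on_cong[OF smooth_on_const[OF U(1), of 1]] by (simp add: h_def)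
  then have h: "smooth_at M p h" using U(2) smooth_at_on by blast
  have "(\<lambda>q. h q * h q) = h" "h p = 1" using U(2) by (auto simp: h_def)
  then have "v h = 0" using tv_mult[OF v h h] by simp
  moreover have "(\<lambda>q. h q * f q) = (\<lambda>q. h q * g q)" using fg by (auto simp: h_def)
  ultimately show ?thesis using tv_mult[OF v h True] tv_mult[OF v h g] \<open>h p = 1\<close> by simp
next
  case False
  then have "\<not> smooth_at M p g" using smooth_at_cong[OF _ U, of g f] fg by auto
  then show ?thesis using False tv_not_smooth[OF v] by simp
qed

text \<open>By \<open>hadamard\<close>, f = f(p) + \<Sum> (\<psi>_k - a_k) H_k near
  \<open>p\<close>. The product rule leaves v(\<psi>_k) H_k(p), and H_k(p) is the k-th partial
  derivative at \<open>p\<close>. For \<open>v\<close> to act on the products each H_k has to be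
  smooth, for which \<open>Ck_on_hadamard_coeff\<close> supplies every order.\<close>

lemma tv_expand:
  assumes V: "(V, \<psi>) \<in> atlas M" and p: "p \<in> V" and v: "v \<in> tangent_space M p" and f: "smooth_at M p f"
  shows "v f = (\<Sum>k<n. v (\<lambda>q. \<psi> q k) * partial k (f \<circ> inv_into V \<psi>) (\<psi> p))"
proof -
  obtain U where U: "p \<in> U" "smooth_on M U f" using f by (auto simp: smooth_at_def)
  let ?F = "f \<circ> inv_into V \<psi>" and ?a = "\<psi> p"
  have W: "openin E (\<psi> ` (U \<inter> V))" by (rule chart_image_open[OF V smooth_on_openin[OF U(2)]])
  have aW: "?a \<in> \<psi> ` (U \<inter> V)" using U p by auto
  then have a: "?a \<in> topspace E" using openin_subset[OF W] by blast
  obtain e where e: "e > 0" "box_at n ?a e \<subseteq> \<psi> ` (U \<inter> V)" using box_at_subset[OF W aW] .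
  let ?B = "box_at n ?a e"
  have F: "Ck_on r n ?B ?F" for r
    using Ck_on_subset[OF _ e(2)] smooth_on_Cinf[OF U(2) V] unfolding Cinf_on_def by blast
  define N where "N = {q \<in> V. \<psi> q \<in> ?B}"
  have N: "opn N" unfolding N_def by (rule chart_preimage_open[OF V openin_box_at])
  have pN: "p \<in> N" using p a e(1) by (auto simp: N_def box_at_def)
  define H where "H k q = hadamard_coeff ?F ?a k (\<psi> q)" for k q
  have "Cinf_on n ?B (hadamard_coeff ?F ?a k)" if "k < n" for k
    using Ck_on_hadamard_coeff[OF a F that] by (simp add: Cinf_on_def)
  then have H: "smooth_at M p (H k)" if "k < n" for k
    using smooth_on_chart_compose[OF V N _ openin_box_at] that smooth_at_on[OF _ pN] unfolding H_def N_def by blast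
  have c: "smooth_at M p (\<lambda>q. \<psi> q k)" if "k < n" for k
    using smooth_on_chart_coord[OF V that] p by (rule smooth_at_on)
  have pt: "p \<in> topspace (mtop M)" using f by (rule smooth_at_topspace)
  have d: "smooth_at M p (\<lambda>q. \<psi> q k - ?a k)" if "k < n" for k
    using smooth_at_add[OF c[OF that] smooth_at_const[OF pt, of "- ?a k"]] by simp
  have "f q = f p + (\<Sum>k<n. (\<psi> q k - ?a k) * H k q)" if "q \<in> N" for q
    using hadamard[OF a F, of "\<psi> q"] that V p by (simp add: N_def H_def)
  then have "v f = v (\<lambda>q. f p + (\<Sum>k<n. (\<psi> q k - ?a k) * H k q))"
    by (rule tv_cong[OF v N pN])
  also have "\<dots> = v (\<lambda>q. f p) + v (\<lambda>q. (\<Sum>k<n. (\<psi> q k - ?a k) * H k q))"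
    by (rule tv_add[OF v]) (use smooth_at_const[OF pt] d H in \<open>auto intro!: smooth_at_sum[OF pt] smooth_at_mult\<close>)
  also have "\<dots> = (\<Sum>k<n. v (\<lambda>q. (\<psi> q k - ?a k) * H k q))"
    by (subst tv_sum[OF v]) (use d H in \<open>auto simp: tv_const[OF v] intro!: smooth_at_mult\<close>)
  also have "\<dots> = (\<Sum>k<n. v (\<lambda>q. \<psi> q k) * partial k ?F ?a)"
  proof (rule sum.cong[OF refl])
    fix k assume "k \<in> {..<n}"
    then have k: "k < n" by simp
    have "v (\<lambda>q. (\<psi> q k - ?a k) * H k q) = H k p * v (\<lambda>q. \<psi> q k - ?a k)"
      using tv_mult[OF v d[OF k] H[OF k]] by simp
    also have "v (\<lambda>q. \<psi> q k - ?a k) = v (\<lambda>q. \<psi> q k)"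
      using tv_diff[OF v c[OF k] smooth_at_const[OF pt]] tv_const[OF v] by simp
    finally show "v (\<lambda>q. (\<psi> q k - ?a k) * H k q) = v (\<lambda>q. \<psi> q k) * partial k ?F ?a"
      by (simp add: H_def hadamard_coeff_at)
  qed
  finally show ?thesis .
qed

lemma tv_eqI:
  assumes V: "(V, \<psi>) \<in> atlas M" and p: "p \<in> V" and v: "v \<in> tangent_space M p" and w: "w \<in> tangent_space M p"
    and eq: "\<And>k. k < n \<Longrightarrow> v (\<lambda>q. \<psi> q k) = w (\<lambda>q. \<psi> q k)"
  shows "v = w"
proof
  fix f show "v f = w f"
  proof (cases "smooth_at M p f")
    case True
    then show ?thesis using tv_expand[OF V p v True] tv_expand[OF V p w True] eq by simp
  next
    case False
    then show ?thesis using tv_not_smooth[OF v False] tv_not_smooth[OF w False] by simp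
  qed
qed

lemma tv_zero: "(\<lambda>f. 0) \<in> tangent_space M p"
  by (simp add: tangent_space_def)

lemma tv_lincomb:
  assumes "v \<in> tangent_space M p" "w \<in> tangent_space M p"
  shows "(\<lambda>f. a * v f + b * w f) \<in> tangent_space M p"
  using assms by (auto simp: tangent_space_def algebra_simps)

lemma tv_scaled: "v \<in> tangent_space M p \<Longrightarrow> (\<lambda>f. a * v f) \<in> tangent_space M p"
  using tv_lincomb[of v p v a 0] by simp

lemma tv_plus: "v \<in> tangent_space M p \<Longrightarrow> w \<in> tangent_space M p \<Longrightarrow> (\<lambda>f. v f + w f) \<in> tangent_space M p"
  using tv_lincomb[of v p w 1 1] by simp

lemma tv_sub: "v \<in> tangent_space M p \<Longrightarrow> w \<in> tangent_space M p \<Longrightarrow> (\<lambda>f. v f - w f) \<in> tangent_space M p"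
  using tv_lincomb[of v p w 1 "- 1"] by simp

lemma tv_setsum:
  assumes "\<And>a. a \<in> A \<Longrightarrow> v a \<in> tangent_space M p"
  shows "(\<lambda>f. \<Sum>a\<in>A. c a * v a f) \<in> tangent_space M p"
  using assms
proof (induction A rule: infinite_finite_induct)
  case (insert x A)
  then show ?case using tv_lincomb[of "v x" p "\<lambda>f. \<Sum>a\<in>A. c a * v a f" "c x" 1] by simp
qed (simp_all add: tv_zero)

end

section \<open>Vector fields\<close>

context charted
begin

lemma vf_openin: "smooth_vfield_on M U X \<Longrightarrow> opn U"
  by (simp add: smooth_vfield_on_def)

lemma vf_tangent: "smooth_vfield_on M U X \<Longrightarrow> p \<in> U \<Longrightarrow> X p \<in> tangent_space M p"
  by (simp add: smooth_vfield_on_def)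

lemma vf_apply: "smooth_vfield_on M U X \<Longrightarrow> smooth_on M W f \<Longrightarrow> W \<subseteq> U \<Longrightarrow> smooth_on M W (\<lambda>p. X p f)"
  by (simp add: smooth_vfield_on_def)

lemma vf_apply_at:
  assumes X: "smooth_vfield_on M U X" and p: "p \<in> U" and f: "smooth_at M p f"
  shows "smooth_at M p (\<lambda>q. X q f)"
proof -
  obtain W where W: "p \<in> W" "smooth_on M W f" using f by (auto simp: smooth_at_def)
  have "smooth_on M (W \<inter> U) f" using smooth_on_subset[OF W(2)] smooth_on_openin[OF W(2)] vf_openin[OF X] by auto
  from vf_apply[OF X this] show ?thesis using W(1) p smooth_at_on by blast
qed

lemma vfI:
  assumes "opn U" "\<And>p. p \<in> U \<Longrightarrow> X p \<in> tangent_space M p"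
    "\<And>W f. W \<subseteq> U \<Longrightarrow> smooth_on M W f \<Longrightarrow> smooth_on M W (\<lambda>p. X p f)"
  shows "smooth_vfield_on M U X"
  using assms by (simp add: smooth_vfield_on_def)

lemma vf_subset: "smooth_vfield_on M U X \<Longrightarrow> opn W \<Longrightarrow> W \<subseteq> U \<Longrightarrow> smooth_vfield_on M W X"
  unfolding smooth_vfield_on_def by (meson subset_trans subsetD)

lemma vf_cong:
  assumes X: "smooth_vfield_on M U X" and eq: "\<And>p. p \<in> U \<Longrightarrow> X p = Y p"
  shows "smooth_vfield_on M U Y"
proof (rule vfI[OF vf_openin[OF X]])
  show "Y p \<in> tangent_space M p" if "p \<in> U" for p using vf_tangent[OF X that] eq[OF that] by simp
  show "smooth_on M W (\<lambda>p. Y p f)" if "W \<subseteq> U" "smooth_on M W f" for W f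
    by (rule smooth_on_cong[OF vf_apply[OF X that(2,1)]]) (use eq that(1) in auto)
qed

lemma vf_lincomb:
  assumes X: "smooth_vfield_on M U X" and Y: "smooth_vfield_on M U Y" and f: "smooth_on M U f" and h: "smooth_on M U h"
  shows "smooth_vfield_on M U (\<lambda>p k. f p * X p k + h p * Y p k)"
proof (rule vfI[OF vf_openin[OF X]])
  show "(\<lambda>k. f p * X p k + h p * Y p k) \<in> tangent_space M p" if "p \<in> U" for p
    using tv_lincomb vf_tangent[OF X that] vf_tangent[OF Y that] .
  fix W k assume W: "W \<subseteq> U" "smooth_on M W k"
  note s = smooth_on_subset[OF _ smooth_on_openin[OF W(2)] W(1)]
  show "smooth_on M W (\<lambda>p. f p * X p k + h p * Y p k)"
    by (intro smooth_on_add smooth_on_mult s[OF f] s[OF h] vf_apply[OF X W(2,1)] vf_apply[OF Y W(2,1)])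
qed

lemma vf_zero: "opn U \<Longrightarrow> smooth_vfield_on M U (\<lambda>p f. 0)"
  by (rule vfI) (auto intro: tv_zero smooth_on_const smooth_on_openin)

lemma vf_add: "smooth_vfield_on M U X \<Longrightarrow> smooth_vfield_on M U Y \<Longrightarrow> smooth_vfield_on M U (\<lambda>p k. X p k + Y p k)"
  using vf_lincomb[of U X Y "\<lambda>_. 1" "\<lambda>_. 1"] smooth_on_const[OF vf_openin] by simp

lemma vf_scale: "smooth_vfield_on M U X \<Longrightarrow> smooth_on M U f \<Longrightarrow> smooth_vfield_on M U (\<lambda>p k. f p * X p k)"
  using vf_lincomb[of U X X f "\<lambda>_. 0"] smooth_on_const[OF vf_openin] by simp

lemma vf_diff: "smooth_vfield_on M U X \<Longrightarrow> smooth_vfield_on M U Y \<Longrightarrow> smooth_vfield_on M U (\<lambda>p k. X p k - Y p k)"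
  using vf_lincomb[of U X Y "\<lambda>_. 1" "\<lambda>_. - 1"] smooth_on_const[OF vf_openin] by simp

lemma vf_sum:
  assumes U: "opn U" and "\<And>a. a \<in> A \<Longrightarrow> smooth_vfield_on M U (X a)" "\<And>a. a \<in> A \<Longrightarrow> smooth_on M U (f a)"
  shows "smooth_vfield_on M U (\<lambda>p k. \<Sum>a\<in>A. f a p * X a p k)"
  using assms(2,3)
  by (induction A rule: infinite_finite_induct) (simp_all add: vf_zero[OF U] vf_add vf_scale)

section \<open>Coordinate fields of a chart\<close>

definition coord_field :: "'a set \<Rightarrow> ('a \<Rightarrow> nat \<Rightarrow> real) \<Rightarrow> nat \<Rightarrow> 'a vfield" where
  "coord_field V \<psi> k p f = (if smooth_at M p f then partial k (f \<circ> inv_into V \<psi>) (\<psi> p) else 0)"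

lemma chart_DERIV:
  assumes V: "(V, \<psi>) \<in> atlas M" and p: "p \<in> V" and k: "k < n" and f: "smooth_at M p f"
  shows "((\<lambda>s. (f \<circ> inv_into V \<psi>) ((\<psi> p)(k := s))) has_field_derivative partial k (f \<circ> inv_into V \<psi>) (\<psi> p)) (at (\<psi> p k))"
proof -
  obtain U where U: "p \<in> U" "smooth_on M U f" using f by (auto simp: smooth_at_def)
  have "Ck_on (Suc 0) n (\<psi> ` (U \<inter> V)) (f \<circ> inv_into V \<psi>)"
    using smooth_on_Cinf[OF U(2) V] unfolding Cinf_on_def ..
  from Ck_on_SucD(2)[OF this k] show ?thesis using U(1) p by blast
qed

lemma coord_field_tangent:
  assumes V: "(V, \<psi>) \<in> atlas M" and p: "p \<in> V" and k: "k < n"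
  shows "coord_field V \<psi> k p \<in> tangent_space M p"
  unfolding tangent_space_def
proof (intro CollectI conjI allI impI)
  note D = chart_DERIV[OF V p k]
  have pt: "p \<in> topspace (mtop M)" using chart_subset[OF V] p by blast
  fix f h a b assume fh: "smooth_at M p f \<and> smooth_at M p h"
  note Df = D[OF conjunct1[OF fh]] and Dh = D[OF conjunct2[OF fh]]
  have s: "smooth_at M p (\<lambda>q. a * f q + b * h q)" "smooth_at M p (\<lambda>q. f q * h q)"
    using fh by (auto intro!: smooth_at_add smooth_at_mult smooth_at_const[OF pt])
  have "partial k ((\<lambda>q. a * f q + b * h q) \<circ> inv_into V \<psi>) (\<psi> p) =
      a * partial k (f \<circ> inv_into V \<psi>) (\<psi> p) + b * partial k (h \<circ> inv_into V \<psi>) (\<psi> p)"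
    using DERIV_add[OF DERIV_cmult[OF Df, of a] DERIV_cmult[OF Dh, of b]]
    by (intro partial_eqI) (simp add: o_def)
  then show "coord_field V \<psi> k p (\<lambda>q. a * f q + b * h q) = a * coord_field V \<psi> k p f + b * coord_field V \<psi> k p h"
    using s fh by (simp add: coord_field_def)
  have "partial k ((\<lambda>q. f q * h q) \<circ> inv_into V \<psi>) (\<psi> p) =
      f p * partial k (h \<circ> inv_into V \<psi>) (\<psi> p) + h p * partial k (f \<circ> inv_into V \<psi>) (\<psi> p)"
    using DERIV_mult[OF Df Dh] V p
    by (intro partial_eqI) (simp add: o_def algebra_simps)
  then show "coord_field V \<psi> k p (\<lambda>q. f q * h q) = f p * coord_field V \<psi> k p h + h p * coord_field V \<psi> k p f"
    using s fh by (simp add: coord_field_def)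
qed (simp add: coord_field_def)

lemma coord_field_coord:
  assumes V: "(V, \<psi>) \<in> atlas M" and p: "p \<in> V" and k: "k < n" and j: "j < n"
  shows "coord_field V \<psi> k p (\<lambda>q. \<psi> q j) = (if j = k then 1 else 0)"
proof -
  have "partial k ((\<lambda>q. \<psi> q j) \<circ> inv_into V \<psi>) (\<psi> p) = partial k (\<lambda>x. x j) (\<psi> p)"
    by (rule partial_cong(1)[OF chart_image[OF V] _ k]) (use p V in auto)
  also have "\<dots> = (if j = k then 1 else 0)"
    by (rule partial_eqI) auto
  finally show ?thesis
    using smooth_at_on[OF smooth_on_chart_coord[OF V j] p] by (simp add: coord_field_def)
qed

lemma coord_field_smooth:
  assumes V: "(V, \<psi>) \<in> atlas M" and k: "k < n"
  shows "smooth_vfield_on M V (coord_field V \<psi> k)"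
proof (rule vfI[OF chart_open[OF V]])
  fix W f assume W: "W \<subseteq> V" "smooth_on M W f"
  have "smooth_on M (W \<inter> V) (\<lambda>p. partial k (f \<circ> inv_into V \<psi>) (\<psi> p))"
    by (rule smooth_on_partial[OF W(2) V k])
  then have "smooth_on M W (\<lambda>p. partial k (f \<circ> inv_into V \<psi>) (\<psi> p))"
    using W(1) by (simp add: Int_absorb2)
  then show "smooth_on M W (\<lambda>p. coord_field V \<psi> k p f)"
    by (rule smooth_on_cong) (use smooth_at_on[OF W(2)] in \<open>simp add: coord_field_def\<close>)
qed (rule coord_field_tangent[OF V _ k])

lemma tv_expand_coord:
  assumes V: "(V, \<psi>) \<in> atlas M" and p: "p \<in> V" and v: "v \<in> tangent_space M p"
  shows "v = (\<lambda>f. \<Sum>k<n. v (\<lambda>q. \<psi> q k) * coord_field V \<psi> k p f)"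
proof
  fix f show "v f = (\<Sum>k<n. v (\<lambda>q. \<psi> q k) * coord_field V \<psi> k p f)"
    using tv_expand[OF V p v, of f] tv_not_smooth[OF v, of f]
    by (cases "smooth_at M p f") (auto simp: coord_field_def)
qed

lemma indicator_smooth: "opn U \<Longrightarrow> smooth_on M U (\<lambda>q. if q \<in> U then 1 else 0)"
  by (rule smooth_on_cong[OF smooth_on_const[of U 1]]) auto

section \<open>Lie brackets\<close>

lemma lie_bracket_apply: "smooth_at M p f \<Longrightarrow> lie_bracket M X Y p f = X p (\<lambda>q. Y q f) - Y p (\<lambda>q. X q f)"
  by (simp add: lie_bracket_def)

lemma lie_bracket_cong:
  assumes X: "smooth_vfield_on M U X" and Y: "smooth_vfield_on M U Y" and p: "p \<in> U"
    and eq: "\<And>q. q \<in> U \<Longrightarrow> X q = X' q" "\<And>q. q \<in> U \<Longrightarrow> Y q = Y' q"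
  shows "lie_bracket M X Y p = lie_bracket M X' Y' p"
proof
  fix f
  have "X p (\<lambda>q. Y q f) = X' p (\<lambda>q. Y' q f)" "Y p (\<lambda>q. X q f) = Y' p (\<lambda>q. X' q f)"
    using tv_cong[OF vf_tangent[OF X p] vf_openin[OF X] p, of "\<lambda>q. Y q f" "\<lambda>q. Y' q f"]
      tv_cong[OF vf_tangent[OF Y p] vf_openin[OF X] p, of "\<lambda>q. X q f" "\<lambda>q. X' q f"] eq p by auto
  then show "lie_bracket M X Y p f = lie_bracket M X' Y' p f" by (simp add: lie_bracket_def)
qed

lemma lie_bracket_swap: "lie_bracket M Y X p = (\<lambda>f. - lie_bracket M X Y p f)"
  by (auto simp: lie_bracket_def)

text \<open>The term with \<open>Y p f\<close> comes from the product rule in the second half of the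
  bracket; it is the one that produces the cancellation in \<open>curvature_scale1\<close>.\<close>

lemma lie_bracket_scale:
  assumes X: "smooth_vfield_on M U X" and Y: "smooth_vfield_on M U Y" and f: "smooth_on M U f" and p: "p \<in> U"
  shows "lie_bracket M (\<lambda>q k. f q * X q k) Y p = (\<lambda>k. f p * lie_bracket M X Y p k - Y p f * X p k)"
proof
  fix k
  show "lie_bracket M (\<lambda>q k. f q * X q k) Y p k = f p * lie_bracket M X Y p k - Y p f * X p k"
  proof (cases "smooth_at M p k")
    case True
    then show ?thesis
      using tv_mult[OF vf_tangent[OF Y p] smooth_at_on[OF f p] vf_apply_at[OF X p True]]
      by (simp add: lie_bracket_def algebra_simps)
  next
    case False
    then show ?thesis using tv_not_smooth[OF vf_tangent[OF X p]] by (simp add: lie_bracket_def)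
  qed
qed

lemma lie_bracket_add:
  assumes X: "smooth_vfield_on M U X" and X': "smooth_vfield_on M U X'" and Y: "smooth_vfield_on M U Y" and p: "p \<in> U"
  shows "lie_bracket M (\<lambda>q k. X q k + X' q k) Y p = (\<lambda>k. lie_bracket M X Y p k + lie_bracket M X' Y p k)"
proof
  fix k
  show "lie_bracket M (\<lambda>q k. X q k + X' q k) Y p k = lie_bracket M X Y p k + lie_bracket M X' Y p k"
    using tv_add[OF vf_tangent[OF Y p] vf_apply_at[OF X p] vf_apply_at[OF X' p]]
    by (cases "smooth_at M p k") (simp_all add: lie_bracket_def)
qed

end

section \<open>Affine connections and curvature\<close>

text \<open>Smoothness of brackets is taken as an assumption, since for a Levi-Civita connection it
  is immediate from torsion-freeness, and a quarter-symmetric connection on the same manifold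
  inherits it.\<close>

locale affine = charted +
  fixes D :: "'a conn"
  assumes affine_conn: "affine_connection M D"
    and bracket_smooth: "\<And>U X Y. smooth_vfield_on M U X \<Longrightarrow> smooth_vfield_on M U Y \<Longrightarrow>
      smooth_vfield_on M U (lie_bracket M X Y)"
begin

lemma D_smooth: "smooth_vfield_on M U X \<Longrightarrow> smooth_vfield_on M U Y \<Longrightarrow> smooth_vfield_on M U (D X Y)"
  using affine_conn unfolding affine_connection_def by blast

lemma D_props:
  assumes "smooth_vfield_on M U X" "smooth_vfield_on M U Y" "smooth_vfield_on M U Z" "smooth_on M U f" "p \<in> U"
  shows "D (\<lambda>q h. X q h + Y q h) Z p = (\<lambda>h. D X Z p h + D Y Z p h)"
    "D (\<lambda>q h. f q * X q h) Z p = (\<lambda>h. f p * D X Z p h)"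
    "D X (\<lambda>q h. Y q h + Z q h) p = (\<lambda>h. D X Y p h + D X Z p h)"
    "D X (\<lambda>q h. f q * Y q h) p = (\<lambda>h. X p f * Y p h + f p * D X Y p h)"
proof -
  have "\<forall>p\<in>U. D (\<lambda>q h. X q h + Y q h) Z p = (\<lambda>h. D X Z p h + D Y Z p h) \<and>
           D (\<lambda>q h. f q * X q h) Z p = (\<lambda>h. f p * D X Z p h) \<and>
           D X (\<lambda>q h. Y q h + Z q h) p = (\<lambda>h. D X Y p h + D X Z p h) \<and>
           D X (\<lambda>q h. f q * Y q h) p = (\<lambda>h. X p f * Y p h + f p * D X Y p h)"
    using conjunct2[OF affine_conn[unfolded affine_connection_def], rule_format, of U X Y Z f] assms by blast
  with assms(5) show "D (\<lambda>q h. X q h + Y q h) Z p = (\<lambda>h. D X Z p h + D Y Z p h)"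
    "D (\<lambda>q h. f q * X q h) Z p = (\<lambda>h. f p * D X Z p h)"
    "D X (\<lambda>q h. Y q h + Z q h) p = (\<lambda>h. D X Y p h + D X Z p h)"
    "D X (\<lambda>q h. f q * Y q h) p = (\<lambda>h. X p f * Y p h + f p * D X Y p h)" by blast+
qed

lemma D_add1:
  assumes "smooth_vfield_on M U X" "smooth_vfield_on M U Y" "smooth_vfield_on M U Z" "p \<in> U"
  shows "D (\<lambda>q h. X q h + Y q h) Z p = (\<lambda>h. D X Z p h + D Y Z p h)"
  by (rule D_props(1)[OF assms(1-3) smooth_on_const[OF vf_openin[OF assms(1)]] assms(4)])

lemma D_scale1:
  assumes "smooth_vfield_on M U X" "smooth_vfield_on M U Z" "smooth_on M U f" "p \<in> U"
  shows "D (\<lambda>q h. f q * X q h) Z p = (\<lambda>h. f p * D X Z p h)"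
  by (rule D_props(2)[OF assms(1,1,2,3,4)])

lemma D_add2:
  assumes "smooth_vfield_on M U X" "smooth_vfield_on M U Y" "smooth_vfield_on M U Z" "p \<in> U"
  shows "D X (\<lambda>q h. Y q h + Z q h) p = (\<lambda>h. D X Y p h + D X Z p h)"
  by (rule D_props(3)[OF assms(1-3) smooth_on_const[OF vf_openin[OF assms(1)]] assms(4)])

lemma D_scale2:
  assumes "smooth_vfield_on M U X" "smooth_vfield_on M U Y" "smooth_on M U f" "p \<in> U"
  shows "D X (\<lambda>q h. f q * Y q h) p = (\<lambda>h. X p f * Y p h + f p * D X Y p h)"
  by (rule D_props(4)[OF assms(1,2,2,3,4)])

text \<open>Multiplying by the indicator function of \<open>U\<close> turns fields that agree on \<open>U\<close> into equal ones.\<close>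

lemma D_cong:
  assumes X: "smooth_vfield_on M U X" and Y: "smooth_vfield_on M U Y" and p: "p \<in> U"
    and eq: "\<And>q. q \<in> U \<Longrightarrow> X q = X' q" "\<And>q. q \<in> U \<Longrightarrow> Y q = Y' q"
  shows "D X Y p = D X' Y' p"
proof -
  let ?i = "\<lambda>q. if q \<in> U then 1 else 0 :: real"
  have X': "smooth_vfield_on M U X'" and Y': "smooth_vfield_on M U Y'" using vf_cong X Y eq by blast+
  note i = indicator_smooth[OF vf_openin[OF X]]
  have d: "v ?i = 0" if "v \<in> tangent_space M p" for v
    using tv_cong[OF that vf_openin[OF X] p, of ?i "\<lambda>_. 1"] tv_const[OF that] by simp
  have "(\<lambda>q h. ?i q * X q h) = (\<lambda>q h. ?i q * X' q h)" "(\<lambda>q h. ?i q * Y q h) = (\<lambda>q h. ?i q * Y' q h)"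
    using eq by (auto intro!: ext)
  then have "D X Y p = D X' Y p" "D X' Y p = D X' Y' p"
    using D_scale1[OF X Y i p] D_scale1[OF X' Y i p] D_scale2[OF X' Y i p] D_scale2[OF X' Y' i p]
      d[OF vf_tangent[OF X' p]] p by simp_all
  then show ?thesis by simp
qed

section \<open>The curvature operator and its tensoriality\<close>

abbreviation "R \<equiv> curvature M D"

lemma curvature_smooth:
  assumes "smooth_vfield_on M U X" "smooth_vfield_on M U Y" "smooth_vfield_on M U Z"
  shows "smooth_vfield_on M U (R X Y Z)"
  unfolding curvature_def by (intro vf_diff D_smooth bracket_smooth assms)

lemma curvature_cong:
  assumes X: "smooth_vfield_on M U X" and Y: "smooth_vfield_on M U Y" and Z: "smooth_vfield_on M U Z" and p: "p \<in> U"
    and eq: "\<And>q. q \<in> U \<Longrightarrow> X q = X' q" "\<And>q. q \<in> U \<Longrightarrow> Y q = Y' q" "\<And>q. q \<in> U \<Longrightarrow> Z q = Z' q"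
  shows "R X Y Z p = R X' Y' Z' p"
proof -
  have "D X (D Y Z) p = D X' (D Y' Z') p"
    by (rule D_cong[OF X D_smooth[OF Y Z] p eq(1)], assumption, rule D_cong[OF Y Z _ eq(2,3)])
  moreover have "D Y (D X Z) p = D Y' (D X' Z') p"
    by (rule D_cong[OF Y D_smooth[OF X Z] p eq(2)], assumption, rule D_cong[OF X Z _ eq(1,3)])
  moreover have "D (lie_bracket M X Y) Z p = D (lie_bracket M X' Y') Z' p"
    by (rule D_cong[OF bracket_smooth[OF X Y] Z p _ eq(3)], rule lie_bracket_cong[OF X Y _ eq(1,2)])
  ultimately show ?thesis by (simp add: curvature_def)
qed

lemma curvature_swap:
  assumes X: "smooth_vfield_on M U X" and Y: "smooth_vfield_on M U Y" and Z: "smooth_vfield_on M U Z" and p: "p \<in> U"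
  shows "R Y X Z p = (\<lambda>h. - R X Y Z p h)"
proof -
  have "D (lie_bracket M Y X) Z p = D (\<lambda>q h. (\<lambda>_. - 1) q * lie_bracket M X Y q h) Z p"
    by (rule D_cong[OF bracket_smooth[OF Y X] Z p]) (simp_all add: lie_bracket_swap[of Y X])
  also have "\<dots> = (\<lambda>h. - 1 * D (lie_bracket M X Y) Z p h)"
    by (rule D_scale1[OF bracket_smooth[OF X Y] Z smooth_on_const[OF vf_openin[OF X]] p])
  finally show ?thesis by (simp add: curvature_def fun_eq_iff)
qed

text \<open>The term -(Y f) D_X Z arising from D_Y (f D_X Z) cancels against the contribution of the
  summand -(Y f) X of the bracket [f X, Y].\<close>

lemma curvature_scale1:
  assumes X: "smooth_vfield_on M U X" and Y: "smooth_vfield_on M U Y" and Z: "smooth_vfield_on M U Z"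
    and f: "smooth_on M U f" and p: "p \<in> U"
  shows "R (\<lambda>q h. f q * X q h) Y Z p = (\<lambda>h. f p * R X Y Z p h)"
proof -
  note fX = vf_scale[OF X f]
  have Yf: "smooth_on M U (\<lambda>q. Y q f)" by (rule vf_apply[OF Y f order_refl])
  have 1: "D (\<lambda>q h. f q * X q h) (D Y Z) p = (\<lambda>h. f p * D X (D Y Z) p h)"
    by (rule D_scale1[OF X D_smooth[OF Y Z] f p])
  have "D Y (D (\<lambda>q h. f q * X q h) Z) p = D Y (\<lambda>q h. f q * D X Z q h) p"
    by (rule D_cong[OF Y D_smooth[OF fX Z] p refl]) (rule D_scale1[OF X Z f])
  also have "\<dots> = (\<lambda>h. Y p f * D X Z p h + f p * D Y (D X Z) p h)"
    by (rule D_scale2[OF Y D_smooth[OF X Z] f p])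
  finally have 2: "D Y (D (\<lambda>q h. f q * X q h) Z) p = (\<lambda>h. Y p f * D X Z p h + f p * D Y (D X Z) p h)" .
  have m: "smooth_vfield_on M U (\<lambda>q h. (- Y q f) * X q h)" by (intro vf_scale X smooth_on_minus Yf)
  have "D (lie_bracket M (\<lambda>q h. f q * X q h) Y) Z p =
     D (\<lambda>q h. f q * lie_bracket M X Y q h + (- Y q f) * X q h) Z p"
    by (rule D_cong[OF bracket_smooth[OF fX Y] Z p _ refl]) (simp add: lie_bracket_scale[OF X Y f])
  also have "\<dots> = (\<lambda>h. f p * D (lie_bracket M X Y) Z p h + (- Y p f) * D X Z p h)"
    by (simp only: D_add1[OF vf_scale[OF bracket_smooth[OF X Y] f] m Z p]
        D_scale1[OF bracket_smooth[OF X Y] Z f p] D_scale1[OF X Z smooth_on_minus[OF Yf] p])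
  finally have 3: "D (lie_bracket M (\<lambda>q h. f q * X q h) Y) Z p =
     (\<lambda>h. f p * D (lie_bracket M X Y) Z p h + (- Y p f) * D X Z p h)" .
  show ?thesis unfolding curvature_def 1 2 3 by (simp add: algebra_simps)
qed

lemma curvature_add1:
  assumes X: "smooth_vfield_on M U X" and X': "smooth_vfield_on M U X'" and Y: "smooth_vfield_on M U Y"
    and Z: "smooth_vfield_on M U Z" and p: "p \<in> U"
  shows "R (\<lambda>q h. X q h + X' q h) Y Z p = (\<lambda>h. R X Y Z p h + R X' Y Z p h)"
proof -
  note S = vf_add[OF X X']
  have "D Y (D (\<lambda>q h. X q h + X' q h) Z) p = D Y (\<lambda>q h. D X Z q h + D X' Z q h) p"
    by (rule D_cong[OF Y D_smooth[OF S Z] p refl]) (rule D_add1[OF X X' Z])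
  also have "\<dots> = (\<lambda>h. D Y (D X Z) p h + D Y (D X' Z) p h)"
    by (rule D_add2[OF Y D_smooth[OF X Z] D_smooth[OF X' Z] p])
  finally have 2: "D Y (D (\<lambda>q h. X q h + X' q h) Z) p = (\<lambda>h. D Y (D X Z) p h + D Y (D X' Z) p h)" .
  have "D (lie_bracket M (\<lambda>q h. X q h + X' q h) Y) Z p =
     D (\<lambda>q h. lie_bracket M X Y q h + lie_bracket M X' Y q h) Z p"
    by (rule D_cong[OF bracket_smooth[OF S Y] Z p _ refl]) (rule lie_bracket_add[OF X X' Y])
  also have "\<dots> = (\<lambda>h. D (lie_bracket M X Y) Z p h + D (lie_bracket M X' Y) Z p h)"
    by (rule D_add1[OF bracket_smooth[OF X Y] bracket_smooth[OF X' Y] Z p])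
  finally have 3: "D (lie_bracket M (\<lambda>q h. X q h + X' q h) Y) Z p =
     (\<lambda>h. D (lie_bracket M X Y) Z p h + D (lie_bracket M X' Y) Z p h)" .
  show ?thesis unfolding curvature_def 2 3 D_add1[OF X X' D_smooth[OF Y Z] p] by (simp add: algebra_simps)
qed

lemma D_D_scale:
  assumes X: "smooth_vfield_on M U X" and Y: "smooth_vfield_on M U Y" and Z: "smooth_vfield_on M U Z"
    and f: "smooth_on M U f" and p: "p \<in> U"
  shows "D X (D Y (\<lambda>q h. f q * Z q h)) p =
    (\<lambda>h. X p (\<lambda>q. Y q f) * Z p h + Y p f * D X Z p h + X p f * D Y Z p h + f p * D X (D Y Z) p h)"
proof -
  have Yf: "smooth_on M U (\<lambda>q. Y q f)" by (rule vf_apply[OF Y f order_refl])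
  have "D X (D Y (\<lambda>q h. f q * Z q h)) p = D X (\<lambda>q h. Y q f * Z q h + f q * D Y Z q h) p"
    by (rule D_cong[OF X D_smooth[OF Y vf_scale[OF Z f]] p refl]) (rule D_scale2[OF Y Z f])
  also have "\<dots> = (\<lambda>h. (X p (\<lambda>q. Y q f) * Z p h + Y p f * D X Z p h) + (X p f * D Y Z p h + f p * D X (D Y Z) p h))"
    by (simp only: D_add2[OF X vf_scale[OF Z Yf] vf_scale[OF D_smooth[OF Y Z] f] p]
        D_scale2[OF X Z Yf p] D_scale2[OF X D_smooth[OF Y Z] f p])
  finally show ?thesis by (simp add: algebra_simps)
qed

text \<open>Antisymmetrising \<open>D_D_scale\<close> in \<open>X\<close> and \<open>Y\<close>
  removes the terms with one derivative on \<open>f\<close> and one on \<open>Z\<close>. What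
  remains besides the curvature is ([X, Y] f) Z, which D_[X,Y] (f Z) cancels.\<close>

lemma curvature_scale3:
  assumes X: "smooth_vfield_on M U X" and Y: "smooth_vfield_on M U Y" and Z: "smooth_vfield_on M U Z"
    and f: "smooth_on M U f" and p: "p \<in> U"
  shows "R X Y (\<lambda>q h. f q * Z q h) p = (\<lambda>h. f p * R X Y Z p h)"
  unfolding curvature_def D_D_scale[OF X Y Z f p] D_D_scale[OF Y X Z f p]
    D_scale2[OF bracket_smooth[OF X Y] Z f p] lie_bracket_apply[OF smooth_at_on[OF f p]]
  by (simp add: algebra_simps)

lemma curvature_add3:
  assumes X: "smooth_vfield_on M U X" and Y: "smooth_vfield_on M U Y" and Z: "smooth_vfield_on M U Z"
    and Z': "smooth_vfield_on M U Z'" and p: "p \<in> U"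
  shows "R X Y (\<lambda>q h. Z q h + Z' q h) p = (\<lambda>h. R X Y Z p h + R X Y Z' p h)"
proof -
  note S = vf_add[OF Z Z']
  have *: "D X (D Y (\<lambda>q h. Z q h + Z' q h)) p = (\<lambda>h. D X (D Y Z) p h + D X (D Y Z') p h)"
    if X: "smooth_vfield_on M U X" and Y: "smooth_vfield_on M U Y" for X Y
  proof -
    have "D X (D Y (\<lambda>q h. Z q h + Z' q h)) p = D X (\<lambda>q h. D Y Z q h + D Y Z' q h) p"
      by (rule D_cong[OF X D_smooth[OF Y S] p refl]) (rule D_add2[OF Y Z Z'])
    also have "\<dots> = (\<lambda>h. D X (D Y Z) p h + D X (D Y Z') p h)"
      by (rule D_add2[OF X D_smooth[OF Y Z] D_smooth[OF Y Z'] p])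
    finally show ?thesis .
  qed
  show ?thesis unfolding curvature_def *[OF X Y] *[OF Y X] D_add2[OF bracket_smooth[OF X Y] Z Z' p]
    by (simp add: algebra_simps)
qed

lemma curvature_zero:
  assumes X: "smooth_vfield_on M U X" and Y: "smooth_vfield_on M U Y" and p: "p \<in> U"
  shows "R (\<lambda>q h. 0) X Y p = (\<lambda>h. 0)" "R X Y (\<lambda>q h. 0) p = (\<lambda>h. 0)"
  using curvature_scale1[OF X X Y smooth_on_const[OF vf_openin[OF X], of 0] p]
    curvature_scale3[OF X Y X smooth_on_const[OF vf_openin[OF X], of 0] p] by simp_all

lemma curvature_sum1:
  assumes Y: "smooth_vfield_on M U Y" and Z: "smooth_vfield_on M U Z" and p: "p \<in> U"
    and "\<And>a. a \<in> A \<Longrightarrow> smooth_vfield_on M U (X a)" "\<And>a. a \<in> A \<Longrightarrow> smooth_on M U (f a)"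
  shows "R (\<lambda>q h. \<Sum>a\<in>A. f a q * X a q h) Y Z p = (\<lambda>h. \<Sum>a\<in>A. f a p * R (X a) Y Z p h)"
  using assms(4,5)
proof (induction A rule: infinite_finite_induct)
  case (insert x A)
  have s: "smooth_vfield_on M U (\<lambda>q h. \<Sum>a\<in>A. f a q * X a q h)"
    by (rule vf_sum[OF vf_openin[OF Y]]) (use insert in auto)
  have x: "smooth_vfield_on M U (X x)" "smooth_on M U (f x)" using insert by auto
  show ?case
    using curvature_add1[OF vf_scale[OF x] s Y Z p] curvature_scale1[OF x(1) Y Z x(2) p] insert by simp
qed (simp_all add: curvature_zero[OF Y Z p])

lemma curvature_sum3:
  assumes Y: "smooth_vfield_on M U Y" and Z: "smooth_vfield_on M U Z" and p: "p \<in> U"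
    and "\<And>a. a \<in> A \<Longrightarrow> smooth_vfield_on M U (X a)" "\<And>a. a \<in> A \<Longrightarrow> smooth_on M U (f a)"
  shows "R Y Z (\<lambda>q h. \<Sum>a\<in>A. f a q * X a q h) p = (\<lambda>h. \<Sum>a\<in>A. f a p * R Y Z (X a) p h)"
  using assms(4,5)
proof (induction A rule: infinite_finite_induct)
  case (insert x A)
  have s: "smooth_vfield_on M U (\<lambda>q h. \<Sum>a\<in>A. f a q * X a q h)"
    by (rule vf_sum[OF vf_openin[OF Y]]) (use insert in auto)
  have x: "smooth_vfield_on M U (X x)" "smooth_on M U (f x)" using insert by auto
  show ?case
    using curvature_add3[OF Y Z vf_scale[OF x] s p] curvature_scale3[OF Y Z x(1) x(2) p] insert by simp
qed (simp_all add: curvature_zero[OF Y Z p])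

lemma curvature_sum2:
  assumes Y: "smooth_vfield_on M U Y" and Z: "smooth_vfield_on M U Z" and p: "p \<in> U"
    and X: "\<And>a. a \<in> A \<Longrightarrow> smooth_vfield_on M U (X a)" and f: "\<And>a. a \<in> A \<Longrightarrow> smooth_on M U (f a)"
  shows "R Y (\<lambda>q h. \<Sum>a\<in>A. f a q * X a q h) Z p = (\<lambda>h. \<Sum>a\<in>A. f a p * R Y (X a) Z p h)"
proof -
  have s: "smooth_vfield_on M U (\<lambda>q h. \<Sum>a\<in>A. f a q * X a q h)"
    by (rule vf_sum[OF vf_openin[OF Y]]) (use X f in auto)
  have "R (\<lambda>q h. \<Sum>a\<in>A. f a q * X a q h) Y Z p = (\<lambda>h. \<Sum>a\<in>A. f a p * R (X a) Y Z p h)"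
    using Y Z p X f by (rule curvature_sum1)
  then show ?thesis
    unfolding curvature_swap[OF s Y Z p] using curvature_swap[OF X Y Z p] by (simp add: sum_negf)
qed

end

section \<open>Metrics, orthogonal frames and scalar curvature\<close>

text \<open>Lengths are normalised by the power -1/2, because \<open>smooth_on_powr\<close> covers
  real powers of positive smooth functions.\<close>

lemma powr_neg_half:
  fixes x :: real
  assumes "x > 0"
  shows "x powr (- 1 / 2) * x powr (- 1 / 2) * x = 1"
proof -
  have "x powr (- 1 / 2) * x powr (- 1 / 2) = x powr (- 1)" by (simp flip: powr_add)
  then show ?thesis using assms by (simp add: powr_minus)
qed

text \<open>No signature is fixed, so that the Riemannian fibres and the Lorentzian product are both
  instances. Nondegeneracy enters through orthogonal frames, positivity in
  \<open>riemannian_mfd\<close>.\<close>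

locale metric_mfd = charted +
  fixes g :: "'a metric"
  assumes g_sym: "p \<in> topspace (mtop M) \<Longrightarrow> u \<in> tangent_space M p \<Longrightarrow> v \<in> tangent_space M p \<Longrightarrow>
      g p u v = g p v u"
    and g_lin: "p \<in> topspace (mtop M) \<Longrightarrow> u \<in> tangent_space M p \<Longrightarrow> v \<in> tangent_space M p \<Longrightarrow>
      w \<in> tangent_space M p \<Longrightarrow> g p (\<lambda>f. a * u f + b * v f) w = a * g p u w + b * g p v w"
    and g_smooth: "smooth_vfield_on M U X \<Longrightarrow> smooth_vfield_on M U Y \<Longrightarrow>
      smooth_on M U (\<lambda>p. g p (X p) (Y p))"
begin

lemma g_add:
  assumes "p \<in> topspace (mtop M)" "u \<in> tangent_space M p" "v \<in> tangent_space M p" "w \<in> tangent_space M p"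
  shows "g p (\<lambda>f. u f + v f) w = g p u w + g p v w" "g p w (\<lambda>f. u f + v f) = g p w u + g p w v"
  using g_lin[OF assms, of 1 1] g_sym[OF assms(1,4)] assms tv_plus by simp_all

lemma g_scale:
  assumes "p \<in> topspace (mtop M)" "u \<in> tangent_space M p" "w \<in> tangent_space M p"
  shows "g p (\<lambda>f. a * u f) w = a * g p u w" "g p w (\<lambda>f. a * u f) = a * g p w u"
  using g_lin[OF assms(1,2,2,3), of a 0] g_sym[OF assms(1,3)] assms tv_scaled by simp_all

lemma g_zero:
  assumes "p \<in> topspace (mtop M)" "w \<in> tangent_space M p"
  shows "g p (\<lambda>f. 0) w = 0" "g p w (\<lambda>f. 0) = 0"
  using g_scale[OF assms(1,2,2), of 0] by simp_all

lemma g_diff: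
  assumes "p \<in> topspace (mtop M)" "u \<in> tangent_space M p" "v \<in> tangent_space M p" "w \<in> tangent_space M p"
  shows "g p (\<lambda>f. u f - v f) w = g p u w - g p v w" "g p w (\<lambda>f. u f - v f) = g p w u - g p w v"
  using g_lin[OF assms, of 1 "- 1"] g_sym[OF assms(1,4)] assms tv_sub by simp_all

lemma g_sum:
  assumes p: "p \<in> topspace (mtop M)" and w: "w \<in> tangent_space M p" and "\<And>a. a \<in> A \<Longrightarrow> v a \<in> tangent_space M p"
  shows "g p (\<lambda>f. \<Sum>a\<in>A. c a * v a f) w = (\<Sum>a\<in>A. c a * g p (v a) w)"
    and "g p w (\<lambda>f. \<Sum>a\<in>A. c a * v a f) = (\<Sum>a\<in>A. c a * g p w (v a))"
proof -
  show *: "g p (\<lambda>f. \<Sum>a\<in>A. c a * v a f) w = (\<Sum>a\<in>A. c a * g p (v a) w)"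
    using assms(3)
  proof (induction A rule: infinite_finite_induct)
    case (insert x A)
    then show ?case
      using g_lin[OF p _ tv_setsum w, of "v x" A v "c x" 1 c] by simp
  qed (simp_all add: g_zero[OF p w])
  have "g p w (\<lambda>f. \<Sum>a\<in>A. c a * v a f) = g p (\<lambda>f. \<Sum>a\<in>A. c a * v a f) w"
    by (rule g_sym[OF p w tv_setsum]) (rule assms(3))
  also have "\<dots> = (\<Sum>a\<in>A. c a * g p w (v a))"
    unfolding * using g_sym[OF p w assms(3)] by simp
  finally show "g p w (\<lambda>f. \<Sum>a\<in>A. c a * v a f) = (\<Sum>a\<in>A. c a * g p w (v a))" .
qed

text \<open>As many orthogonal vectors of nonzero square as the dimension span the tangent space,
  whatever the signature. Orthogonality says A B = 1, where A holds the components of the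
  \<open>e a\<close> and B their scaled products with the coordinate vectors. The matrices are
  square, so B A = 1, which is the expansion of every coordinate vector in the
  \<open>e a\<close>.\<close>

lemma orthogonal_expansion:
  assumes p: "p \<in> topspace (mtop M)" and J: "finite J" "card J = n"
    and e: "\<And>a. a \<in> J \<Longrightarrow> e a \<in> tangent_space M p"
    and orth: "\<And>a b. a \<in> J \<Longrightarrow> b \<in> J \<Longrightarrow> g p (e a) (e b) = (if a = b then c a else 0)"
    and c: "\<And>a. a \<in> J \<Longrightarrow> c a \<noteq> 0"
    and w: "w \<in> tangent_space M p"
  shows "w = (\<lambda>f. \<Sum>a\<in>J. g p w (e a) / c a * e a f)"
proof -
  obtain V \<psi> where V: "(V, \<psi>) \<in> atlas M" "p \<in> V" using chart_at[OF p] .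
  obtain \<sigma> where \<sigma>: "bij_betw \<sigma> {0..<n} J" using ex_bij_betw_nat_finite[OF J(1)] J(2) by auto
  have \<sigma>J: "\<sigma> j \<in> J" if "j < n" for j using bij_betwE[OF \<sigma>] that by auto
  have \<sigma>inj: "\<sigma> i = \<sigma> j \<longleftrightarrow> i = j" if "i < n" "j < n" for i j
    using bij_betw_imp_inj_on[OF \<sigma>] that by (auto simp: inj_on_eq_iff)
  let ?C = "\<lambda>k. coord_field V \<psi> k p"
  have C: "?C k \<in> tangent_space M p" if "k < n" for k by (rule coord_field_tangent[OF V that])
  let ?x = "\<lambda>k q. \<psi> q k"
  have gx: "g p v u = (\<Sum>k<n. v (?x k) * g p (?C k) u)"
    if "v \<in> tangent_space M p" "u \<in> tangent_space M p" for v u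
    using g_sum(1)[OF p that(2), of "{..<n}" ?C "\<lambda>k. v (?x k)"] C tv_expand_coord[OF V that(1)] by simp
  define A where "A = mat n n (\<lambda>(j, k). e (\<sigma> j) (?x k))"
  define B where "B = mat n n (\<lambda>(k, j). g p (?C k) (e (\<sigma> j)) / c (\<sigma> j))"
  have carr: "A \<in> carrier_mat n n" "B \<in> carrier_mat n n" by (simp_all add: A_def B_def)
  have "A * B = 1\<^sub>m n"
  proof (rule eq_matI)
    fix i j assume "i < dim_row (1\<^sub>m n :: real mat)" "j < dim_col (1\<^sub>m n :: real mat)"
    then have ij: "i < n" "j < n" by simp_all
    have "(A * B) $$ (i, j) = (\<Sum>k<n. e (\<sigma> i) (?x k) * (g p (?C k) (e (\<sigma> j)) / c (\<sigma> j)))"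
      using ij by (simp add: A_def B_def scalar_prod_def atLeast0LessThan)
    also have "\<dots> = g p (e (\<sigma> i)) (e (\<sigma> j)) / c (\<sigma> j)"
      unfolding gx[OF e[OF \<sigma>J[OF ij(1)]] e[OF \<sigma>J[OF ij(2)]]] by (simp add: sum_divide_distrib)
    also have "\<dots> = (if i = j then 1 else 0)"
      using orth[OF \<sigma>J[OF ij(1)] \<sigma>J[OF ij(2)]] c[OF \<sigma>J[OF ij(2)]] \<sigma>inj[OF ij] by auto
    finally show "(A * B) $$ (i, j) = 1\<^sub>m n $$ (i, j)" using ij by simp
  qed (simp_all add: A_def B_def)
  then have BA: "B * A = 1\<^sub>m n" by (rule mat_mult_left_right_inverse[OF carr])
  have inv: "(\<Sum>j<n. g p (?C k) (e (\<sigma> j)) / c (\<sigma> j) * e (\<sigma> j) (?x l)) = (if k = l then 1 else 0)"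
    if kl: "k < n" "l < n" for k l
  proof -
    have "(B * A) $$ (k, l) = (\<Sum>j<n. g p (?C k) (e (\<sigma> j)) / c (\<sigma> j) * e (\<sigma> j) (?x l))"
      using kl by (simp add: A_def B_def scalar_prod_def atLeast0LessThan)
    then show ?thesis using BA kl by simp
  qed
  show ?thesis
  proof (rule tv_eqI[OF V w])
    show "(\<lambda>f. \<Sum>a\<in>J. g p w (e a) / c a * e a f) \<in> tangent_space M p" by (rule tv_setsum) (rule e)
    fix l assume l: "l < n"
    have "(\<Sum>a\<in>J. g p w (e a) / c a * e a (?x l)) = (\<Sum>j<n. g p w (e (\<sigma> j)) / c (\<sigma> j) * e (\<sigma> j) (?x l))"
      using sum.reindex_bij_betw[OF \<sigma>, of "\<lambda>a. g p w (e a) / c a * e a (?x l)"] by (simp add: atLeast0LessThan)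
    also have "\<dots> = (\<Sum>j<n. \<Sum>k<n. w (?x k) * (g p (?C k) (e (\<sigma> j)) / c (\<sigma> j) * e (\<sigma> j) (?x l)))"
    proof (rule sum.cong[OF refl])
      fix j assume "j \<in> {..<n}"
      then have "e (\<sigma> j) \<in> tangent_space M p" using e \<sigma>J by simp
      from gx[OF w this] show "g p w (e (\<sigma> j)) / c (\<sigma> j) * e (\<sigma> j) (?x l) =
          (\<Sum>k<n. w (?x k) * (g p (?C k) (e (\<sigma> j)) / c (\<sigma> j) * e (\<sigma> j) (?x l)))"
        by (simp add: sum_divide_distrib sum_distrib_right mult.assoc)
    qed
    also have "\<dots> = (\<Sum>k<n. w (?x k) * (\<Sum>j<n. g p (?C k) (e (\<sigma> j)) / c (\<sigma> j) * e (\<sigma> j) (?x l)))"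
      by (subst sum.swap) (simp add: sum_distrib_left)
    also have "\<dots> = (\<Sum>k<n. w (?x k) * (if k = l then 1 else 0))"
      by (rule sum.cong[OF refl]) (use inv l in simp)
    also have "\<dots> = w (?x l)" using l by (simp add: if_distrib[of "times _"] cong: if_cong)
    finally show "w (?x l) = (\<Sum>a\<in>J. g p w (e a) / c a * e a (?x l))" by simp
  qed
qed

text \<open>The factors \<open>d\<close> may vary with the point and the index set is arbitrary, so
  that unnormalised lifts, indexed by pairs, can serve as a frame. As the signs \<open>s\<close>
  square to 1, the inverse of \<open>s a * d a p\<close> is \<open>s a / d a p\<close>.\<close>

definition orth_frame :: "'a set \<Rightarrow> 'j set \<Rightarrow> ('j \<Rightarrow> 'a vfield) \<Rightarrow> ('j \<Rightarrow> real) \<Rightarrow> ('j \<Rightarrow> 'a \<Rightarrow> real) \<Rightarrow> bool" where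
  "orth_frame U J X s d \<longleftrightarrow> opn U \<and> finite J \<and> card J = n \<and>
    (\<forall>a\<in>J. smooth_vfield_on M U (X a) \<and> s a \<in> {1, -1} \<and> (\<forall>p\<in>U. d a p > 0)) \<and>
    (\<forall>a\<in>J. \<forall>b\<in>J. \<forall>p\<in>U. g p (X a p) (X b p) = (if a = b then s a * d a p else 0))"

lemma orth_frameD:
  assumes "orth_frame U J X s d"
  shows "opn U" "finite J" "card J = n"
    and "a \<in> J \<Longrightarrow> smooth_vfield_on M U (X a)" "a \<in> J \<Longrightarrow> s a * s a = 1" "a \<in> J \<Longrightarrow> s a \<in> {1, -1}"
    and "a \<in> J \<Longrightarrow> p \<in> U \<Longrightarrow> d a p > 0"
    and "a \<in> J \<Longrightarrow> b \<in> J \<Longrightarrow> p \<in> U \<Longrightarrow> g p (X a p) (X b p) = (if a = b then s a * d a p else 0)"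
  using assms by (auto simp: orth_frame_def)

lemma opn_topspace: "opn U \<Longrightarrow> p \<in> U \<Longrightarrow> p \<in> topspace (mtop M)"
  using openin_subset by blast

lemma orth_frame_expansion:
  assumes F: "orth_frame U J X s d" and p: "p \<in> U" and w: "w \<in> tangent_space M p"
  shows "w = (\<lambda>f. \<Sum>a\<in>J. s a / d a p * g p w (X a p) * X a p f)"
proof -
  note * = orth_frameD[OF F]
  have "w = (\<lambda>f. \<Sum>a\<in>J. g p w (X a p) / (s a * d a p) * X a p f)"
  proof (rule orthogonal_expansion[OF opn_topspace[OF *(1) p] *(2,3) vf_tangent[OF *(4) p] *(8)[OF _ _ p] _ w])
    show "s a * d a p \<noteq> 0" if "a \<in> J" for a using *(6)[OF that] *(7)[OF that p] by auto
  qed auto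
  moreover have "x / (s a * d a p) = s a / d a p * x" if "a \<in> J" for a x
    using *(6)[OF that] by auto
  ultimately show ?thesis by simp
qed

lemma orth_frame_d_smooth:
  assumes F: "orth_frame U J X s d" and a: "a \<in> J"
  shows "smooth_on M U (d a)"
proof -
  note * = orth_frameD[OF F]
  have "smooth_on M U (\<lambda>p. s a * g p (X a p) (X a p))"
    by (intro smooth_on_cmult g_smooth *(4)[OF a])
  then show ?thesis
    by (rule smooth_on_cong) (use *(8)[OF a a] *(5)[OF a] in \<open>simp add: mult.assoc[symmetric]\<close>)
qed

text \<open>Needed because \<open>local_frame\<close> is a choice: a witness is required before
  anything can be said about the frame that it selects. Dividing each field by the root of
  \<open>d\<close> keeps the signs.\<close>

lemma orthonormal_frame_exists:
  assumes F: "orth_frame U J X s d" and p: "p \<in> U"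
  shows "\<exists>F U. openin (mtop M) U \<and> p \<in> U \<and> orthonormal_frame_on M g U (fst F) (snd F)"
proof -
  note * = orth_frameD[OF F]
  obtain \<sigma> where \<sigma>: "bij_betw \<sigma> {0..<n} J" using ex_bij_betw_nat_finite[OF *(2)] *(3) by auto
  have \<sigma>J: "\<sigma> j \<in> J" if "j < n" for j using bij_betwE[OF \<sigma>] that by auto
  have \<sigma>inj: "\<sigma> i = \<sigma> j \<longleftrightarrow> i = j" if "i < n" "j < n" for i j
    using bij_betw_imp_inj_on[OF \<sigma>] that by (auto simp: inj_on_eq_iff)
  define e where "e j = (\<lambda>p f. (d (\<sigma> j) p powr (- 1 / 2)) * X (\<sigma> j) p f)" for j
  have "orthonormal_frame_on M g U e (s \<circ> \<sigma>)"
    unfolding orthonormal_frame_on_def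
  proof (intro conjI allI impI ballI)
    fix k assume k: "k < n"
    show "smooth_vfield_on M U (e k)" unfolding e_def
      by (intro vf_scale *(4) \<sigma>J k smooth_on_powr orth_frame_d_smooth[OF F] *(7))
    show "(s \<circ> \<sigma>) k \<in> {1, -1}" using *(6) \<sigma>J k by simp
    fix q j assume q: "q \<in> U" and j: "j < n"
    note qt = opn_topspace[OF *(1) q]
    have t: "X (\<sigma> i) q \<in> tangent_space M q" if "i < n" for i using vf_tangent[OF *(4) q] \<sigma>J that by blast
    have "g q (e j q) (e k q) = d (\<sigma> j) q powr (- 1 / 2) * (d (\<sigma> k) q powr (- 1 / 2) * g q (X (\<sigma> j) q) (X (\<sigma> k) q))"
      unfolding e_def using g_scale[OF qt] t j k tv_scaled by simp
    also have "\<dots> = (if j = k then (s \<circ> \<sigma>) k else 0)"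
    proof (cases "j = k")
      case True
      have "d (\<sigma> k) q powr (- 1 / 2) * d (\<sigma> k) q powr (- 1 / 2) * d (\<sigma> k) q = 1"
        by (rule powr_neg_half[OF *(7)[OF \<sigma>J[OF k] q]])
      then show ?thesis using True *(8)[OF \<sigma>J[OF k] \<sigma>J[OF k] q] by (simp add: algebra_simps)
    next
      case False
      then show ?thesis using *(8)[OF \<sigma>J[OF j] \<sigma>J[OF k] q] \<sigma>inj[OF j k] by simp
    qed
    finally show "g q (e j q) (e k q) = (if j = k then (s \<circ> \<sigma>) k else 0)" .
  qed
  then show ?thesis using *(1) p by (intro exI[of _ "(e, s \<circ> \<sigma>)"] exI[of _ U]) auto
qed

section \<open>Change of frame in the double trace\<close>

lemma local_frame_orth:
  assumes "orth_frame U J X s d" "p \<in> U" "local_frame M g p = (e, \<epsilon>)"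
  obtains W where "p \<in> W" "orth_frame W {..<n} e \<epsilon> (\<lambda>_ _. 1)"
proof -
  have "\<exists>U. opn U \<and> p \<in> U \<and> orthonormal_frame_on M g U (fst (local_frame M g p)) (snd (local_frame M g p))"
    unfolding local_frame_def by (rule someI_ex[OF orthonormal_frame_exists[OF assms(1,2)]])
  then obtain W where "opn W" "p \<in> W" "orthonormal_frame_on M g W e \<epsilon>" using assms(3) by auto
  moreover from this have "orth_frame W {..<n} e \<epsilon> (\<lambda>_ _. 1)"
    unfolding orth_frame_def orthonormal_frame_on_def by auto
  ultimately show ?thesis using that by blast
qed

lemma orth_frame_subset:
  assumes F: "orth_frame U J X s d" and "opn W" "W \<subseteq> U"
  shows "orth_frame W J X s d"
  using assms vf_subset[OF orth_frameD(4)[OF F] assms(2,3)] unfolding orth_frame_def by blast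

end

text \<open>Frame independence of a trace: \<open>A j a\<close> is the component of the j-th vector
  of one frame along the a-th vector of another, and the assumption says that both frames define the
  same inverse metric.\<close>

lemma trace_change:
  fixes A :: "'k \<Rightarrow> 'j \<Rightarrow> real"
  assumes "finite J" "\<And>a c. a \<in> J \<Longrightarrow> c \<in> J \<Longrightarrow> (\<Sum>j\<in>K. \<epsilon> j * A j a * A j c) = (if a = c then t a else 0)"
  shows "(\<Sum>j\<in>K. \<epsilon> j * (\<Sum>a\<in>J. \<Sum>c\<in>J. A j a * A j c * B a c)) = (\<Sum>a\<in>J. t a * B a a)"
proof -
  have "(\<Sum>j\<in>K. \<epsilon> j * (\<Sum>a\<in>J. \<Sum>c\<in>J. A j a * A j c * B a c)) =
      (\<Sum>j\<in>K. \<Sum>a\<in>J. \<Sum>c\<in>J. \<epsilon> j * A j a * A j c * B a c)"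
    by (simp add: sum_distrib_left mult.assoc)
  also have "\<dots> = (\<Sum>a\<in>J. \<Sum>j\<in>K. \<Sum>c\<in>J. \<epsilon> j * A j a * A j c * B a c)" by (rule sum.swap)
  also have "\<dots> = (\<Sum>a\<in>J. \<Sum>c\<in>J. (\<Sum>j\<in>K. \<epsilon> j * A j a * A j c) * B a c)"
    by (rule sum.cong[OF refl], subst sum.swap) (simp add: sum_distrib_right)
  also have "\<dots> = (\<Sum>a\<in>J. \<Sum>c\<in>J. (if a = c then t a else 0) * B a c)"
    by (intro sum.cong refl) (use assms(2) in simp)
  also have "\<dots> = (\<Sum>a\<in>J. t a * B a a)"
    using assms(1) by (intro sum.cong refl) (simp add: if_distrib[of "\<lambda>x. x * _"] cong: if_cong)
  finally show ?thesis .
qed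

locale metric_affine = metric_mfd + affine
begin

text \<open>Although the coefficients \<open>A j a\<close> vary with the point, tensoriality pulls
  them out of all three slots. \<open>trace_change\<close> is used twice: for the second slot with
  the frame vector \<open>e k\<close> fixed, then for the first and third slots together.\<close>

lemma scalar_curvature_orth_frame:
  assumes F: "orth_frame U J X s d" and p: "p \<in> U"
  shows "scalar_curvature M g D p =
    (\<Sum>a\<in>J. \<Sum>b\<in>J. s a / d a p * (s b / d b p * g p (R (X a) (X b) (X a) p) (X b p)))"
proof -
  obtain e \<epsilon> where loc: "local_frame M g p = (e, \<epsilon>)" by fastforce
  obtain W where W: "p \<in> W" "orth_frame W {..<n} e \<epsilon> (\<lambda>_ _. 1)" using local_frame_orth[OF F p loc] .
  let ?N = "U \<inter> W"
  have N: "opn ?N" using orth_frameD(1)[OF F] orth_frameD(1)[OF W(2)] by blast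
  have pN: "p \<in> ?N" using p W(1) by simp
  note pt = opn_topspace[OF N pN]
  note FN = orth_frame_subset[OF F N] and EN = orth_frame_subset[OF W(2) N]
  have FN: "orth_frame ?N J X s d" and EN: "orth_frame ?N {..<n} e \<epsilon> (\<lambda>_ _. 1)" using FN EN by auto
  note f = orth_frameD[OF FN] and h = orth_frameD[OF EN]
  define A where "A j a q = s a / d a q * g q (e j q) (X a q)" for j a q
  have X: "smooth_vfield_on M ?N (X a)" if "a \<in> J" for a using f(4)[OF that] .
  have e: "smooth_vfield_on M ?N (e j)" if "j < n" for j using h(4) that by simp
  have As: "smooth_on M ?N (A j a)" if "j < n" "a \<in> J" for j a
  proof -
    have "smooth_on M ?N (\<lambda>q. (s a * d a q powr - 1) * g q (e j q) (X a q))"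
      by (intro smooth_on_mult smooth_on_const[OF N] smooth_on_powr orth_frame_d_smooth[OF FN] g_smooth X e f(7) that)
    then show ?thesis
    proof (rule smooth_on_cong)
      fix q assume "q \<in> ?N"
      then have "d a q > 0" by (rule f(7)[OF that(2)])
      then show "s a * d a q powr - 1 * g q (e j q) (X a q) = A j a q"
        by (simp add: A_def powr_minus divide_inverse)
    qed
  qed
  have ex: "e j q = (\<lambda>k. \<Sum>a\<in>J. A j a q * X a q k)" if "j < n" "q \<in> ?N" for j q
    unfolding A_def by (rule orth_frame_expansion[OF FN that(2) vf_tangent[OF e[OF that(1)] that(2)]])
  have Xt: "X a p \<in> tangent_space M p" if "a \<in> J" for a using vf_tangent[OF X[OF that] pN] .
  have et: "e j p \<in> tangent_space M p" if "j < n" for j using vf_tangent[OF e[OF that] pN] .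
  have A_orth: "(\<Sum>j\<in>{..<n}. \<epsilon> j * A j a p * A j c p) = (if a = c then s a / d a p else 0)"
    if ac: "a \<in> J" "c \<in> J" for a c
  proof -
    \<comment> \<open>Parseval's identity in the orthonormal frame \<open>e\<close>. Multiplied by
      the inverse squares of \<open>X a\<close> and \<open>X c\<close>, it is the orthogonality
      relation for the coefficients.\<close>
    have "g p (X a p) (X c p) = (\<Sum>j\<in>{..<n}. \<epsilon> j / 1 * g p (X a p) (e j p) * g p (e j p) (X c p))"
      using g_sum(1)[OF pt Xt[OF ac(2)], of "{..<n}" "\<lambda>j. e j p" "\<lambda>j. \<epsilon> j / 1 * g p (X a p) (e j p)"] et
        orth_frame_expansion[OF EN pN Xt[OF ac(1)]] by simp
    also have "\<dots> = (\<Sum>j\<in>{..<n}. \<epsilon> j * g p (e j p) (X a p) * g p (e j p) (X c p))"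
      using g_sym[OF pt Xt[OF ac(1)] et] by (intro sum.cong) auto
    finally have "(\<Sum>j\<in>{..<n}. \<epsilon> j * A j a p * A j c p) = s a / d a p * (s c / d c p) * g p (X a p) (X c p)"
      by (simp add: A_def sum_distrib_left mult_ac)
    then show ?thesis using f(8)[OF ac pN] f(5)[OF ac(1)] f(7)[OF ac(1) pN]
      by (cases "a = c") (simp_all add: field_simps)
  qed
  have Rs: "R Y Z Y' p \<in> tangent_space M p"
    if "smooth_vfield_on M ?N Y" "smooth_vfield_on M ?N Z" "smooth_vfield_on M ?N Y'" for Y Z Y'
    using vf_tangent[OF curvature_smooth[OF that] pN] .
  have inner: "(\<Sum>j\<in>{..<n}. \<epsilon> j * g p (R (e k) (e j) (e k) p) (e j p)) =
      (\<Sum>b\<in>J. s b / d b p * g p (R (e k) (X b) (e k) p) (X b p))" if k: "k < n" for k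
  proof -
    have "g p (R (e k) (e j) (e k) p) (e j p) = (\<Sum>b\<in>J. \<Sum>c\<in>J. A j b p * A j c p * g p (R (e k) (X b) (e k) p) (X c p))"
      if j: "j < n" for j
    proof -
      have "R (e k) (e j) (e k) p = R (e k) (\<lambda>q h. \<Sum>b\<in>J. A j b q * X b q h) (e k) p"
        by (rule curvature_cong[OF e[OF k] e[OF j] e[OF k] pN]) (simp_all only: ex[OF j])
      also have "\<dots> = (\<lambda>h. \<Sum>b\<in>J. A j b p * R (e k) (X b) (e k) p h)"
        by (rule curvature_sum2[OF e[OF k] e[OF k] pN X As[OF j]])
      finally have "g p (R (e k) (e j) (e k) p) (e j p) = (\<Sum>b\<in>J. A j b p * g p (R (e k) (X b) (e k) p) (e j p))"
        using g_sum(1)[OF pt et[OF j], of J "\<lambda>b. R (e k) (X b) (e k) p" "\<lambda>b. A j b p"] Rs[OF e[OF k] X e[OF k]] by simp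
      also have "\<dots> = (\<Sum>b\<in>J. A j b p * (\<Sum>c\<in>J. A j c p * g p (R (e k) (X b) (e k) p) (X c p)))"
      proof (rule sum.cong[OF refl])
        fix b assume b: "b \<in> J"
        show "A j b p * g p (R (e k) (X b) (e k) p) (e j p) =
            A j b p * (\<Sum>c\<in>J. A j c p * g p (R (e k) (X b) (e k) p) (X c p))"
          using g_sum(2)[OF pt Rs[OF e[OF k] X[OF b] e[OF k]], of J "\<lambda>c. X c p" "\<lambda>c. A j c p"] Xt ex[OF j pN] by simp
      qed
      finally show ?thesis by (simp add: sum_distrib_left mult.assoc)
    qed
    then have "(\<Sum>j\<in>{..<n}. \<epsilon> j * g p (R (e k) (e j) (e k) p) (e j p)) =
       (\<Sum>j\<in>{..<n}. \<epsilon> j * (\<Sum>b\<in>J. \<Sum>c\<in>J. A j b p * A j c p * g p (R (e k) (X b) (e k) p) (X c p)))"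
      by (intro sum.cong) auto
    also have "\<dots> = (\<Sum>b\<in>J. s b / d b p * g p (R (e k) (X b) (e k) p) (X b p))"
      by (rule trace_change[OF f(2) A_orth])
    finally show ?thesis .
  qed
  have outer: "(\<Sum>k\<in>{..<n}. \<epsilon> k * g p (R (e k) (X b) (e k) p) (X b p)) =
      (\<Sum>a\<in>J. s a / d a p * g p (R (X a) (X b) (X a) p) (X b p))" if b: "b \<in> J" for b
  proof -
    have "g p (R (e k) (X b) (e k) p) (X b p) = (\<Sum>a\<in>J. \<Sum>c\<in>J. A k a p * A k c p * g p (R (X a) (X b) (X c) p) (X b p))"
      if k: "k < n" for k
    proof -
      have S: "smooth_vfield_on M ?N (\<lambda>q h. \<Sum>a\<in>J. A k a q * X a q h)"
        by (rule vf_sum[OF N X As[OF k]])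
      have "R (e k) (X b) (e k) p = R (\<lambda>q h. \<Sum>a\<in>J. A k a q * X a q h) (X b) (\<lambda>q h. \<Sum>a\<in>J. A k a q * X a q h) p"
        by (rule curvature_cong[OF e[OF k] X[OF b] e[OF k] pN]) (simp_all only: ex[OF k])
      also have "\<dots> = (\<lambda>h. \<Sum>a\<in>J. A k a p * R (X a) (X b) (\<lambda>q h. \<Sum>a\<in>J. A k a q * X a q h) p h)"
        by (rule curvature_sum1[OF X[OF b] S pN X As[OF k]])
      finally have "g p (R (e k) (X b) (e k) p) (X b p) =
          (\<Sum>a\<in>J. A k a p * g p (R (X a) (X b) (\<lambda>q h. \<Sum>a\<in>J. A k a q * X a q h) p) (X b p))"
        using g_sum(1)[OF pt Xt[OF b], of J "\<lambda>a. R (X a) (X b) (\<lambda>q h. \<Sum>a\<in>J. A k a q * X a q h) p" "\<lambda>a. A k a p"]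
          Rs[OF X X[OF b] S] by simp
      also have "\<dots> = (\<Sum>a\<in>J. A k a p * (\<Sum>c\<in>J. A k c p * g p (R (X a) (X b) (X c) p) (X b p)))"
      proof (rule sum.cong[OF refl])
        fix a assume a: "a \<in> J"
        have "R (X a) (X b) (\<lambda>q h. \<Sum>a\<in>J. A k a q * X a q h) p = (\<lambda>h. \<Sum>c\<in>J. A k c p * R (X a) (X b) (X c) p h)"
          by (rule curvature_sum3[OF X[OF a] X[OF b] pN X As[OF k]])
        then show "A k a p * g p (R (X a) (X b) (\<lambda>q h. \<Sum>a\<in>J. A k a q * X a q h) p) (X b p) =
            A k a p * (\<Sum>c\<in>J. A k c p * g p (R (X a) (X b) (X c) p) (X b p))"
          using g_sum(1)[OF pt Xt[OF b], of J "\<lambda>c. R (X a) (X b) (X c) p" "\<lambda>c. A k c p"] Rs[OF X[OF a] X[OF b] X] by simp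
      qed
      finally show ?thesis by (simp add: sum_distrib_left mult.assoc)
    qed
    then have "(\<Sum>k\<in>{..<n}. \<epsilon> k * g p (R (e k) (X b) (e k) p) (X b p)) =
       (\<Sum>k\<in>{..<n}. \<epsilon> k * (\<Sum>a\<in>J. \<Sum>c\<in>J. A k a p * A k c p * g p (R (X a) (X b) (X c) p) (X b p)))"
      by (intro sum.cong) auto
    also have "\<dots> = (\<Sum>a\<in>J. s a / d a p * g p (R (X a) (X b) (X a) p) (X b p))"
      by (rule trace_change[OF f(2) A_orth])
    finally show ?thesis .
  qed
  have "scalar_curvature M g D p = (\<Sum>k\<in>{..<n}. \<epsilon> k * (\<Sum>j\<in>{..<n}. \<epsilon> j * g p (R (e k) (e j) (e k) p) (e j p)))"
    by (simp add: scalar_curvature_def ricci_def loc)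
  also have "\<dots> = (\<Sum>k\<in>{..<n}. \<epsilon> k * (\<Sum>b\<in>J. s b / d b p * g p (R (e k) (X b) (e k) p) (X b p)))"
    by (intro sum.cong refl) (simp add: inner)
  also have "\<dots> = (\<Sum>b\<in>J. s b / d b p * (\<Sum>k\<in>{..<n}. \<epsilon> k * g p (R (e k) (X b) (e k) p) (X b p)))"
    unfolding sum_distrib_left by (subst sum.swap) (simp add: mult_ac)
  also have "\<dots> = (\<Sum>b\<in>J. s b / d b p * (\<Sum>a\<in>J. s a / d a p * g p (R (X a) (X b) (X a) p) (X b p)))"
    by (intro sum.cong refl) (simp add: outer)
  also have "\<dots> = (\<Sum>a\<in>J. \<Sum>b\<in>J. s a / d a p * (s b / d b p * g p (R (X a) (X b) (X a) p) (X b p)))"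
    unfolding sum_distrib_left by (subst sum.swap) (simp add: mult_ac)
  finally show ?thesis .
qed

end

locale riemannian_mfd = metric_mfd +
  assumes g_pos: "p \<in> topspace (mtop M) \<Longrightarrow> u \<in> tangent_space M p \<Longrightarrow> u \<noteq> (\<lambda>f. 0) \<Longrightarrow> g p u u > 0"
begin

text \<open>Gram--Schmidt applied to the coordinate fields.  Recording that the first \<open>r\<close> fields kill the
  later coordinates shows that the next field does not vanish.\<close>

lemma gram_schmidt:
  assumes V: "(V, \<psi>) \<in> atlas M" and "r \<le> n"
  shows "\<exists>e. (\<forall>j<r. smooth_vfield_on M V (e j)) \<and>
    (\<forall>p\<in>V. \<forall>i<r. \<forall>j<r. g p (e i p) (e j p) = (if i = j then 1 else 0)) \<and>
    (\<forall>p\<in>V. \<forall>j<r. \<forall>k<n. r \<le> k \<longrightarrow> e j p (\<lambda>q. \<psi> q k) = 0)"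
  using assms(2)
proof (induction r)
  case (Suc r)
  note VO = chart_open[OF V]
  obtain e where E: "(\<forall>j<r. smooth_vfield_on M V (e j)) \<and>
    (\<forall>p\<in>V. \<forall>i<r. \<forall>j<r. g p (e i p) (e j p) = (if i = j then 1 else 0)) \<and>
    (\<forall>p\<in>V. \<forall>j<r. \<forall>k<n. r \<le> k \<longrightarrow> e j p (\<lambda>q. \<psi> q k) = 0)"
    using Suc.IH[OF Suc_leD[OF Suc.prems]] by (rule exE)
  have e: "\<And>j. j < r \<Longrightarrow> smooth_vfield_on M V (e j)"
    "\<And>p i j. p \<in> V \<Longrightarrow> i < r \<Longrightarrow> j < r \<Longrightarrow> g p (e i p) (e j p) = (if i = j then 1 else 0)"
    "\<And>p j k. p \<in> V \<Longrightarrow> j < r \<Longrightarrow> k < n \<Longrightarrow> r \<le> k \<Longrightarrow> e j p (\<lambda>q. \<psi> q k) = 0"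
    using E by simp_all
  have r: "r < n" using Suc.prems by simp
  let ?C = "coord_field V \<psi> r"
  have C: "smooth_vfield_on M V ?C" by (rule coord_field_smooth[OF V r])
  define N where "N p f = ?C p f - (\<Sum>j\<in>{..<r}. g p (?C p) (e j p) * e j p f)" for p f
  have S: "smooth_vfield_on M V (\<lambda>p f. \<Sum>j\<in>{..<r}. g p (?C p) (e j p) * e j p f)"
    by (rule vf_sum[OF VO]) (use e(1) g_smooth[OF C] in auto)
  have N: "smooth_vfield_on M V N"
    using vf_diff[OF C S] by (simp add: N_def[abs_def])
  have et: "e j p \<in> tangent_space M p" if "p \<in> V" "j < r" for p j using vf_tangent[OF e(1)[OF that(2)] that(1)] .
  have Ne: "g p (N p) (e i p) = 0" if p: "p \<in> V" and i: "i < r" for p i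
  proof -
    note pt = opn_topspace[OF VO p]
    have "g p (N p) (e i p) = g p (?C p) (e i p) - g p (\<lambda>f. \<Sum>j\<in>{..<r}. g p (?C p) (e j p) * e j p f) (e i p)"
      unfolding N_def[abs_def] by (rule g_diff(1)[OF pt vf_tangent[OF C p] vf_tangent[OF S p] et[OF p i]])
    also have "g p (\<lambda>f. \<Sum>j\<in>{..<r}. g p (?C p) (e j p) * e j p f) (e i p) =
        (\<Sum>j\<in>{..<r}. g p (?C p) (e j p) * g p (e j p) (e i p))"
      by (rule g_sum(1)[OF pt et[OF p i]]) (use et[OF p] in auto)
    also have "\<dots> = (\<Sum>j\<in>{..<r}. if j = i then g p (?C p) (e i p) else 0)"
      by (intro sum.cong refl) (use e(2)[OF p _ i] in auto)
    also have "\<dots> = g p (?C p) (e i p)" using i by simp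
    finally show ?thesis by simp
  qed
  have Nr: "N p (\<lambda>q. \<psi> q r) = 1" if "p \<in> V" for p
    using coord_field_coord[OF V that r r] e(3)[OF that _ r] by (simp add: N_def)
  have Nk: "N p (\<lambda>q. \<psi> q k) = 0" if "p \<in> V" "k < n" "Suc r \<le> k" for p k
    using coord_field_coord[OF V that(1) r that(2)] e(3)[OF that(1) _ that(2)] that(3) by (simp add: N_def)
  have pos: "g p (N p) (N p) > 0" if "p \<in> V" for p
    using g_pos[OF opn_topspace[OF VO that] vf_tangent[OF N that]] Nr[OF that] by force
  define u where "u p = g p (N p) (N p) powr (- 1 / 2)" for p
  have u: "smooth_on M V u" unfolding u_def[abs_def] by (intro smooth_on_powr g_smooth N pos)
  define e' where "e' = e(r := (\<lambda>p f. u p * N p f))"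
  have "smooth_vfield_on M V (e' j)" if "j < Suc r" for j
    using that e(1) vf_scale[OF N u] by (cases "j = r") (auto simp: e'_def)
  moreover have "g p (e' i p) (e' j p) = (if i = j then 1 else 0)" if p: "p \<in> V" and ij: "i < Suc r" "j < Suc r" for p i j
  proof -
    note pt = opn_topspace[OF VO p]
    note Nt = vf_tangent[OF N p]
    have 1: "g p (\<lambda>f. u p * N p f) (e j p) = 0" "g p (e j p) (\<lambda>f. u p * N p f) = 0" if "j < r" for j
      using g_scale[OF pt Nt et[OF p that]] Ne[OF p that] g_sym[OF pt Nt et[OF p that]] by simp_all
    have "g p (\<lambda>f. u p * N p f) (\<lambda>f. u p * N p f) = u p * u p * g p (N p) (N p)"
      using g_scale(1)[OF pt Nt tv_scaled[OF Nt]] g_scale(2)[OF pt Nt Nt] by simp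
    also have "\<dots> = 1" unfolding u_def by (rule powr_neg_half[OF pos[OF p]])
    finally show ?thesis using 1 e(2)[OF p] ij by (auto simp: e'_def less_Suc_eq)
  qed
  moreover have "e' j p (\<lambda>q. \<psi> q k) = 0" if "p \<in> V" "j < Suc r" "k < n" "Suc r \<le> k" for p j k
    using that e(3)[of p j k] Nk[of p k] by (auto simp: e'_def less_Suc_eq)
  ultimately show ?case by blast
qed simp

lemma orth_frame_at:
  assumes "p \<in> topspace (mtop M)"
  obtains U e where "p \<in> U" "orth_frame U {..<n} e (\<lambda>_. 1) (\<lambda>_ _. 1)"
proof -
  obtain V \<psi> where V: "(V, \<psi>) \<in> atlas M" "p \<in> V" using chart_at[OF assms] .
  obtain e where "\<forall>j<n. smooth_vfield_on M V (e j)"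
    "\<forall>p\<in>V. \<forall>i<n. \<forall>j<n. g p (e i p) (e j p) = (if i = j then 1 else 0)"
    using gram_schmidt[OF V(1) order_refl] by auto
  then have "orth_frame V {..<n} e (\<lambda>_. 1) (\<lambda>_ _. 1)"
    using chart_open[OF V(1)] by (simp add: orth_frame_def)
  with V(2) that show ?thesis by blast
qed

end

section \<open>Levi-Civita and quarter-symmetric connections\<close>

locale lc_mfd = metric_mfd + fixes D :: "'a conn" assumes lc: "levi_civita M g D"
begin

lemma lc_affine: "affine_connection M D"
  using lc unfolding levi_civita_def by blast

lemma lc_torsion:
  assumes "smooth_vfield_on M U X" "smooth_vfield_on M U Y" "p \<in> U"
  shows "lie_bracket M X Y p = (\<lambda>h. D X Y p h - D Y X p h)"
  using conjunct1[OF conjunct2[OF lc[unfolded levi_civita_def]], rule_format, of U X Y p] assms by simp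

lemma lc_compatible:
  assumes "smooth_vfield_on M U X" "smooth_vfield_on M U Y" "smooth_vfield_on M U Z" "p \<in> U"
  shows "X p (\<lambda>q. g q (Y q) (Z q)) = g p (D X Y p) (Z p) + g p (Y p) (D X Z p)"
  using conjunct2[OF conjunct2[OF lc[unfolded levi_civita_def]], rule_format, of U X Y Z p] assms by simp

end

text \<open>By torsion-freeness a bracket is the difference of the smooth fields
  \<open>D X Y\<close> and \<open>D Y X\<close>.\<close>

sublocale lc_mfd \<subseteq> metric_affine
proof
  show "affine_connection M D" by (rule lc_affine)
  show "smooth_vfield_on M U (lie_bracket M X Y)"
    if X: "smooth_vfield_on M U X" and Y: "smooth_vfield_on M U Y" for U X Y
  proof (rule vf_cong)
    have "smooth_vfield_on M U (D X Y)" "smooth_vfield_on M U (D Y X)"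
      using lc_affine that unfolding affine_connection_def by blast+
    then show "smooth_vfield_on M U (\<lambda>p h. D X Y p h - D Y X p h)" by (rule vf_diff)
    show "(\<lambda>h. D X Y p h - D Y X p h) = lie_bracket M X Y p" if "p \<in> U" for p
      using lc_torsion[OF X Y that] by simp
  qed
qed

context lc_mfd
begin

text \<open>The signed sum of three compatibility identities, in which torsion-freeness collects the
  unmatched derivatives into brackets. It is applied to the product and to its fibres, so that the
  two can be compared.\<close>

lemma koszul:
  assumes X: "smooth_vfield_on M U X" and Y: "smooth_vfield_on M U Y" and Z: "smooth_vfield_on M U Z" and p: "p \<in> U"
  shows "2 * g p (D X Y p) (Z p) =
    X p (\<lambda>q. g q (Y q) (Z q)) + Y p (\<lambda>q. g q (X q) (Z q)) - Z p (\<lambda>q. g q (X q) (Y q))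
    + g p (lie_bracket M X Y p) (Z p) - g p (lie_bracket M X Z p) (Y p) - g p (lie_bracket M Y Z p) (X p)"
proof -
  have pt: "p \<in> topspace (mtop M)" using opn_topspace[OF vf_openin[OF X] p] .
  note t = vf_tangent[OF _ p]
  note d = t[OF D_smooth]
  note T = t[OF X] t[OF Y] t[OF Z] d[OF X Y] d[OF Y X] d[OF X Z] d[OF Z X] d[OF Y Z] d[OF Z Y]
  show ?thesis
    unfolding lc_compatible[OF X Y Z p] lc_compatible[OF Y X Z p] lc_compatible[OF Z X Y p]
      lc_torsion[OF X Y p] lc_torsion[OF X Z p] lc_torsion[OF Y Z p]
    using g_diff(1)[OF pt T(4,5,3)] g_diff(1)[OF pt T(6,7,2)] g_diff(1)[OF pt T(8,9,1)]
      g_sym[OF pt T(2,6)] g_sym[OF pt T(1,8)] g_sym[OF pt T(1,9)] g_sym[OF pt T(2,7)]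
    by simp
qed

text \<open>The two added terms are linear over functions in \<open>X\<close> and in
  \<open>Y\<close>, so they do not disturb the Leibniz rule. The field \<open>P\<close> is global
  and is restricted to each \<open>U\<close>.\<close>

lemma quarter_symmetric_affine:
  assumes P: "smooth_vfield_on M (topspace (mtop M)) P"
  shows "affine_connection M (quarter_symmetric g D P l1 l2)"
  unfolding affine_connection_def
proof (intro conjI allI impI ballI; elim conjE)
  fix U X Y assume X: "smooth_vfield_on M U X" and Y: "smooth_vfield_on M U Y"
  note PU = vf_subset[OF P vf_openin[OF X] openin_subset[OF vf_openin[OF X]]]
  show "smooth_vfield_on M U (quarter_symmetric g D P l1 l2 X Y)"
    unfolding quarter_symmetric_def
    by (intro vf_diff vf_add vf_scale D_smooth X Y PU smooth_on_mult g_smooth smooth_on_const[OF vf_openin[OF X]])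
next
  fix U X Y Z f p
  assume X: "smooth_vfield_on M U X" and Y: "smooth_vfield_on M U Y" and Z: "smooth_vfield_on M U Z"
    and f: "smooth_on M U f" and p: "p \<in> U"
  have pt: "p \<in> topspace (mtop M)" using opn_topspace[OF vf_openin[OF X] p] .
  note t = vf_tangent[OF X p] vf_tangent[OF Y p] vf_tangent[OF Z p] vf_tangent[OF P pt]
  let ?D = "quarter_symmetric g D P l1 l2"
  show "?D (\<lambda>q h. X q h + Y q h) Z p = (\<lambda>h. ?D X Z p h + ?D Y Z p h)"
    unfolding quarter_symmetric_def D_add1[OF X Y Z p] g_add(1)[OF pt t(1,2,3)] by (simp add: algebra_simps)
  show "?D (\<lambda>q h. f q * X q h) Z p = (\<lambda>h. f p * ?D X Z p h)"
    unfolding quarter_symmetric_def D_scale1[OF X Z f p] g_scale(1)[OF pt t(1,3)] by (simp add: algebra_simps)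
  show "?D X (\<lambda>q h. Y q h + Z q h) p = (\<lambda>h. ?D X Y p h + ?D X Z p h)"
    unfolding quarter_symmetric_def D_add2[OF X Y Z p] g_add(1)[OF pt t(2,3,4)] g_add(2)[OF pt t(2,3,1)]
    by (simp add: algebra_simps)
  show "?D X (\<lambda>q h. f q * Y q h) p = (\<lambda>h. X p f * Y p h + f p * ?D X Y p h)"
    unfolding quarter_symmetric_def D_scale2[OF X Y f p] g_scale(1)[OF pt t(2,4)] g_scale(2)[OF pt t(2,1)]
    by (simp add: algebra_simps)
qed

end

section \<open>Charts of the product manifold\<close>

lemma continuous_map_Euclidean_coord: "continuous_map (Euclidean_space k) euclideanreal (\<lambda>y. y a)"
  unfolding continuous_map_Euclidean_space_iff
  by (rule continuous_on_product_then_coordinatewise[OF continuous_on_id])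

lemma continuous_map_Euclidean_componentwise:
  assumes "\<And>x. x \<in> topspace X \<Longrightarrow> f x \<in> topspace (Euclidean_space k)"
    "\<And>a. a < k \<Longrightarrow> continuous_map X euclideanreal (\<lambda>x. f x a)"
  shows "continuous_map X (Euclidean_space k) f"
proof (rule continuous_map_eq)
  show "continuous_map X (Euclidean_space k) (\<lambda>x a. if a < k then f x a else 0)"
    unfolding continuous_map_componentwise_Euclidean_space using assms(2) by blast
  show "(\<lambda>a. if a < k then f x a else 0) = f x" if "x \<in> topspace X" for x
    using assms(1)[OF that] by (auto simp: topspace_Euclidean_space)
qed

context charted
begin

lemma chart_continuous:
  assumes "(V, \<psi>) \<in> atlas M"
  shows "continuous_map (subtopology (mtop M) V) E \<psi>"
  using continuous_map_into_fulltopology[OF homeomorphic_imp_continuous_map[OF chart_homeo[OF assms]]] .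

lemma chart_inv_continuous:
  assumes V: "(V, \<psi>) \<in> atlas M"
  shows "continuous_map (subtopology E (\<psi> ` V)) (mtop M) (inv_into V \<psi>)"
proof -
  obtain h where h: "homeomorphic_maps (subtopology (mtop M) V) (subtopology E (\<psi> ` V)) \<psi> h"
    using chart_homeo[OF V] unfolding homeomorphic_map_maps by (rule exE)
  have "continuous_map (subtopology E (\<psi> ` V)) (mtop M) h"
    using h continuous_map_into_fulltopology unfolding homeomorphic_maps_def by blast
  then show ?thesis
  proof (rule continuous_map_eq)
    fix y assume "y \<in> topspace (subtopology E (\<psi> ` V))"
    then obtain q where q: "q \<in> V" "y = \<psi> q" by auto
    moreover have "q \<in> topspace (subtopology (mtop M) V)" using q chart_subset[OF V] by auto
    ultimately show "h y = inv_into V \<psi> y" using h V by (simp add: homeomorphic_maps_def)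
  qed
qed

end

section \<open>Index blocks of the product coordinates\<close>

lemma block_start_Suc: "1 \<le> i \<Longrightarrow> block_start F (Suc i) = block_start F i + mdim (F i)"
  by (simp add: block_start_def sum.atLeastLessThan_Suc)

lemma block_start_pos: "block_start F i > 0"
  by (simp add: block_start_def)

lemma block_end_le:
  assumes "1 \<le> i" "i < j"
  shows "block_start F i + mdim (F i) \<le> block_start F j"
proof -
  have "block_start F (Suc i) \<le> block_start F j"
    unfolding block_start_def using assms by (intro add_left_mono sum_mono2) auto
  then show ?thesis using block_start_Suc[OF assms(1), of F] by simp
qed

text \<open>The blocks are disjoint, so at an index of a block exactly one term of the sum defining
  \<open>product_coords\<close> is selected.\<close>

lemma in_block_iff:
  assumes "1 \<le> i" "1 \<le> j" "a < mdim (F i)"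
  shows "block_start F j \<le> block_start F i + a \<and> block_start F i + a < block_start F j + mdim (F j) \<longleftrightarrow> i = j"
  using block_end_le[OF assms(1), of j F] block_end_le[OF assms(2), of i F] assms(3)
  by (cases i j rule: linorder_cases) auto

locale product_base =
  fixes I :: "real set" and m :: nat and F :: "nat \<Rightarrow> 'a mfd"
  assumes open_I: "open I" and fib: "i \<in> {1..m} \<Longrightarrow> charted (F i)"
begin

abbreviation "l i \<equiv> mdim (F i)"
abbreviation "bs \<equiv> block_start F"
abbreviation "M \<equiv> kasner_manifold I m F"
abbreviation "N \<equiv> 1 + (\<Sum>i\<in>{1..m}. mdim (F i))"
abbreviation "P \<equiv> product_coords m F"

text \<open>Recovers the coordinates of one fibre from product coordinates. Padding by zero puts
  them in \<open>Euclidean_space (l i)\<close>, where the fibre charts take their values.\<close>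

definition block :: "nat \<Rightarrow> (nat \<Rightarrow> real) \<Rightarrow> nat \<Rightarrow> real" where
  "block i y = (\<lambda>a. if a < l i then y (bs i + a) else 0)"

lemma mdim_M: "mdim M = N" and mtop_M: "mtop M = prod_topology (top_of_set I) (product_topology (\<lambda>i. mtop (F i)) {1..m})"
  by (simp_all add: kasner_manifold_def)

lemma topspace_M: "topspace (mtop M) = I \<times> (\<Pi>\<^sub>E i\<in>{1..m}. topspace (mtop (F i)))"
  by (simp add: mtop_M)

lemma bs_end: "bs (Suc m) = N"
proof -
  have "{1..<Suc m} = {1..m}" by auto
  then show ?thesis by (simp add: block_start_def)
qed

lemma block_bound:
  assumes "i \<in> {1..m}" "a < l i"
  shows "bs i + a < N"
  using block_end_le[of i "Suc m" F] assms bs_end by simp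

lemma block_cases:
  assumes "k < N"
  obtains "k = 0" | i a where "i \<in> {1..m}" "a < l i" "k = bs i + a"
proof -
  \<comment> \<open>\<open>bs (Suc j)\<close> is the end of block \<open>j\<close>, so each step of
    the induction adds one block; after \<open>m\<close> blocks all indices are reached.\<close>
  have "k < bs (Suc j) \<Longrightarrow> k = 0 \<or> (\<exists>i\<in>{1..j}. \<exists>a<l i. k = bs i + a)" for j
  proof (induction j)
    case 0
    then show ?case by (simp add: block_start_def)
  next
    case (Suc j)
    show ?case
    proof (cases "k < bs (Suc j)")
      case True
      then show ?thesis using Suc.IH by fastforce
    next
      case False
      then have "k = bs (Suc j) + (k - bs (Suc j))" "k - bs (Suc j) < l (Suc j)"
        using Suc.prems block_start_Suc[of "Suc j" F] by auto
      then show ?thesis by (intro disjI2 bexI[of _ "Suc j"]) auto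
    qed
  qed
  from this[of m] assms bs_end that show ?thesis by auto
qed

lemma P_0 [simp]: "P \<psi> q 0 = fst q"
  by (cases q) (simp add: product_coords_def)

lemma P_block [simp]:
  assumes "i \<in> {1..m}" "a < l i"
  shows "P \<psi> q (bs i + a) = \<psi> i (snd q i) a"
proof -
  obtain t x where q: "q = (t, x)" by (cases q)
  have "P \<psi> (t, x) (bs i + a) = (\<Sum>j\<in>{1..m}. if j = i then \<psi> i (x i) a else 0)"
    using block_start_pos[of F i] assms in_block_iff[of i _ a F]
    by (auto simp: product_coords_def intro!: sum.cong)
  then show ?thesis using assms q by simp
qed

lemma P_high: "k \<ge> N \<Longrightarrow> P \<psi> q k = 0"
proof -
  assume k: "k \<ge> N"
  have "\<not> k < bs i + l i" if "i \<in> {1..m}" for i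
    using block_end_le[of i "Suc m" F] that bs_end k by simp
  then show ?thesis using k by (cases q) (auto simp: product_coords_def intro!: sum.neutral)
qed

lemma P_topspace: "P \<psi> q \<in> topspace (Euclidean_space N)"
  by (simp add: topspace_Euclidean_space P_high)

lemma block_topspace: "block i y \<in> topspace (Euclidean_space (l i))"
  by (simp add: topspace_Euclidean_space block_def)

lemma block_P:
  assumes "i \<in> {1..m}" "(V, \<psi> i) \<in> atlas (F i)" "snd q i \<in> V"
  shows "block i (P \<psi> q) = \<psi> i (snd q i)"
proof (rule trans[OF _ charted.chart_restrict[OF fib[OF assms(1)] assms(2,3)]])
  show "block i (P \<psi> q) = (\<lambda>a. if a < l i then \<psi> i (snd q i) a else 0)"
    unfolding block_def by (intro ext if_cong refl) (erule P_block[OF assms(1)])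
qed

text \<open>The reason why the coordinate fields of one fibre annihilate functions on all the
  others.\<close>

lemma block_upd:
  assumes "i \<in> {1..m}" "j \<in> {1..m}" "a < l j"
  shows "block i (y(bs j + a := s)) = (if i = j then (block i y)(a := s) else block i y)"
proof
  fix b
  have "bs i + b = bs j + a \<longleftrightarrow> i = j \<and> a = b" if "b < l i"
    using in_block_iff[of i j b F] in_block_iff[of j i a F] assms that by auto
  then show "block i (y(bs j + a := s)) b = (if i = j then (block i y)(a := s) else block i y) b"
    using assms(3) by (auto simp: block_def)
qed

lemma block_upd_0: "block i (y(0 := s)) = block i y"
  using block_start_pos[of F i] by (auto simp: block_def fun_eq_iff)

lemma block_continuous: "i \<in> {1..m} \<Longrightarrow> continuous_map (Euclidean_space N) (Euclidean_space (l i)) (block i)"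
  by (rule continuous_map_Euclidean_componentwise[OF block_topspace])
    (simp add: block_def continuous_map_Euclidean_coord)

lemma block_region_open:
  assumes "\<And>i. i \<in> {1..m} \<Longrightarrow> openin (Euclidean_space (l i)) (B i)"
  shows "openin (Euclidean_space N) {y \<in> topspace (Euclidean_space N). y 0 \<in> I \<and> (\<forall>i\<in>{1..m}. block i y \<in> B i)}"
proof -
  have 0: "openin (Euclidean_space N) {y \<in> topspace (Euclidean_space N). y 0 \<in> I}"
    by (rule openin_continuous_map_preimage[OF continuous_map_Euclidean_coord]) (simp add: open_I)
  have i: "openin (Euclidean_space N) {y \<in> topspace (Euclidean_space N). block i y \<in> B i}" if "i \<in> {1..m}" for i
    by (rule openin_continuous_map_preimage[OF block_continuous[OF that] assms[OF that]])
  \<comment> \<open>The intersection with the whole space covers \<open>m = 0\<close>, where the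
    inner intersection has no members.\<close>
  have "openin (Euclidean_space N) ((\<Inter>i\<in>{1..m}. {y \<in> topspace (Euclidean_space N). block i y \<in> B i}) \<inter> topspace (Euclidean_space N))"
    by (rule openin_INT) (use i in auto)
  moreover have "{y \<in> topspace (Euclidean_space N). y 0 \<in> I \<and> (\<forall>i\<in>{1..m}. block i y \<in> B i)} =
     {y \<in> topspace (Euclidean_space N). y 0 \<in> I} \<inter>
     ((\<Inter>i\<in>{1..m}. {y \<in> topspace (Euclidean_space N). block i y \<in> B i}) \<inter> topspace (Euclidean_space N))"
    by auto
  ultimately show ?thesis using openin_Int[OF 0] by simp
qed

lemma region_open:
  assumes "\<And>i. i \<in> {1..m} \<Longrightarrow> openin (mtop (F i)) (U i)"
  shows "openin (mtop M) (I \<times> (\<Pi>\<^sub>E i\<in>{1..m}. U i))"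
  unfolding mtop_M openin_prod_Times_iff using assms open_I by (simp add: openin_PiE)

text \<open>Inverse of a product chart. \<open>restrict\<close> makes the fibre part extensional, as
  points of the product topology are.\<close>

definition P_inv :: "(nat \<Rightarrow> 'a set) \<Rightarrow> (nat \<Rightarrow> 'a \<Rightarrow> nat \<Rightarrow> real) \<Rightarrow> (nat \<Rightarrow> real) \<Rightarrow> real \<times> (nat \<Rightarrow> 'a)" where
  "P_inv V \<psi> y = (y 0, \<lambda>i\<in>{1..m}. inv_into (V i) (\<psi> i) (block i y))"

lemma P_inv_P:
  assumes V: "\<forall>i\<in>{1..m}. (V i, \<psi> i) \<in> atlas (F i)" and q: "q \<in> I \<times> (\<Pi>\<^sub>E i\<in>{1..m}. V i)"
  shows "P_inv V \<psi> (P \<psi> q) = q"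
proof -
  have "inv_into (V i) (\<psi> i) (block i (P \<psi> q)) = snd q i" if i: "i \<in> {1..m}" for i
  proof -
    have s: "snd q i \<in> V i" using q i by auto
    show ?thesis using block_P[of i "V i" \<psi> q] charted.chart_inv[OF fib[OF i] bspec[OF V i] s] V s i by simp
  qed
  moreover have "snd q \<in> extensional {1..m}" using q by (auto simp: PiE_def)
  ultimately have "(\<lambda>i\<in>{1..m}. inv_into (V i) (\<psi> i) (block i (P \<psi> q))) = snd q"
    by (intro extensionalityI[of _ "{1..m}"]) (simp_all add: extensional_def)
  then show ?thesis by (simp add: P_inv_def)
qed

lemma P_P_inv:
  assumes V: "\<forall>i\<in>{1..m}. (V i, \<psi> i) \<in> atlas (F i)"
    and y: "y \<in> topspace (Euclidean_space N)" "\<forall>i\<in>{1..m}. block i y \<in> \<psi> i ` V i"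
  shows "P \<psi> (P_inv V \<psi> y) = y"
proof
  fix k
  show "P \<psi> (P_inv V \<psi> y) k = y k"
  proof (cases "k < N")
    case True
    then show ?thesis
    proof (cases rule: block_cases)
      case 1
      then show ?thesis by (simp add: P_inv_def)
    next
      case (2 i a)
      have "\<psi> i (inv_into (V i) (\<psi> i) (block i y)) = block i y"
        using y(2) 2(1) by (intro f_inv_into_f) auto
      then show ?thesis using 2 by (simp add: P_inv_def block_def)
    qed
  next
    case False
    then show ?thesis using y(1) P_high by (simp add: topspace_Euclidean_space)
  qed
qed

text \<open>Smaller sets \<open>U i\<close> inside the chart domains are allowed because the same
  description is needed for the overlap of two product charts.\<close>

lemma P_image:
  assumes V: "\<forall>i\<in>{1..m}. (V i, \<psi> i) \<in> atlas (F i)" and U: "\<forall>i\<in>{1..m}. U i \<subseteq> V i"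
  shows "P \<psi> ` (I \<times> (\<Pi>\<^sub>E i\<in>{1..m}. U i)) =
    {y \<in> topspace (Euclidean_space N). y 0 \<in> I \<and> (\<forall>i\<in>{1..m}. block i y \<in> \<psi> i ` U i)}" (is "_ = ?R")
proof
  show "P \<psi> ` (I \<times> (\<Pi>\<^sub>E i\<in>{1..m}. U i)) \<subseteq> ?R"
  proof
    fix y assume "y \<in> P \<psi> ` (I \<times> (\<Pi>\<^sub>E i\<in>{1..m}. U i))"
    then obtain q where q: "q \<in> I \<times> (\<Pi>\<^sub>E i\<in>{1..m}. U i)" "y = P \<psi> q" by blast
    have "block i y \<in> \<psi> i ` U i" if i: "i \<in> {1..m}" for i
    proof -
      have "snd q i \<in> U i" using q(1) i by auto
      moreover have "block i y = \<psi> i (snd q i)"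
        unfolding q(2) using block_P[of i "V i" \<psi> q] i bspec[OF V i] bspec[OF U i] \<open>snd q i \<in> U i\<close> by blast
      ultimately show ?thesis by simp
    qed
    then show "y \<in> ?R" using q P_topspace by auto
  qed
  show "?R \<subseteq> P \<psi> ` (I \<times> (\<Pi>\<^sub>E i\<in>{1..m}. U i))"
  proof
    fix y assume y: "y \<in> ?R"
    have b: "\<forall>i\<in>{1..m}. block i y \<in> \<psi> i ` V i" using y U by blast
    have "P_inv V \<psi> y \<in> I \<times> (\<Pi>\<^sub>E i\<in>{1..m}. U i)"
    proof -
      have "inv_into (V i) (\<psi> i) (block i y) \<in> U i" if i: "i \<in> {1..m}" for i
      proof -
        have "block i y \<in> \<psi> i ` U i" using y i by blast
        then obtain z where z: "z \<in> U i" "block i y = \<psi> i z" by blast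
        moreover have "z \<in> V i" using z(1) U i by blast
        ultimately show ?thesis using charted.chart_inv[OF fib[OF i] bspec[OF V i]] by simp
      qed
      then show ?thesis using y by (simp add: P_inv_def)
    qed
    moreover have "P \<psi> (P_inv V \<psi> y) = y" using P_P_inv[OF V _ b] y by blast
    ultimately show "y \<in> P \<psi> ` (I \<times> (\<Pi>\<^sub>E i\<in>{1..m}. U i))" by (metis imageI)
  qed
qed

lemma P_inv_into:
  assumes V: "\<forall>i\<in>{1..m}. (V i, \<psi> i) \<in> atlas (F i)" and y: "y \<in> P \<psi> ` (I \<times> (\<Pi>\<^sub>E i\<in>{1..m}. V i))"
  shows "inv_into (I \<times> (\<Pi>\<^sub>E i\<in>{1..m}. V i)) (P \<psi>) y = P_inv V \<psi> y"
proof -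
  have "inj_on (P \<psi>) (I \<times> (\<Pi>\<^sub>E i\<in>{1..m}. V i))"
    by (rule inj_on_inverseI[of _ "P_inv V \<psi>"]) (rule P_inv_P[OF V])
  then show ?thesis using y P_inv_P[OF V] by (auto simp: inv_into_f_f)
qed

lemma proj_continuous:
  assumes "i \<in> {1..m}"
  shows "continuous_map (mtop M) (mtop (F i)) (\<lambda>q. snd q i)"
  using continuous_map_compose[OF continuous_map_snd continuous_map_product_projection[OF assms]]
  unfolding mtop_M o_def .

lemma fst_continuous: "continuous_map (mtop M) euclideanreal fst"
  unfolding mtop_M by (rule continuous_map_into_fulltopology[OF continuous_map_fst])

text \<open>Continuity is checked by components: a projection followed by a fibre chart in one
  direction, \<open>block\<close> followed by the inverse of a fibre chart in the other.\<close>

lemma P_homeomorphic: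
  assumes V: "\<forall>i\<in>{1..m}. (V i, \<psi> i) \<in> atlas (F i)"
  defines "W \<equiv> I \<times> (\<Pi>\<^sub>E i\<in>{1..m}. V i)"
  shows "homeomorphic_map (subtopology (mtop M) W) (subtopology (Euclidean_space N) (P \<psi> ` W)) (P \<psi>)"
  unfolding homeomorphic_map_maps homeomorphic_maps_def
proof (intro exI[of _ "P_inv V \<psi>"] conjI ballI)
  show "continuous_map (subtopology (mtop M) W) (subtopology (Euclidean_space N) (P \<psi> ` W)) (P \<psi>)"
  proof (rule continuous_map_into_subtopology[OF continuous_map_Euclidean_componentwise[OF P_topspace]])
    fix k assume "k < N"
    then show "continuous_map (subtopology (mtop M) W) euclideanreal (\<lambda>q. P \<psi> q k)"
    proof (cases rule: block_cases)
      case 1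
      then show ?thesis using continuous_map_from_subtopology[OF fst_continuous] by simp
    next
      case (2 i a)
      have "continuous_map (subtopology (mtop M) W) (subtopology (mtop (F i)) (V i)) (\<lambda>q. snd q i)"
        by (rule continuous_map_into_subtopology[OF continuous_map_from_subtopology[OF proj_continuous[OF 2(1)]]])
          (use 2(1) in \<open>auto simp: W_def\<close>)
      from continuous_map_compose[OF continuous_map_compose[OF this charted.chart_continuous[OF fib[OF 2(1)] bspec[OF V 2(1)]]]
          continuous_map_Euclidean_coord[of _ a]]
      show ?thesis using 2 by (simp add: o_def)
    qed
  qed auto
  have c: "continuous_map (subtopology (Euclidean_space N) (P \<psi> ` W)) (mtop (F i)) (\<lambda>y. inv_into (V i) (\<psi> i) (block i y))"
    if i: "i \<in> {1..m}" for i
  proof -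
    have "continuous_map (subtopology (Euclidean_space N) (P \<psi> ` W)) (subtopology (Euclidean_space (l i)) (\<psi> i ` V i)) (block i)"
      by (rule continuous_map_into_subtopology[OF continuous_map_from_subtopology[OF block_continuous[OF i]]])
        (use P_image[OF V, of V] i in \<open>auto simp: W_def\<close>)
    from continuous_map_compose[OF this charted.chart_inv_continuous[OF fib[OF i] bspec[OF V i]]]
    show ?thesis by (simp add: o_def)
  qed
  show "continuous_map (subtopology (Euclidean_space N) (P \<psi> ` W)) (subtopology (mtop M) W) (P_inv V \<psi>)"
  proof (rule continuous_map_into_subtopology)
    have "continuous_map (subtopology (Euclidean_space N) (P \<psi> ` W)) (top_of_set I) (\<lambda>y. y 0)"
      by (rule continuous_map_into_subtopology[OF continuous_map_from_subtopology[OF continuous_map_Euclidean_coord]])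
        (auto simp: W_def)
    moreover have "continuous_map (subtopology (Euclidean_space N) (P \<psi> ` W)) (product_topology (\<lambda>i. mtop (F i)) {1..m})
        (\<lambda>y. \<lambda>i\<in>{1..m}. inv_into (V i) (\<psi> i) (block i y))"
      unfolding continuous_map_componentwise
    proof (intro conjI ballI)
      show "(\<lambda>y. \<lambda>i\<in>{1..m}. inv_into (V i) (\<psi> i) (block i y)) `
          topspace (subtopology (Euclidean_space N) (P \<psi> ` W)) \<subseteq> extensional {1..m}"
        by (intro image_subsetI) (rule restrict_extensional)
      show "continuous_map (subtopology (Euclidean_space N) (P \<psi> ` W)) (mtop (F i))
          (\<lambda>y. (\<lambda>i\<in>{1..m}. inv_into (V i) (\<psi> i) (block i y)) i)" if "i \<in> {1..m}" for i
        using c[OF that] that by (simp only: restrict_apply' if_True)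
    qed
    ultimately show "continuous_map (subtopology (Euclidean_space N) (P \<psi> ` W)) (mtop M) (P_inv V \<psi>)"
      unfolding mtop_M P_inv_def by (rule continuous_map_pairedI)
    show "P_inv V \<psi> \<in> topspace (subtopology (Euclidean_space N) (P \<psi> ` W)) \<rightarrow> W"
      using P_inv_P[OF V] by (auto simp: W_def)
  qed
  show "P_inv V \<psi> (P \<psi> q) = q" if "q \<in> topspace (subtopology (mtop M) W)" for q
    using that P_inv_P[OF V] by (simp add: W_def)
  show "P \<psi> (P_inv V \<psi> y) = y" if "y \<in> topspace (subtopology (Euclidean_space N) (P \<psi> ` W))" for y
    using that P_inv_P[OF V] by (auto simp: W_def)
qed

lemma atlas_M: "(W, \<Psi>) \<in> atlas M \<longleftrightarrow>
    (\<exists>V \<psi>. W = I \<times> (\<Pi>\<^sub>E i\<in>{1..m}. V i) \<and> \<Psi> = P \<psi> \<and> (\<forall>i\<in>{1..m}. (V i, \<psi> i) \<in> atlas (F i)))"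
  unfolding kasner_manifold_def mfd.select_convs mem_Collect_eq by (simp only: prod.inject conj_assoc)

lemma Ck_on_block_compose:
  assumes i: "i \<in> {1..m}" and B: "openin (Euclidean_space (l i)) B" and G: "Ck_on r (l i) B G"
    and T: "openin (Euclidean_space N) T" "\<And>y. y \<in> T \<Longrightarrow> block i y \<in> B"
  shows "Ck_on r N T (\<lambda>y. G (block i y))"
  using Ck_on_compose[OF T(1) B Ck_on_coord[OF T(1)] G, of "\<lambda>a. bs i + a"] T(2) by (simp add: block_def)

text \<open>A transition map of the product is the identity in coordinate 0 and acts on each block
  by the transition map of that fibre, so its smoothness is inherited.\<close>

lemma charted_M: "charted M"
proof
  show "\<Union> (fst ` atlas M) = topspace (mtop M)"
  proof
    show "\<Union> (fst ` atlas M) \<subseteq> topspace (mtop M)"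
    proof
      fix q assume "q \<in> \<Union> (fst ` atlas M)"
      then obtain W \<Psi> where q: "(W, \<Psi>) \<in> atlas M" "q \<in> W" by (auto simp del: One_nat_def)
      then obtain V \<psi> where "W = I \<times> (\<Pi>\<^sub>E i\<in>{1..m}. V i)" and V: "\<forall>i\<in>{1..m}. (V i, \<psi> i) \<in> atlas (F i)"
        unfolding atlas_M by blast
      moreover have "(\<Pi>\<^sub>E i\<in>{1..m}. V i) \<subseteq> (\<Pi>\<^sub>E i\<in>{1..m}. topspace (mtop (F i)))"
        by (rule PiE_mono) (rule charted.chart_subset[OF fib bspec[OF V]])
      ultimately show "q \<in> topspace (mtop M)" using q(2) unfolding topspace_M by blast
    qed
    show "topspace (mtop M) \<subseteq> \<Union> (fst ` atlas M)"
    proof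
      fix q assume q: "q \<in> topspace (mtop M)"
      have "\<exists>z. z \<in> atlas (F i) \<and> snd q i \<in> fst z" if i: "i \<in> {1..m}" for i
      proof -
        have "snd q i \<in> \<Union> (fst ` atlas (F i))"
          using q i unfolding topspace_M charted.atlas_cover[OF fib[OF i]] by auto
        then show ?thesis by blast
      qed
      then obtain z where z: "\<And>i. i \<in> {1..m} \<Longrightarrow> z i \<in> atlas (F i) \<and> snd q i \<in> fst (z i)" by metis
      have "(I \<times> (\<Pi>\<^sub>E i\<in>{1..m}. fst (z i)), P (\<lambda>i. snd (z i))) \<in> atlas M"
        unfolding atlas_M using z by (intro exI[of _ "\<lambda>i. fst (z i)"] exI[of _ "\<lambda>i. snd (z i)"]) auto
      moreover have "q \<in> I \<times> (\<Pi>\<^sub>E i\<in>{1..m}. fst (z i))"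
        using q z unfolding topspace_M mem_Times_iff PiE_iff by blast
      moreover from calculation(1) have "I \<times> (\<Pi>\<^sub>E i\<in>{1..m}. fst (z i)) \<in> fst ` atlas M"
        using imageI[of _ "atlas M" fst] by (metis fst_conv)
      ultimately show "q \<in> \<Union> (fst ` atlas M)" by blast
    qed
  qed
next
  fix W \<Psi> assume "(W, \<Psi>) \<in> atlas M"
  then obtain V \<psi> where W: "W = I \<times> (\<Pi>\<^sub>E i\<in>{1..m}. V i)" "\<Psi> = P \<psi>" and V: "\<forall>i\<in>{1..m}. (V i, \<psi> i) \<in> atlas (F i)"
    unfolding atlas_M by blast
  show "openin (mtop M) W"
    unfolding W by (rule region_open) (use charted.chart_open[OF fib] V in blast)
  show "openin (Euclidean_space (mdim M)) (\<Psi> ` W)"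
    unfolding W mdim_M P_image[OF V ballI[OF order_refl]]
    by (rule block_region_open) (use charted.chart_image[OF fib] V in blast)
  show "homeomorphic_map (subtopology (mtop M) W) (subtopology (Euclidean_space (mdim M)) (\<Psi> ` W)) \<Psi>"
    unfolding W mdim_M by (rule P_homeomorphic[OF V])
  fix W' \<Psi>' k assume "(W', \<Psi>') \<in> atlas M" and k: "k < mdim M"
  then obtain V' \<psi>' where W': "W' = I \<times> (\<Pi>\<^sub>E i\<in>{1..m}. V' i)" "\<Psi>' = P \<psi>'" and V': "\<forall>i\<in>{1..m}. (V' i, \<psi>' i) \<in> atlas (F i)"
    unfolding atlas_M by blast
  have WW: "W \<inter> W' = I \<times> (\<Pi>\<^sub>E i\<in>{1..m}. V i \<inter> V' i)" unfolding W W' by auto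
  have im: "\<Psi> ` (W \<inter> W') =
    {y \<in> topspace (Euclidean_space N). y 0 \<in> I \<and> (\<forall>i\<in>{1..m}. block i y \<in> \<psi> i ` (V i \<inter> V' i))}"
    unfolding WW W(2) by (rule P_image[OF V]) auto
  have B: "openin (Euclidean_space (l i)) (\<psi> i ` (V i \<inter> V' i))" if i: "i \<in> {1..m}" for i
    using charted.chart_image_open[OF fib[OF i] bspec[OF V i] charted.chart_open[OF fib[OF i] bspec[OF V' i]]]
    by (simp add: Int_commute)
  have T: "openin (Euclidean_space N) (\<Psi> ` (W \<inter> W'))" unfolding im by (rule block_region_open[OF B])
  have inv: "inv_into W \<Psi> y = P_inv V \<psi> y" if "y \<in> \<Psi> ` (W \<inter> W')" for y
    using that P_inv_into[OF V] unfolding W by blast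
  from k have "k < N" unfolding mdim_M .
  then show "Cinf_on (mdim M) (\<Psi> ` (W \<inter> W')) (\<lambda>x. \<Psi>' (inv_into W \<Psi> x) k)"
  proof (cases rule: block_cases)
    case 1
    have "Ck_on r N (\<Psi> ` (W \<inter> W')) (\<lambda>x. \<Psi>' (inv_into W \<Psi> x) k)" for r
      using Ck_on_cong[OF T, of "\<lambda>x. \<Psi>' (inv_into W \<Psi> x) k" "\<lambda>y. y 0" r] Ck_on_coord[OF T, of r 0] inv 1
      by (simp add: W' P_inv_def)
    then show ?thesis unfolding Cinf_on_def mdim_M by blast
  next
    case (2 i a)
    have "Ck_on r N (\<Psi> ` (W \<inter> W')) (\<lambda>x. \<Psi>' (inv_into W \<Psi> x) k)" for r
    proof -
      have "Ck_on r (l i) (\<psi> i ` (V i \<inter> V' i)) (\<lambda>z. \<psi>' i (inv_into (V i) (\<psi> i) z) a)"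
        using charted.transition[OF fib[OF 2(1)] bspec[OF V 2(1)] bspec[OF V' 2(1)] 2(2)] unfolding Cinf_on_def by blast
      from Ck_on_block_compose[OF 2(1) B[OF 2(1)] this T]
      have "Ck_on r N (\<Psi> ` (W \<inter> W')) (\<lambda>y. \<psi>' i (inv_into (V i) (\<psi> i) (block i y)) a)"
        unfolding im using 2(1) by blast
      moreover have "\<Psi>' (inv_into W \<Psi> y) k = \<psi>' i (inv_into (V i) (\<psi> i) (block i y)) a"
        if "y \<in> \<Psi> ` (W \<inter> W')" for y
        using inv[OF that] 2 by (simp add: W' P_inv_def)
      ultimately show ?thesis
        using Ck_on_cong[OF T, of "\<lambda>x. \<Psi>' (inv_into W \<Psi> x) k"
            "\<lambda>y. \<psi>' i (inv_into (V i) (\<psi> i) (block i y)) a" r] by blast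
    qed
    then show ?thesis unfolding Cinf_on_def mdim_M by blast
  qed
qed

end

section \<open>Smooth functions and tangent vectors on the product\<close>

context product_base
begin

sublocale M: charted "kasner_manifold I m F" by (rule charted_M)

lemma chart_family:
  assumes "q \<in> topspace (mtop M)"
  obtains V \<psi> where "\<forall>i\<in>{1..m}. (V i, \<psi> i) \<in> atlas (F i)" "q \<in> I \<times> (\<Pi>\<^sub>E i\<in>{1..m}. V i)"
  using M.chart_at[OF assms] unfolding atlas_M by metis

lemma proj_topspace: "q \<in> topspace (mtop M) \<Longrightarrow> i \<in> {1..m} \<Longrightarrow> snd q i \<in> topspace (mtop (F i))"
  unfolding topspace_M by auto

text \<open>In a product chart the pulled-back function depends on the i-th block only, through its
  expression in a fibre chart.\<close>

lemma smooth_on_proj: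
  assumes i: "i \<in> {1..m}" and h: "smooth_on (F i) U h"
  shows "smooth_on M {q \<in> topspace (mtop M). snd q i \<in> U} (\<lambda>q. h (snd q i))"
proof (rule M.smooth_on_local)
  fix q assume q: "q \<in> {q \<in> topspace (mtop M). snd q i \<in> U}"
  then obtain V \<psi> where V: "\<forall>i\<in>{1..m}. (V i, \<psi> i) \<in> atlas (F i)" and qV: "q \<in> I \<times> (\<Pi>\<^sub>E i\<in>{1..m}. V i)"
    using chart_family by blast
  interpret Fi: charted "F i" by (rule fib[OF i])
  let ?W = "I \<times> (\<Pi>\<^sub>E i\<in>{1..m}. V i)"
  have W: "(?W, P \<psi>) \<in> atlas M" unfolding atlas_M using V by blast
  note Vi = bspec[OF V i]
  define Q where "Q = {q \<in> ?W. snd q i \<in> U}"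
  have Q: "openin (mtop M) Q" unfolding Q_def
    by (rule openin_continuous_map_preimage_gen[OF proj_continuous[OF i] M.chart_open[OF W] Fi.smooth_on_openin[OF h]])
  \<comment> \<open>Only coordinate 0 and the i-th block are restricted; the other blocks range over
    their whole spaces.\<close>
  define B where "B = {y \<in> topspace (Euclidean_space N). y 0 \<in> I \<and>
      (\<forall>j\<in>{1..m}. block j y \<in> (if j = i then \<psi> i ` (U \<inter> V i) else topspace (Euclidean_space (l j))))}"
  have B: "openin (Euclidean_space N) B" unfolding B_def
    by (rule block_region_open) (use Fi.chart_image_open[OF Vi Fi.smooth_on_openin[OF h]] in simp)
  have "P \<psi> q' \<in> B" if "q' \<in> Q" for q'
  proof -
    have s: "snd q' i \<in> U \<inter> V i" "fst q' \<in> I" using that i by (auto simp: Q_def)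
    then have "block i (P \<psi> q') \<in> \<psi> i ` (U \<inter> V i)" using block_P[of i "V i" \<psi> q', OF i Vi] by simp
    then show ?thesis using s(2) P_topspace block_topspace unfolding B_def by simp
  qed
  then have PB: "P \<psi> ` Q \<subseteq> B" by blast
  have "Ck_on r N B (\<lambda>y. (h \<circ> inv_into (V i) (\<psi> i)) (block i y))" for r
  proof (rule Ck_on_block_compose[OF i Fi.chart_image_open[OF Vi Fi.smooth_on_openin[OF h]] _ B])
    show "Ck_on r (l i) (\<psi> i ` (U \<inter> V i)) (h \<circ> inv_into (V i) (\<psi> i))"
      using Fi.smooth_on_Cinf[OF h Vi] unfolding Cinf_on_def by blast
    show "block i y \<in> \<psi> i ` (U \<inter> V i)" if "y \<in> B" for y
    proof -
      have "\<forall>j\<in>{1..m}. block j y \<in> (if j = i then \<psi> i ` (U \<inter> V i) else topspace (Euclidean_space (l j)))"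
        using that unfolding B_def by blast
      from bspec[OF this i] show ?thesis by (simp only: if_True simp_thms)
    qed
  qed
  then have G: "Cinf_on (mdim M) B (\<lambda>y. (h \<circ> inv_into (V i) (\<psi> i)) (block i y))"
    unfolding Cinf_on_def mdim_M by blast
  have "Q \<subseteq> ?W" unfolding Q_def by blast
  then have "smooth_on M Q (\<lambda>q. (h \<circ> inv_into (V i) (\<psi> i)) (block i (P \<psi> q)))"
    by (rule M.smooth_on_chart_compose[OF W Q _ B[folded mdim_M] PB G])
  then have "smooth_on M Q (\<lambda>q. h (snd q i))"
  proof (rule M.smooth_on_cong)
    fix q' assume q': "q' \<in> Q"
    then have "snd q' i \<in> V i" using i by (auto simp: Q_def)
    then show "(h \<circ> inv_into (V i) (\<psi> i)) (block i (P \<psi> q')) = h (snd q' i)"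
      using block_P[of i "V i" \<psi> q'] Vi i by simp
  qed
  moreover have "Q \<subseteq> {q \<in> topspace (mtop M). snd q i \<in> U}" "q \<in> Q"
    using q qV M.chart_subset[OF W] by (auto simp: Q_def)
  ultimately show "\<exists>W. q \<in> W \<and> W \<subseteq> {q \<in> topspace (mtop M). snd q i \<in> U} \<and> smooth_on M W (\<lambda>q. h (snd q i))"
    by (intro exI[of _ Q] conjI)
qed

lemma smooth_at_proj:
  assumes "i \<in> {1..m}" "q \<in> topspace (mtop M)" "smooth_at (F i) (snd q i) h"
  shows "smooth_at M q (\<lambda>q. h (snd q i))"
proof -
  obtain U where "snd q i \<in> U" "smooth_on (F i) U h" using assms(3) by (auto simp: smooth_at_def)
  then show ?thesis using M.smooth_at_on[OF smooth_on_proj[OF assms(1)]] assms(2) by blast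
qed

lemma smooth_on_fst: "smooth_on M (topspace (mtop M)) fst"
proof (rule M.smooth_on_local)
  fix q assume "q \<in> topspace (mtop M)"
  then obtain V \<psi> where V: "\<forall>i\<in>{1..m}. (V i, \<psi> i) \<in> atlas (F i)" "q \<in> I \<times> (\<Pi>\<^sub>E i\<in>{1..m}. V i)"
    using chart_family by blast
  then have W: "(I \<times> (\<Pi>\<^sub>E i\<in>{1..m}. V i), P \<psi>) \<in> atlas M" unfolding atlas_M by blast
  have "smooth_on M (I \<times> (\<Pi>\<^sub>E i\<in>{1..m}. V i)) (\<lambda>q. P \<psi> q 0)"
    by (rule M.smooth_on_chart_coord[OF W]) (simp add: mdim_M)
  then have "smooth_on M (I \<times> (\<Pi>\<^sub>E i\<in>{1..m}. V i)) fst" by simp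
  then show "\<exists>W. q \<in> W \<and> W \<subseteq> topspace (mtop M) \<and> smooth_on M W fst"
    using V(2) M.chart_subset[OF W] by (intro exI[of _ "I \<times> (\<Pi>\<^sub>E i\<in>{1..m}. V i)"] conjI)
qed

lemma smooth_on_fst_fun:
  assumes "smooth_real_on I h"
  shows "smooth_on M (topspace (mtop M)) (\<lambda>q. h (fst q))"
  by (rule M.smooth_on_real_compose[OF smooth_on_fst open_I assms]) (auto simp: topspace_M)

abbreviation "tmap i q \<equiv> tangent_map (F i) (\<lambda>q. snd q i) q"

lemma tmap_apply:
  "i \<in> {1..m} \<Longrightarrow> smooth_at (F i) (snd q i) f \<Longrightarrow> tmap i q u f = u (\<lambda>q. f (snd q i))"
  by (simp add: tangent_map_def o_def)

lemma tmap_tangent: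
  assumes i: "i \<in> {1..m}" and q: "q \<in> topspace (mtop M)" and u: "u \<in> tangent_space M q"
  shows "tmap i q u \<in> tangent_space (F i) (snd q i)"
  unfolding tangent_space_def
proof (intro CollectI conjI allI impI)
  interpret Fi: charted "F i" by (rule fib[OF i])
  note s = smooth_at_proj[OF i q]
  fix f h a b assume fh: "smooth_at (F i) (snd q i) f \<and> smooth_at (F i) (snd q i) h"
  have c: "smooth_at (F i) (snd q i) (\<lambda>_. c)" for c by (rule Fi.smooth_at_const[OF proj_topspace[OF q i]])
  have "smooth_at (F i) (snd q i) (\<lambda>q. a * f q + b * h q)" "smooth_at (F i) (snd q i) (\<lambda>q. f q * h q)"
    using fh c by (auto intro!: Fi.smooth_at_add Fi.smooth_at_mult)
  then show "tmap i q u (\<lambda>q. a * f q + b * h q) = a * tmap i q u f + b * tmap i q u h"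
    "tmap i q u (\<lambda>q. f q * h q) = f (snd q i) * tmap i q u h + h (snd q i) * tmap i q u f"
    using fh M.tv_lin[OF u s s, of f h a b] M.tv_mult[OF u s s, of f h] i by (simp_all add: tmap_apply)
qed (simp add: tangent_map_def)

lemma tmap_lin: "tmap i q (\<lambda>f. a * u f + b * v f) = (\<lambda>f. a * tmap i q u f + b * tmap i q v f)"
  by (auto simp: tangent_map_def)

end

section \<open>Coordinate fields, lifts and \<partial>/\<partial>t in a product chart\<close>

locale product_chart = product_base I m F for I m and F :: "nat \<Rightarrow> 'a mfd" +
  fixes V :: "nat \<Rightarrow> 'a set" and \<psi> :: "nat \<Rightarrow> 'a \<Rightarrow> nat \<Rightarrow> real"
  assumes V: "\<forall>i\<in>{1..m}. (V i, \<psi> i) \<in> atlas (F i)"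
begin

abbreviation "W \<equiv> I \<times> (\<Pi>\<^sub>E i\<in>{1..m}. V i)"
abbreviation "C k \<equiv> charted.coord_field M W (P \<psi>) k"

lemma W_chart: "(W, P \<psi>) \<in> atlas M"
  unfolding atlas_M using V by blast

lemma W_topspace: "q \<in> W \<Longrightarrow> q \<in> topspace (mtop M)"
  using M.chart_subset[OF W_chart] by blast

lemma W_proj: "q \<in> W \<Longrightarrow> i \<in> {1..m} \<Longrightarrow> snd q i \<in> V i"
  by auto

lemma partial_proj:
  assumes q: "q \<in> W" and k: "k < N" and i: "i \<in> {1..m}"
  shows "partial k ((\<lambda>q. h (snd q i)) \<circ> inv_into W (P \<psi>)) (P \<psi> q) =
    deriv (\<lambda>s. (h \<circ> inv_into (V i) (\<psi> i)) (block i ((P \<psi> q)(k := s)))) (P \<psi> q k)"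
proof -
  have "partial k ((\<lambda>q. h (snd q i)) \<circ> inv_into W (P \<psi>)) (P \<psi> q) =
      partial k (\<lambda>y. (h \<circ> inv_into (V i) (\<psi> i)) (block i y)) (P \<psi> q)"
  proof (rule partial_cong(1)[OF M.chart_image[OF W_chart]])
    show "((\<lambda>q. h (snd q i)) \<circ> inv_into W (P \<psi>)) y = (h \<circ> inv_into (V i) (\<psi> i)) (block i y)"
      if "y \<in> P \<psi> ` W" for y
      using P_inv_into[OF V that] i by (simp add: P_inv_def)
  qed (use q k in \<open>auto simp: mdim_M\<close>)
  then show ?thesis by (simp add: partial_def)
qed

lemma C_proj:
  assumes q: "q \<in> W" and j: "j \<in> {1..m}" "a < l j" and i: "i \<in> {1..m}" and h: "smooth_at (F i) (snd q i) h"
  shows "C (bs j + a) q (\<lambda>q. h (snd q i)) =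
    (if i = j then partial a (h \<circ> inv_into (V i) (\<psi> i)) (\<psi> i (snd q i)) else 0)"
proof -
  have "C (bs j + a) q (\<lambda>q. h (snd q i)) =
      deriv (\<lambda>s. (h \<circ> inv_into (V i) (\<psi> i)) (block i ((P \<psi> q)(bs j + a := s)))) (P \<psi> q (bs j + a))"
    using partial_proj[OF q block_bound[OF j] i] smooth_at_proj[OF i W_topspace[OF q] h]
    by (simp add: M.coord_field_def)
  also have "\<dots> = (if i = j then partial a (h \<circ> inv_into (V i) (\<psi> i)) (\<psi> i (snd q i)) else 0)"
    unfolding block_upd[OF i j] P_block[OF j]
  proof (cases "i = j")
    case True
    then have "block j (P \<psi> q) = \<psi> j (snd q j)"
      using block_P[of i "V i" \<psi> q, OF i bspec[OF V i] W_proj[OF q i]] by simp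
    then show "deriv (\<lambda>s. (h \<circ> inv_into (V i) (\<psi> i)) (if i = j then (block i (P \<psi> q))(a := s) else block i (P \<psi> q)))
        (\<psi> j (snd q j) a) = (if i = j then partial a (h \<circ> inv_into (V i) (\<psi> i)) (\<psi> i (snd q i)) else 0)"
      using True by (simp add: partial_def)
  qed simp
  finally show ?thesis .
qed

lemma C_0_proj:
  assumes q: "q \<in> W" and i: "i \<in> {1..m}"
  shows "C 0 q (\<lambda>q. h (snd q i)) = 0"
  using partial_proj[OF q _ i, of 0 h] by (simp add: M.coord_field_def block_upd_0)

lemma C_fst_fun:
  assumes q: "q \<in> W" and k: "k < N" and h: "smooth_at M q (\<lambda>q. h (fst q))"
  shows "C k q (\<lambda>q. h (fst q)) = (if k = 0 then deriv h (fst q) else 0)"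
proof -
  have "partial k ((\<lambda>q. h (fst q)) \<circ> inv_into W (P \<psi>)) (P \<psi> q) = partial k (\<lambda>y. h (y 0)) (P \<psi> q)"
  proof (rule partial_cong(1)[OF M.chart_image[OF W_chart]])
    show "((\<lambda>q. h (fst q)) \<circ> inv_into W (P \<psi>)) y = h (y 0)" if "y \<in> P \<psi> ` W" for y
      using P_inv_into[OF V that] by (simp add: P_inv_def)
  qed (use q k in \<open>auto simp: mdim_M\<close>)
  then show ?thesis using h by (simp add: M.coord_field_def partial_def)
qed

lemma P_upd_0: "(P \<psi> q)(0 := s) = P \<psi> (s, snd q)"
proof
  fix k
  show "((P \<psi> q)(0 := s)) k = P \<psi> (s, snd q) k"
  proof (cases "k < N")
    case True
    then show ?thesis
    proof (cases rule: block_cases)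
      case (2 i a)
      then show ?thesis using block_start_pos[of F i] by simp
    qed simp
  next
    case False
    then show ?thesis using P_high[of k \<psi>] by simp
  qed
qed

text \<open>\<open>d_dt\<close> is defined without charts; its tangency and smoothness are deduced
  from this identification. As \<open>I\<close> is open, the points with slightly changed time stay
  in the chart, which is all that \<open>deriv\<close> sees.\<close>

lemma d_dt_C:
  assumes q: "q \<in> W"
  shows "d_dt M q = C 0 q"
proof
  fix f :: "real \<times> (nat \<Rightarrow> 'a) \<Rightarrow> real"
  have "\<forall>\<^sub>F s in nhds (fst q). s \<in> I" using q open_I by (intro eventually_nhds_in_open) auto
  then have "\<forall>\<^sub>F s in nhds (fst q). f (s, snd q) = (f \<circ> inv_into W (P \<psi>)) ((P \<psi> q)(0 := s))"
  proof eventually_elim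
    case (elim s)
    then have "(s, snd q) \<in> W" using q by auto
    then show ?case unfolding P_upd_0 using M.chart_inv[OF W_chart] by simp
  qed
  then have "deriv (\<lambda>s. f (s, snd q)) (fst q) = partial 0 (f \<circ> inv_into W (P \<psi>)) (P \<psi> q)"
    unfolding partial_def by (rule deriv_cong_ev) simp
  then show "d_dt M q f = C 0 q f" by (simp add: d_dt_def M.coord_field_def)
qed

lemma tv_eq_M:
  assumes q: "q \<in> W" and v: "v \<in> tangent_space M q" and w: "w \<in> tangent_space M q" and t: "v fst = w fst"
    and x: "\<And>i a. i \<in> {1..m} \<Longrightarrow> a < l i \<Longrightarrow> v (\<lambda>q. \<psi> i (snd q i) a) = w (\<lambda>q. \<psi> i (snd q i) a)"
  shows "v = w"
proof (rule M.tv_eqI[OF W_chart q v w])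
  fix k assume "k < mdim M"
  then have "k < N" unfolding mdim_M .
  then show "v (\<lambda>q. P \<psi> q k) = w (\<lambda>q. P \<psi> q k)"
  proof (cases rule: block_cases)
    case 1
    then show ?thesis using t by simp
  next
    case (2 i a)
    then show ?thesis using x[OF 2(1,2)] by (simp only: P_block)
  qed
qed

text \<open>Built from the components of \<open>X\<close> in the chart; the intrinsic meaning is in
  \<open>lift_proj\<close> and \<open>lift_fst_fun\<close>: the lift is related to \<open>X\<close>
  under the i-th projection and annihilates functions of t and of the other fibres.\<close>

definition lift :: "nat \<Rightarrow> 'a vfield \<Rightarrow> (real \<times> (nat \<Rightarrow> 'a)) vfield" where
  "lift i X q f = (\<Sum>a\<in>{..<l i}. X (snd q i) (\<lambda>y. \<psi> i y a) * C (bs i + a) q f)"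

lemma lift_tangent:
  assumes "q \<in> W" "i \<in> {1..m}"
  shows "lift i X q \<in> tangent_space M q"
  unfolding lift_def[abs_def]
  by (rule M.tv_setsum, rule M.coord_field_tangent[OF W_chart assms(1)])
    (use block_bound[OF assms(2)] in \<open>simp add: mdim_M\<close>)

lemma lift_proj:
  assumes q: "q \<in> W" and i: "i \<in> {1..m}" and j: "j \<in> {1..m}" and h: "smooth_at (F j) (snd q j) h"
    and X: "X (snd q i) \<in> tangent_space (F i) (snd q i)"
  shows "lift i X q (\<lambda>q. h (snd q j)) = (if i = j then X (snd q i) h else 0)"
proof -
  have "lift i X q (\<lambda>q. h (snd q j)) = (\<Sum>a\<in>{..<l i}. X (snd q i) (\<lambda>y. \<psi> i y a) *
      (if j = i then partial a (h \<circ> inv_into (V j) (\<psi> j)) (\<psi> j (snd q j)) else 0))"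
    unfolding lift_def by (intro sum.cong refl) (use C_proj[OF q i _ j h] in simp)
  also have "\<dots> = (if i = j then X (snd q i) h else 0)"
    using charted.tv_expand[OF fib[OF i] bspec[OF V i] W_proj[OF q i] X] h by auto
  finally show ?thesis .
qed

lemma lift_fst_fun:
  assumes q: "q \<in> W" and i: "i \<in> {1..m}" and h: "smooth_at M q (\<lambda>q. h (fst q))"
  shows "lift i X q (\<lambda>q. h (fst q)) = 0"
  unfolding lift_def
  by (intro sum.neutral ballI)
    (use C_fst_fun[OF q block_bound[OF i] h] block_start_pos[of F i] in simp)

lemma d_dt_tangent: "q \<in> W \<Longrightarrow> d_dt M q \<in> tangent_space M q"
  using d_dt_C M.coord_field_tangent[OF W_chart] mdim_M by simp

lemma d_dt_proj: "q \<in> W \<Longrightarrow> i \<in> {1..m} \<Longrightarrow> d_dt M q (\<lambda>q. h (snd q i)) = 0"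
  using d_dt_C C_0_proj by simp

lemma d_dt_fst_fun: "q \<in> W \<Longrightarrow> smooth_at M q (\<lambda>q. h (fst q)) \<Longrightarrow> d_dt M q (\<lambda>q. h (fst q)) = deriv h (fst q)"
  using d_dt_C C_fst_fun[of q 0 h] by simp

lemma fst_smooth_at: "q \<in> W \<Longrightarrow> smooth_at M q fst"
  by (rule M.smooth_at_on[OF smooth_on_fst W_topspace])

lemma fst_values:
  assumes q: "q \<in> W"
  shows "d_dt M q fst = 1" "i \<in> {1..m} \<Longrightarrow> lift i X q fst = 0"
  using d_dt_fst_fun[OF q, of "\<lambda>t. t"] lift_fst_fun[OF q, of i "\<lambda>t. t"] fst_smooth_at[OF q] by simp_all

lemma tmap_lift:
  assumes q: "q \<in> W" and i: "i \<in> {1..m}" and j: "j \<in> {1..m}" and X: "X (snd q i) \<in> tangent_space (F i) (snd q i)"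
  shows "tmap j q (lift i X q) = (if i = j then X (snd q i) else (\<lambda>f. 0))"
proof
  fix f
  show "tmap j q (lift i X q) f = (if i = j then X (snd q i) else (\<lambda>f. 0)) f"
    using lift_proj[where X = X, OF q i j _ X] charted.tv_not_smooth[OF fib[OF i] X, of f]
    by (cases "smooth_at (F j) (snd q j) f") (auto simp: tangent_map_def o_def)
qed

lemma tmap_d_dt: "q \<in> W \<Longrightarrow> i \<in> {1..m} \<Longrightarrow> tmap i q (d_dt M q) = (\<lambda>f. 0)"
  using d_dt_proj by (auto simp: tangent_map_def o_def)

lemma tmap_expand:
  assumes q: "q \<in> W" and i: "i \<in> {1..m}" and u: "u \<in> tangent_space M q"
  shows "tmap i q u = (\<lambda>f. \<Sum>a\<in>{..<l i}. u (\<lambda>q. \<psi> i (snd q i) a) *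
    charted.coord_field (F i) (V i) (\<psi> i) a (snd q i) f)"
proof -
  interpret Fi: charted "F i" by (rule fib[OF i])
  note Vi = bspec[OF V i]
  have "tmap i q u (\<lambda>y. \<psi> i y a) = u (\<lambda>q. \<psi> i (snd q i) a)" if "a < l i" for a
    by (rule tmap_apply[OF i]) (rule Fi.smooth_at_on[OF Fi.smooth_on_chart_coord[OF Vi that] W_proj[OF q i]])
  then show ?thesis
    using Fi.tv_expand_coord[OF Vi W_proj[OF q i] tmap_tangent[OF i W_topspace[OF q] u]] by simp
qed

lemma d_dt_smooth_W: "smooth_vfield_on M W (d_dt M)"
  by (rule M.vf_cong[OF M.coord_field_smooth[OF W_chart]]) (simp_all add: d_dt_C mdim_M)

end

lemma (in product_base) d_dt_smooth: "smooth_vfield_on M (topspace (mtop M)) (d_dt M)"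
proof -
  have ex: "\<exists>W. q \<in> W \<and> W \<subseteq> topspace (mtop M) \<and> smooth_vfield_on M W (d_dt M)" if q: "q \<in> topspace (mtop M)" for q
  proof -
    obtain V \<psi> where c: "\<forall>i\<in>{1..m}. (V i, \<psi> i) \<in> atlas (F i)" "q \<in> I \<times> (\<Pi>\<^sub>E i\<in>{1..m}. V i)"
      using q by (rule chart_family)
    interpret product_chart I m F V \<psi> by unfold_locales (rule c(1))
    have "W \<subseteq> topspace (mtop M)" by (rule M.chart_subset[OF W_chart])
    then show ?thesis using d_dt_smooth_W c(2) by (intro exI[of _ W] conjI)
  qed
  show ?thesis
  proof (rule M.vfI[OF openin_topspace])
    fix q assume "q \<in> topspace (mtop M)"
    from ex[OF this] obtain W where "q \<in> W" "smooth_vfield_on M W (d_dt M)" by (elim exE conjE)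
    then show "d_dt M q \<in> tangent_space M q" using M.vf_tangent by simp
  next
    fix U f assume U: "U \<subseteq> topspace (mtop M)" "smooth_on M U f"
    show "smooth_on M U (\<lambda>q. d_dt M q f)"
    proof (rule M.smooth_on_local)
      fix q assume q: "q \<in> U"
      from ex[OF subsetD[OF U(1) q]] obtain W where W: "q \<in> W" "smooth_vfield_on M W (d_dt M)" by (elim exE conjE)
      have "smooth_on M (U \<inter> W) f"
        using M.smooth_on_subset[OF U(2)] M.smooth_on_openin[OF U(2)] M.vf_openin[OF W(2)] by auto
      from M.vf_apply[OF W(2) this] show "\<exists>W. q \<in> W \<and> W \<subseteq> U \<and> smooth_on M W (\<lambda>q. d_dt M q f)"
        using q W(1) by (intro exI[of _ "U \<inter> W"]) auto
    qed
  qed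
qed

section \<open>The Kasner metric\<close>

locale kasner = product_base I m F for I m and F :: "nat \<Rightarrow> 'a mfd" +
  fixes gF :: "nat \<Rightarrow> 'a metric" and DF :: "nat \<Rightarrow> 'a conn" and \<phi> :: "real \<Rightarrow> real" and p :: "nat \<Rightarrow> real"
  assumes phi_smooth: "smooth_real_on I \<phi>" and phi_pos: "t \<in> I \<Longrightarrow> \<phi> t > 0"
    and fib_riem: "i \<in> {1..m} \<Longrightarrow> riemannian_mfd (F i) (gF i)"
    and fib_lc: "i \<in> {1..m} \<Longrightarrow> lc_mfd (F i) (gF i) (DF i)"
begin

abbreviation "g \<equiv> kasner_metric m F gF \<phi> p"

definition B :: "nat \<Rightarrow> real \<Rightarrow> real" where "B i t = \<phi> t powr (2 * p i)"

lemma fib_metric: "i \<in> {1..m} \<Longrightarrow> metric_mfd (F i) (gF i)"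
  using fib_riem riemannian_mfd.axioms(1) by blast

lemma g_eq: "g q u v = - (u fst * v fst) + (\<Sum>i\<in>{1..m}. B i (fst q) * gF i (snd q i) (tmap i q u) (tmap i q v))"
  by (simp add: kasner_metric_def B_def)

lemma B_smooth: "smooth_on M (topspace (mtop M)) (\<lambda>q. B i (fst q))"
  unfolding B_def by (rule M.smooth_on_powr[OF smooth_on_fst_fun[OF phi_smooth]]) (auto simp: topspace_M phi_pos)

lemma B_pos: "t \<in> I \<Longrightarrow> B i t > 0"
  using phi_pos[of t] by (simp add: B_def)

text \<open>Symmetry and bilinearity come from the fibres. Smoothness is local: in a product chart
  each pushforward is a combination of coordinate fields of the fibre with smooth coefficients, so
  the metric becomes a sum of products of these with pulled-back components of
  \<open>gF i\<close>.\<close>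

lemma metric_M: "metric_mfd M g"
proof
  fix q u v assume q: "q \<in> topspace (mtop M)" and u: "u \<in> tangent_space M q" and v: "v \<in> tangent_space M q"
  note s = proj_topspace[OF q] and t = tmap_tangent[OF _ q]
  have "gF i (snd q i) (tmap i q u) (tmap i q v) = gF i (snd q i) (tmap i q v) (tmap i q u)" if i: "i \<in> {1..m}" for i
    by (rule metric_mfd.g_sym[OF fib_metric[OF i] s[OF i] t[OF i u] t[OF i v]])
  then show "g q u v = g q v u"
    unfolding g_eq by (simp only: mult.commute cong: sum.cong)
  fix w a b assume w: "w \<in> tangent_space M q"
  have "gF i (snd q i) (tmap i q (\<lambda>f. a * u f + b * v f)) (tmap i q w) =
      a * gF i (snd q i) (tmap i q u) (tmap i q w) + b * gF i (snd q i) (tmap i q v) (tmap i q w)"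
    if i: "i \<in> {1..m}" for i
    unfolding tmap_lin by (rule metric_mfd.g_lin[OF fib_metric[OF i] s[OF i] t[OF i u] t[OF i v] t[OF i w]])
  then have "(\<Sum>i\<in>{1..m}. B i (fst q) * gF i (snd q i) (tmap i q (\<lambda>f. a * u f + b * v f)) (tmap i q w)) =
    (\<Sum>i\<in>{1..m}. a * (B i (fst q) * gF i (snd q i) (tmap i q u) (tmap i q w)) + b * (B i (fst q) * gF i (snd q i) (tmap i q v) (tmap i q w)))"
    by (intro sum.cong refl) (simp only: distrib_left mult.left_commute)
  also have "\<dots> = a * (\<Sum>i\<in>{1..m}. B i (fst q) * gF i (snd q i) (tmap i q u) (tmap i q w))
      + b * (\<Sum>i\<in>{1..m}. B i (fst q) * gF i (snd q i) (tmap i q v) (tmap i q w))"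
    by (simp only: sum.distrib sum_distrib_left)
  finally have S: "(\<Sum>i\<in>{1..m}. B i (fst q) * gF i (snd q i) (tmap i q (\<lambda>f. a * u f + b * v f)) (tmap i q w)) =
      a * (\<Sum>i\<in>{1..m}. B i (fst q) * gF i (snd q i) (tmap i q u) (tmap i q w))
      + b * (\<Sum>i\<in>{1..m}. B i (fst q) * gF i (snd q i) (tmap i q v) (tmap i q w))" .
  show "g q (\<lambda>f. a * u f + b * v f) w = a * g q u w + b * g q v w"
    unfolding g_eq S
  proof -
    show "- ((a * u fst + b * v fst) * w fst) + (a * r + b * s) = a * (- (u fst * w fst) + r) + b * (- (v fst * w fst) + s)"
      for r s by (simp add: algebra_simps)
  qed
next
  fix U X Y assume X: "smooth_vfield_on M U X" and Y: "smooth_vfield_on M U Y"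
  show "smooth_on M U (\<lambda>q. g q (X q) (Y q))"
  proof (rule M.smooth_on_local)
    fix q assume q: "q \<in> U"
    then have "q \<in> topspace (mtop M)" using openin_subset[OF M.vf_openin[OF X]] by blast
    then obtain V \<psi> where V: "\<forall>i\<in>{1..m}. (V i, \<psi> i) \<in> atlas (F i)" and qV: "q \<in> I \<times> (\<Pi>\<^sub>E i\<in>{1..m}. V i)"
      by (rule chart_family)
    interpret product_chart I m F V \<psi> by unfold_locales (rule V)
    let ?Q = "U \<inter> W"
    have Q: "openin (mtop M) ?Q" using M.vf_openin[OF X] M.chart_open[OF W_chart] by blast
    note X' = M.vf_subset[OF X Q Int_lower1] and Y' = M.vf_subset[OF Y Q Int_lower1]
    have t: "smooth_on M ?Q fst"
      by (rule M.smooth_on_subset[OF smooth_on_fst Q]) (use openin_subset[OF Q] in blast)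
    have x: "smooth_on M ?Q (\<lambda>q. \<psi> i (snd q i) a)" if i: "i \<in> {1..m}" "a < l i" for i a
    proof -
      have "smooth_on M W (\<lambda>q. P \<psi> q (bs i + a))"
        by (rule M.smooth_on_chart_coord[OF W_chart]) (use block_bound[OF i] in \<open>simp only: mdim_M\<close>)
      then show ?thesis unfolding P_block[OF i] using M.smooth_on_subset[OF _ Q] by blast
    qed
    have s: "smooth_on M ?Q (\<lambda>q. gF i (snd q i) (tmap i q (X q)) (tmap i q (Y q)))" if i: "i \<in> {1..m}" for i
    proof -
      interpret Fi: metric_mfd "F i" "gF i" by (rule fib_metric[OF i])
      note Vi = bspec[OF V i]
      let ?c = "\<lambda>a. Fi.coord_field (V i) (\<psi> i) a"
      have cs: "smooth_on M ?Q (\<lambda>q. gF i (snd q i) (?c a (snd q i)) (?c b (snd q i)))" if "a < l i" "b < l i" for a b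
      proof (rule M.smooth_on_subset[OF smooth_on_proj[OF i Fi.g_smooth[OF Fi.coord_field_smooth[OF Vi that(1)] Fi.coord_field_smooth[OF Vi that(2)]]] Q])
        show "?Q \<subseteq> {q \<in> topspace (mtop M). snd q i \<in> V i}" using W_topspace W_proj[OF _ i] by blast
      qed
      have "smooth_on M ?Q (\<lambda>q. \<Sum>a\<in>{..<l i}. X q (\<lambda>q. \<psi> i (snd q i) a) * (\<Sum>b\<in>{..<l i}. Y q (\<lambda>q. \<psi> i (snd q i) b) *
          gF i (snd q i) (?c a (snd q i)) (?c b (snd q i))))"
        by (intro M.smooth_on_sum[OF Q] M.smooth_on_mult M.vf_apply[OF X'] M.vf_apply[OF Y'] x i cs) auto
      then show ?thesis
      proof (rule M.smooth_on_cong)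
        fix q assume q: "q \<in> ?Q"
        then have qW: "q \<in> W" by simp
        have pt: "snd q i \<in> topspace (mtop (F i))" using proj_topspace[OF W_topspace[OF qW] i] .
        have ct: "?c a (snd q i) \<in> tangent_space (F i) (snd q i)" if "a \<in> {..<l i}" for a
          using Fi.coord_field_tangent[OF Vi W_proj[OF qW i]] that by simp
        note Xt = M.vf_tangent[OF X' q] and Yt = M.vf_tangent[OF Y' q]
        have "gF i (snd q i) (tmap i q (X q)) (tmap i q (Y q)) =
            (\<Sum>a\<in>{..<l i}. X q (\<lambda>q. \<psi> i (snd q i) a) * gF i (snd q i) (?c a (snd q i)) (tmap i q (Y q)))"
          unfolding tmap_expand[OF qW i Xt]
          by (rule Fi.g_sum(1)[OF pt tmap_tangent[OF i W_topspace[OF qW] Yt] ct])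
        also have "\<dots> = (\<Sum>a\<in>{..<l i}. X q (\<lambda>q. \<psi> i (snd q i) a) * (\<Sum>b\<in>{..<l i}. Y q (\<lambda>q. \<psi> i (snd q i) b) *
          gF i (snd q i) (?c a (snd q i)) (?c b (snd q i))))"
          unfolding tmap_expand[OF qW i Yt]
          by (intro sum.cong refl) (simp only: Fi.g_sum(2)[OF pt ct ct])
        finally show "(\<Sum>a\<in>{..<l i}. X q (\<lambda>q. \<psi> i (snd q i) a) * (\<Sum>b\<in>{..<l i}. Y q (\<lambda>q. \<psi> i (snd q i) b) *
          gF i (snd q i) (?c a (snd q i)) (?c b (snd q i)))) = gF i (snd q i) (tmap i q (X q)) (tmap i q (Y q))" by simp
      qed
    qed
    have "smooth_on M ?Q (\<lambda>q. g q (X q) (Y q))"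
      unfolding g_eq
      by (intro M.smooth_on_add M.smooth_on_minus M.smooth_on_mult M.smooth_on_sum[OF Q] M.vf_apply[OF X' t] M.vf_apply[OF Y' t] s
          M.smooth_on_subset[OF B_smooth Q openin_subset[OF Q]]) auto
    then show "\<exists>W. q \<in> W \<and> W \<subseteq> U \<and> smooth_on M W (\<lambda>q. g q (X q) (Y q))"
      using q qV by (intro exI[of _ ?Q] conjI IntI Int_lower1)
  qed
qed

end

text \<open>A product region on which everything can be computed: a chart of each fibre to form
  lifts, and inside it an open set \<open>A i\<close> that carries an orthonormal frame
  \<open>e i\<close>.\<close>

locale kasner_region = kasner I m F gF DF \<phi> p + product_chart I m F V \<psi>
  for I m and F :: "nat \<Rightarrow> 'a mfd" and gF DF \<phi> p V \<psi> +
  fixes D :: "(real \<times> (nat \<Rightarrow> 'a)) conn" and A :: "nat \<Rightarrow> 'a set" and e :: "nat \<Rightarrow> nat \<Rightarrow> 'a vfield"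
  assumes lcM: "levi_civita M g D"
    and O_chart: "i \<in> {1..m} \<Longrightarrow> A i \<subseteq> V i"
    and e_frame: "i \<in> {1..m} \<Longrightarrow>
      metric_mfd.orth_frame (F i) (gF i) (A i) {..<mdim (F i)} (e i) (\<lambda>_. 1) (\<lambda>_ _. 1)"
begin

abbreviation "U \<equiv> I \<times> (\<Pi>\<^sub>E i\<in>{1..m}. A i)"
abbreviation "\<tau> \<equiv> d_dt M"
abbreviation "vfF i X \<equiv> smooth_vfield_on (F i) (A i) X"

end

sublocale kasner_region \<subseteq> L: lc_mfd "kasner_manifold I m F" "kasner_metric m F gF \<phi> p" D
  using metric_M lcM by (simp add: lc_mfd_def lc_mfd_axioms_def)

context kasner_region
begin

lemma e_facts:
  assumes i: "i \<in> {1..m}"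
  shows "openin (mtop (F i)) (A i)" "a < l i \<Longrightarrow> vfF i (e i a)"
    "a < l i \<Longrightarrow> b < l i \<Longrightarrow> x \<in> A i \<Longrightarrow> gF i x (e i a x) (e i b x) = (if a = b then 1 else 0)"
  using metric_mfd.orth_frameD(1,4,8)[OF fib_metric[OF i] e_frame[OF i]] by auto

lemma U_W: "U \<subseteq> W"
  using PiE_mono[of "{1..m}" A V] O_chart by blast

lemma UW: "q \<in> U \<Longrightarrow> q \<in> W"
  using U_W by blast

lemma U_open: "openin (mtop M) U"
  by (rule region_open) (rule e_facts(1))

lemma U_proj: "q \<in> U \<Longrightarrow> i \<in> {1..m} \<Longrightarrow> snd q i \<in> A i"
  by auto

lemma U_fst: "q \<in> U \<Longrightarrow> fst q \<in> I"
  by auto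

lemma U_top: "U \<subseteq> topspace (mtop M)"
  using openin_subset[OF U_open] .

lemma U_ptop: "q \<in> U \<Longrightarrow> i \<in> {1..m} \<Longrightarrow> snd q i \<in> topspace (mtop (F i))"
  using proj_topspace U_top by blast

lemma vfF_tangent: "i \<in> {1..m} \<Longrightarrow> vfF i X \<Longrightarrow> q \<in> U \<Longrightarrow> X (snd q i) \<in> tangent_space (F i) (snd q i)"
  using charted.vf_tangent[OF fib] U_proj by blast

lemma smooth_on_U_proj:
  assumes "i \<in> {1..m}" "smooth_on (F i) (A i) h"
  shows "smooth_on M U (\<lambda>q. h (snd q i))"
  by (rule M.smooth_on_subset[OF smooth_on_proj[OF assms] U_open]) (use U_top U_proj assms(1) in blast)

lemma smooth_on_U_fst:
  assumes "smooth_on M (topspace (mtop M)) (\<lambda>q. h (fst q))"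
  shows "smooth_on M U (\<lambda>q. h (fst q))"
  by (rule M.smooth_on_subset[OF assms U_open U_top])

lemma lift_smooth:
  assumes i: "i \<in> {1..m}" and X: "vfF i X"
  shows "smooth_vfield_on M U (lift i X)"
  unfolding lift_def[abs_def]
proof (rule M.vf_sum[OF U_open])
  interpret Fi: charted "F i" by (rule fib[OF i])
  fix a assume "a \<in> {..<l i}"
  then have a: "a < l i" by simp
  show "smooth_vfield_on M U (C (bs i + a))"
    by (rule M.vf_subset[OF M.coord_field_smooth[OF W_chart] U_open U_W]) (use block_bound[OF i a] mdim_M in simp)
  have "smooth_on (F i) (A i) (\<lambda>y. \<psi> i y a)"
    by (rule Fi.smooth_on_subset[OF Fi.smooth_on_chart_coord[OF bspec[OF V i] a] e_facts(1)[OF i] O_chart[OF i]])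
  from smooth_on_U_proj[OF i Fi.vf_apply[OF X this order_refl]]
  show "smooth_on M U (\<lambda>q. X (snd q i) (\<lambda>y. \<psi> i y a))" .
qed

lemma \<tau>_smooth: "smooth_vfield_on M U \<tau>"
  by (rule M.vf_subset[OF d_dt_smooth U_open U_top])

lemma coord_smooth_O: "k \<in> {1..m} \<Longrightarrow> b < l k \<Longrightarrow> smooth_on (F k) (A k) (\<lambda>y. \<psi> k y b)"
  using charted.smooth_on_subset[OF fib charted.smooth_on_chart_coord[OF fib bspec[OF V]] e_facts(1) O_chart] by blast

lemma tv_vanishing_on_U:
  assumes "q \<in> U" "v \<in> tangent_space M q" "\<And>q. q \<in> U \<Longrightarrow> f q = 0"
  shows "v f = 0"
  using M.tv_cong[OF assms(2) U_open assms(1), of f "\<lambda>_. 0"] assms(3) M.tv_const[OF assms(2)] by simp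

lemma lift_U_tangent: "q \<in> U \<Longrightarrow> i \<in> {1..m} \<Longrightarrow> lift i X q \<in> tangent_space M q"
  by (rule lift_tangent[OF UW])

lemma \<tau>_U_tangent: "q \<in> U \<Longrightarrow> \<tau> q \<in> tangent_space M q"
  by (rule d_dt_tangent[OF UW])

lemma lift_proj_U:
  assumes q: "q \<in> U" and i: "i \<in> {1..m}" and k: "k \<in> {1..m}" and X: "vfF i X" and f: "smooth_on (F k) (A k) f"
  shows "lift i X q (\<lambda>q. f (snd q k)) = (if i = k then X (snd q i) f else 0)"
  using lift_proj[where X = X, OF UW[OF q] i k charted.smooth_at_on[OF fib[OF k] f U_proj[OF q k]] vfF_tangent[OF i X q]] .

section \<open>Brackets and inner products of lifts\<close>

lemma lift_lift:
  assumes q: "q \<in> U" and i: "i \<in> {1..m}" and j: "j \<in> {1..m}" and k: "k \<in> {1..m}" and X: "vfF i X" and Y: "vfF j Y"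
    and f: "smooth_on (F k) (A k) f"
  shows "lift i X q (\<lambda>q. lift j Y q (\<lambda>q. f (snd q k))) = (if i = k \<and> j = k then X (snd q i) (\<lambda>z. Y z f) else 0)"
proof (cases "j = k")
  case True
  have s: "smooth_on (F k) (A k) (\<lambda>z. Y z f)"
    using charted.vf_apply[OF fib[OF k] _ f order_refl] Y True by blast
  have "lift i X q (\<lambda>q. lift j Y q (\<lambda>q. f (snd q k))) = lift i X q (\<lambda>q. Y (snd q k) f)"
    by (rule M.tv_cong[OF lift_U_tangent[OF q i] U_open q]) (use lift_proj_U[OF _ j k Y f] True in simp)
  then show ?thesis using lift_proj_U[OF q i k X s] True by simp
next
  case False
  have "lift i X q (\<lambda>q. lift j Y q (\<lambda>q. f (snd q k))) = 0"
    by (rule tv_vanishing_on_U[OF q lift_U_tangent[OF q i]]) (use lift_proj_U[OF _ j k Y f] False in simp)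
  then show ?thesis using False by simp
qed

text \<open>Lifts from one fibre are related to the original fields, and hence so are their
  brackets; lifts from distinct fibres differentiate different variables and commute. Both sides are
  compared on t and on the fibre coordinates.\<close>

lemma bracket_lift:
  assumes q: "q \<in> U" and i: "i \<in> {1..m}" and j: "j \<in> {1..m}" and X: "vfF i X" and Y: "vfF j Y"
  shows "lie_bracket M (lift i X) (lift j Y) q = (if i = j then lift i (lie_bracket (F i) X Y) q else (\<lambda>f. 0))"
proof (rule tv_eq_M[OF UW[OF q]])
  note t = lift_U_tangent[OF q]
  show "lie_bracket M (lift i X) (lift j Y) q \<in> tangent_space M q"
    by (rule M.vf_tangent[OF L.bracket_smooth[OF lift_smooth[OF i X] lift_smooth[OF j Y]] q])
  show "(if i = j then lift i (lie_bracket (F i) X Y) q else (\<lambda>f. 0)) \<in> tangent_space M q"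
    using t[OF i] M.tv_zero by (cases "i = j") simp_all
  have z: "lift i X q (\<lambda>q. lift j Y q fst) = 0" "lift j Y q (\<lambda>q. lift i X q fst) = 0"
    by (rule tv_vanishing_on_U[OF q t[OF i]], rule fst_values(2)[OF UW j], assumption)
      (rule tv_vanishing_on_U[OF q t[OF j]], rule fst_values(2)[OF UW i], assumption)
  show "lie_bracket M (lift i X) (lift j Y) q fst = (if i = j then lift i (lie_bracket (F i) X Y) q else (\<lambda>f. 0)) fst"
    unfolding M.lie_bracket_apply[OF fst_smooth_at[OF UW[OF q]]] z using fst_values(2)[OF UW[OF q] i]
    by (cases "i = j") simp_all
  fix k b assume k: "k \<in> {1..m}" and b: "b < l k"
  note f = coord_smooth_O[OF k b]
  have s: "smooth_at M q (\<lambda>q. \<psi> k (snd q k) b)" by (rule M.smooth_at_on[OF smooth_on_U_proj[OF k f] q])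
  interpret Fi: lc_mfd "F i" "gF i" "DF i" by (rule fib_lc[OF i])
  show "lie_bracket M (lift i X) (lift j Y) q (\<lambda>q. \<psi> k (snd q k) b) =
      (if i = j then lift i (lie_bracket (F i) X Y) q else (\<lambda>f. 0)) (\<lambda>q. \<psi> k (snd q k) b)"
  proof (cases "i = j")
    case True
    have Y': "vfF i Y" using Y True by simp
    have "lift i (lie_bracket (F i) X Y) q (\<lambda>q. \<psi> k (snd q k) b) =
        (if i = k then lie_bracket (F i) X Y (snd q i) (\<lambda>y. \<psi> k y b) else 0)"
      by (rule lift_proj_U[OF q i k Fi.bracket_smooth[OF X Y'] f])
    also have "\<dots> = lift i X q (\<lambda>q. lift j Y q (\<lambda>q. \<psi> k (snd q k) b)) - lift j Y q (\<lambda>q. lift i X q (\<lambda>q. \<psi> k (snd q k) b))"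
      unfolding lift_lift[OF q i j k X Y f] lift_lift[OF q j i k Y X f]
      using True Fi.lie_bracket_apply[OF Fi.smooth_at_on[of "A i" "\<lambda>y. \<psi> k y b"], of "snd q i" X Y] f U_proj[OF q i] by auto
    finally show ?thesis unfolding M.lie_bracket_apply[OF s] using True by simp
  next
    case False
    then show ?thesis unfolding M.lie_bracket_apply[OF s] lift_lift[OF q i j k X Y f] lift_lift[OF q j i k Y X f] by auto
  qed
qed

text \<open>Applied to fibre coordinates, a lift gives functions of the fibre, which
  \<partial>/\<partial>t annihilates; applied to t, each of the two fields gives a constant.\<close>

lemma bracket_\<tau>_lift:
  assumes q: "q \<in> U" and j: "j \<in> {1..m}" and Y: "vfF j Y"
  shows "lie_bracket M \<tau> (lift j Y) q = (\<lambda>f. 0)"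
proof (rule tv_eq_M[OF UW[OF q]])
  note t = lift_U_tangent[OF q j] and d = \<tau>_U_tangent[OF q]
  show "lie_bracket M \<tau> (lift j Y) q \<in> tangent_space M q"
    by (rule M.vf_tangent[OF L.bracket_smooth[OF \<tau>_smooth lift_smooth[OF j Y]] q])
  show "(\<lambda>f. 0) \<in> tangent_space M q" by (rule M.tv_zero)
  have "\<tau> q (\<lambda>q. lift j Y q fst) = 0"
    by (rule tv_vanishing_on_U[OF q d], rule fst_values(2)[OF UW j], assumption)
  moreover have "lift j Y q (\<lambda>q. \<tau> q fst) = lift j Y q (\<lambda>q. 1)"
    by (rule M.tv_cong[OF t U_open q]) (rule fst_values(1)[OF UW])
  ultimately show "lie_bracket M \<tau> (lift j Y) q fst = 0"
    unfolding M.lie_bracket_apply[OF fst_smooth_at[OF UW[OF q]]] using M.tv_const[OF t] by simp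
  fix k b assume k: "k \<in> {1..m}" and b: "b < l k"
  note f = coord_smooth_O[OF k b]
  have s: "smooth_at M q (\<lambda>q. \<psi> k (snd q k) b)" by (rule M.smooth_at_on[OF smooth_on_U_proj[OF k f] q])
  have "\<tau> q (\<lambda>q. lift j Y q (\<lambda>q. \<psi> k (snd q k) b)) = \<tau> q (\<lambda>q. if j = k then Y (snd q j) (\<lambda>y. \<psi> k y b) else 0)"
    by (rule M.tv_cong[OF d U_open q]) (rule lift_proj_U[OF _ j k Y f])
  also have "\<dots> = 0"
    using d_dt_proj[OF UW[OF q] j] M.tv_const[OF d] by (cases "j = k") simp_all
  finally have "\<tau> q (\<lambda>q. lift j Y q (\<lambda>q. \<psi> k (snd q k) b)) = 0" .
  moreover have "lift j Y q (\<lambda>q. \<tau> q (\<lambda>q. \<psi> k (snd q k) b)) = 0"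
    by (rule tv_vanishing_on_U[OF q t]) (rule d_dt_proj[OF UW k])
  ultimately show "lie_bracket M \<tau> (lift j Y) q (\<lambda>q. \<psi> k (snd q k) b) = 0"
    unfolding M.lie_bracket_apply[OF s] by simp
qed

lemma bracket_lift_\<tau>:
  assumes q: "q \<in> U" and j: "j \<in> {1..m}" and Y: "vfF j Y"
  shows "lie_bracket M (lift j Y) \<tau> q = (\<lambda>f. 0)"
  using bracket_\<tau>_lift[OF assms] M.lie_bracket_swap[of "lift j Y" \<tau> q] by simp

lemma g_lift_lift:
  assumes q: "q \<in> U" and i: "i \<in> {1..m}" and j: "j \<in> {1..m}" and X: "vfF i X" and Y: "vfF j Y"
  shows "g q (lift i X q) (lift j Y q) = (if i = j then B i (fst q) * gF i (snd q i) (X (snd q i)) (Y (snd q i)) else 0)"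
proof -
  note qW = UW[OF q] and Xt = vfF_tangent[OF i X q] and Yt = vfF_tangent[OF j Y q]
  have "B k (fst q) * gF k (snd q k) (tmap k q (lift i X q)) (tmap k q (lift j Y q)) =
      (if k = i then if i = j then B i (fst q) * gF i (snd q i) (X (snd q i)) (Y (snd q i)) else 0 else 0)"
    if k: "k \<in> {1..m}" for k
  proof -
    interpret Fk: metric_mfd "F k" "gF k" by (rule fib_metric[OF k])
    note z = Fk.g_zero[OF U_ptop[OF q k]]
    have a: "tmap k q (lift i X q) = (if i = k then X (snd q i) else (\<lambda>f. 0))"
      by (rule tmap_lift[where X = X, OF qW i k Xt])
    have b: "tmap k q (lift j Y q) = (if j = k then Y (snd q j) else (\<lambda>f. 0))"
      by (rule tmap_lift[where X = Y, OF qW j k Yt])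
    show ?thesis
    proof (cases "i = k")
      case True
      show ?thesis
      proof (cases "j = k")
        case False
        have "gF k (snd q k) (X (snd q k)) (\<lambda>f. 0) = 0" using z(2) Xt True by blast
        then show ?thesis using a b True False by simp
      qed (use a b True in simp)
    next
      case False
      have "tmap k q (lift j Y q) \<in> tangent_space (F k) (snd q k)"
        by (rule tmap_tangent[OF k subsetD[OF U_top q] lift_U_tangent[OF q j]])
      from z(1)[OF this] show ?thesis using a False by simp
    qed
  qed
  then have s: "(\<Sum>k\<in>{1..m}. B k (fst q) * gF k (snd q k) (tmap k q (lift i X q)) (tmap k q (lift j Y q))) =
     (\<Sum>k\<in>{1..m}. if k = i then if i = j then B i (fst q) * gF i (snd q i) (X (snd q i)) (Y (snd q i)) else 0 else 0)"
    by (rule sum.cong[OF refl])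
  have "g q (lift i X q) (lift j Y q) =
     (\<Sum>k\<in>{1..m}. if k = i then if i = j then B i (fst q) * gF i (snd q i) (X (snd q i)) (Y (snd q i)) else 0 else 0)"
    unfolding g_eq fst_values(2)[OF qW i] s by simp
  also have "\<dots> = (if i = j then B i (fst q) * gF i (snd q i) (X (snd q i)) (Y (snd q i)) else 0)"
    using i by (simp add: sum.delta)
  finally show ?thesis .
qed

lemma g_\<tau>:
  assumes q: "q \<in> U" and v: "v \<in> tangent_space M q"
  shows "g q (\<tau> q) v = - (v fst)"
proof -
  note qW = UW[OF q]
  have "gF i (snd q i) (tmap i q (\<tau> q)) (tmap i q v) = 0" if i: "i \<in> {1..m}" for i
    unfolding tmap_d_dt[OF qW i]
    by (rule metric_mfd.g_zero(1)[OF fib_metric[OF i] U_ptop[OF q i] tmap_tangent[OF i subsetD[OF U_top q] v]])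
  then show ?thesis unfolding g_eq fst_values(1)[OF qW] by simp
qed

lemma g_\<tau>_\<tau>: "q \<in> U \<Longrightarrow> g q (\<tau> q) (\<tau> q) = - 1"
  using g_\<tau>[OF _ \<tau>_U_tangent] fst_values(1)[OF UW] by metis

lemma g_\<tau>_lift:
  assumes "q \<in> U" "i \<in> {1..m}"
  shows "g q (\<tau> q) (lift i X q) = 0" "g q (lift i X q) (\<tau> q) = 0"
  using g_\<tau>[OF assms(1) lift_U_tangent[OF assms]] fst_values(2)[OF UW[OF assms(1)] assms(2)]
    L.g_sym[OF subsetD[OF U_top assms(1)] \<tau>_U_tangent[OF assms(1)] lift_U_tangent[OF assms]] by simp_all

text \<open>The logarithmic derivative of the warping function \<open>\<phi>\<^bsup>p i\<^esup>\<close>, of which \<open>B i\<close> is the square.\<close>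

definition H :: "nat \<Rightarrow> real \<Rightarrow> real" where "H i t = p i * (deriv \<phi> t / \<phi> t)"

lemma phi_deriv: "t \<in> I \<Longrightarrow> (\<phi> has_field_derivative deriv \<phi> t) (at t)"
  "t \<in> I \<Longrightarrow> (deriv \<phi> has_field_derivative deriv (deriv \<phi>) t) (at t)"
proof -
  assume t: "t \<in> I"
  have "((deriv ^^ k) \<phi> has_field_derivative deriv ((deriv ^^ k) \<phi>) t) (at t)" for k
  proof -
    have "(deriv ^^ k) \<phi> differentiable (at t)"
      using phi_smooth t at_within_open[OF t open_I]
      unfolding smooth_real_on_def differentiable_on_def by metis
    then show ?thesis by (metis DERIV_imp_deriv real_differentiable_def)
  qed
  from this[of 0] this[of 1] show "(\<phi> has_field_derivative deriv \<phi> t) (at t)"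
    "(deriv \<phi> has_field_derivative deriv (deriv \<phi>) t) (at t)" by simp_all
qed

lemma B_deriv:
  assumes t: "t \<in> I"
  shows "(B i has_field_derivative 2 * H i t * B i t) (at t)"
proof -
  have "((\<lambda>t. \<phi> t powr (2 * p i)) has_field_derivative
      \<phi> t powr (2 * p i) * (0 * ln (\<phi> t) + deriv \<phi> t * (2 * p i) / \<phi> t)) (at t)"
    by (rule DERIV_powr[OF phi_deriv(1)[OF t] phi_pos[OF t] DERIV_const])
  then show ?thesis unfolding B_def[abs_def] H_def by (rule DERIV_cong) (simp add: mult_ac)
qed

lemma H_deriv:
  assumes t: "t \<in> I"
  shows "(H i has_field_derivative p i * (deriv (deriv \<phi>) t / \<phi> t - (deriv \<phi> t / \<phi> t)\<^sup>2)) (at t)"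
proof -
  have "((\<lambda>t. p i * (deriv \<phi> t / \<phi> t)) has_field_derivative
     p i * ((deriv (deriv \<phi>) t * \<phi> t - deriv \<phi> t * deriv \<phi> t) / (\<phi> t * \<phi> t))) (at t)"
    by (intro DERIV_cmult DERIV_divide phi_deriv t) (use phi_pos[OF t] in simp)
  then show ?thesis unfolding H_def[abs_def]
    by (rule DERIV_cong) (use phi_pos[OF t] in \<open>simp add: field_simps power2_eq_square\<close>)
qed

lemma H_smooth: "smooth_on M U (\<lambda>q. H i (fst q))"
proof -
  have d: "smooth_real_on I (deriv \<phi>)"
    unfolding smooth_real_on_def
  proof
    fix k show "(deriv ^^ k) (deriv \<phi>) differentiable_on I"
      using phi_smooth[unfolded smooth_real_on_def, rule_format, of "Suc k"] by (simp add: funpow_swap1)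
  qed
  have "smooth_on M U (\<lambda>q. p i * (deriv \<phi> (fst q) * \<phi> (fst q) powr - 1))"
    by (intro M.smooth_on_cmult M.smooth_on_mult M.smooth_on_powr smooth_on_U_fst smooth_on_fst_fun d phi_smooth)
      (rule phi_pos[OF U_fst])
  then show ?thesis
  proof (rule M.smooth_on_cong)
    show "p i * (deriv \<phi> (fst q) * \<phi> (fst q) powr - 1) = H i (fst q)" if "q \<in> U" for q
      using phi_pos[OF U_fst[OF that]] by (simp add: H_def powr_minus divide_inverse)
  qed
qed

lemma lift_B:
  assumes q: "q \<in> U" and j: "j \<in> {1..m}" and k: "k \<in> {1..m}" and X: "vfF j X" and G: "smooth_on (F k) (A k) G"
  shows "lift j X q (\<lambda>q. B i (fst q) * G (snd q k)) = (if j = k then B i (fst q) * X (snd q j) G else 0)"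
proof -
  have s: "smooth_at M q (\<lambda>q. B i (fst q))" by (rule M.smooth_at_on[OF B_smooth subsetD[OF U_top q]])
  have s': "smooth_at M q (\<lambda>q. G (snd q k))" by (rule M.smooth_at_on[OF smooth_on_U_proj[OF k G] q])
  show ?thesis
    unfolding M.tv_mult[OF lift_U_tangent[OF q j] s s'] lift_proj_U[OF q j k X G] lift_fst_fun[OF UW[OF q] j s] by simp
qed

lemma \<tau>_B:
  assumes q: "q \<in> U" and k: "k \<in> {1..m}" and G: "smooth_on (F k) (A k) G"
  shows "\<tau> q (\<lambda>q. B i (fst q) * G (snd q k)) = 2 * H i (fst q) * B i (fst q) * G (snd q k)"
proof -
  have s: "smooth_at M q (\<lambda>q. B i (fst q))" by (rule M.smooth_at_on[OF B_smooth subsetD[OF U_top q]])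
  have s': "smooth_at M q (\<lambda>q. G (snd q k))" by (rule M.smooth_at_on[OF smooth_on_U_proj[OF k G] q])
  show ?thesis
    unfolding M.tv_mult[OF \<tau>_U_tangent[OF q] s s'] d_dt_proj[OF UW[OF q] k] d_dt_fst_fun[OF UW[OF q] s]
      DERIV_imp_deriv[OF B_deriv[OF U_fst[OF q]]] by simp
qed

lemma lift_g:
  assumes q: "q \<in> U" and i: "i \<in> {1..m}" and j: "j \<in> {1..m}" and k: "k \<in> {1..m}"
    and X: "vfF i X" and Y: "vfF j Y" and Z: "vfF k Z"
  shows "lift i X q (\<lambda>q. g q (lift j Y q) (lift k Z q)) =
    (if j = k \<and> i = j then B i (fst q) * X (snd q i) (\<lambda>z. gF i z (Y z) (Z z)) else 0)"
proof (cases "j = k")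
  case True
  have s: "smooth_on (F j) (A j) (\<lambda>z. gF j z (Y z) (Z z))"
    using metric_mfd.g_smooth[OF fib_metric[OF j] Y] Z True by blast
  have "lift i X q (\<lambda>q. g q (lift j Y q) (lift k Z q)) = lift i X q (\<lambda>q. B j (fst q) * (\<lambda>z. gF j z (Y z) (Z z)) (snd q j))"
    by (rule M.tv_cong[OF lift_U_tangent[OF q i] U_open q]) (use g_lift_lift[OF _ j k Y Z] True in simp)
  also have "\<dots> = (if i = j then B j (fst q) * X (snd q i) (\<lambda>z. gF j z (Y z) (Z z)) else 0)"
    by (rule lift_B[OF q i j X s])
  finally show ?thesis using True by auto
next
  case False
  have "lift i X q (\<lambda>q. g q (lift j Y q) (lift k Z q)) = 0"
    by (rule tv_vanishing_on_U[OF q lift_U_tangent[OF q i]]) (use g_lift_lift[OF _ j k Y Z] False in simp)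
  then show ?thesis using False by simp
qed

lemma \<tau>_g:
  assumes q: "q \<in> U" and i: "i \<in> {1..m}" and j: "j \<in> {1..m}" and X: "vfF i X" and Y: "vfF j Y"
  shows "\<tau> q (\<lambda>q. g q (lift i X q) (lift j Y q)) =
    (if i = j then 2 * H i (fst q) * B i (fst q) * gF i (snd q i) (X (snd q i)) (Y (snd q i)) else 0)"
proof (cases "i = j")
  case True
  have s: "smooth_on (F i) (A i) (\<lambda>z. gF i z (X z) (Y z))"
    using metric_mfd.g_smooth[OF fib_metric[OF i] X] Y True by blast
  have "\<tau> q (\<lambda>q. g q (lift i X q) (lift j Y q)) = \<tau> q (\<lambda>q. B i (fst q) * (\<lambda>z. gF i z (X z) (Y z)) (snd q i))"
    by (rule M.tv_cong[OF \<tau>_U_tangent[OF q] U_open q]) (use g_lift_lift[OF _ i j X Y] True in simp)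
  also have "\<dots> = 2 * H i (fst q) * B i (fst q) * gF i (snd q i) (X (snd q i)) (Y (snd q i))"
    by (rule \<tau>_B[OF q i s])
  finally show ?thesis using True by simp
next
  case False
  have "\<tau> q (\<lambda>q. g q (lift i X q) (lift j Y q)) = 0"
    by (rule tv_vanishing_on_U[OF q \<tau>_U_tangent[OF q]]) (use g_lift_lift[OF _ i j X Y] False in simp)
  then show ?thesis using False by simp
qed

text \<open>Inner products of \<partial>/\<partial>t with lifts and with itself are constant, so
  their derivatives drop out of the Koszul formula.\<close>

lemma deriv_g_\<tau>:
  assumes q: "q \<in> U" and v: "v \<in> tangent_space M q" and i: "i \<in> {1..m}"
  shows "v (\<lambda>q. g q (lift i X q) (\<tau> q)) = 0" "v (\<lambda>q. g q (\<tau> q) (lift i X q)) = 0" "v (\<lambda>q. g q (\<tau> q) (\<tau> q)) = 0"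
proof -
  show "v (\<lambda>q. g q (lift i X q) (\<tau> q)) = 0" by (rule tv_vanishing_on_U[OF q v]) (rule g_\<tau>_lift(2)[OF _ i])
  show "v (\<lambda>q. g q (\<tau> q) (lift i X q)) = 0" by (rule tv_vanishing_on_U[OF q v]) (rule g_\<tau>_lift(1)[OF _ i])
  have "v (\<lambda>q. g q (\<tau> q) (\<tau> q)) = v (\<lambda>q. - 1)" by (rule M.tv_cong[OF v U_open q]) (rule g_\<tau>_\<tau>)
  then show "v (\<lambda>q. g q (\<tau> q) (\<tau> q)) = 0" using M.tv_const[OF v] by simp
qed

section \<open>The adapted frame and the Levi-Civita connection\<close>

lemma g_0: "q \<in> U \<Longrightarrow> v \<in> tangent_space M q \<Longrightarrow> g q (\<lambda>f. 0) v = 0"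
  using L.g_zero(1) U_top by blast

text \<open>The pair (0, 0) stands for \<partial>/\<partial>t and (i, a) for the lift of the a-th
  frame field of fibre i. There is no clash, as fibres are numbered from 1.\<close>

definition J :: "(nat \<times> nat) set" where "J = insert (0, 0) (SIGMA i:{1..m}. {..<l i})"

definition x :: "nat \<times> nat \<Rightarrow> (real \<times> (nat \<Rightarrow> 'a)) vfield" where
  "x \<alpha> = (if fst \<alpha> = 0 then \<tau> else lift (fst \<alpha>) (e (fst \<alpha>) (snd \<alpha>)))"

definition sg :: "nat \<times> nat \<Rightarrow> real" where "sg \<alpha> = (if fst \<alpha> = 0 then - 1 else 1)"

definition sc :: "nat \<times> nat \<Rightarrow> real \<times> (nat \<Rightarrow> 'a) \<Rightarrow> real" where
  "sc \<alpha> q = (if fst \<alpha> = 0 then 1 else B (fst \<alpha>) (fst q))"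

lemma J_cases:
  assumes "\<alpha> \<in> J"
  obtains "\<alpha> = (0, 0)" | i a where "\<alpha> = (i, a)" "i \<in> {1..m}" "a < l i" "i \<noteq> 0"
  using assms unfolding J_def by auto

lemma frame: "L.orth_frame U J x sg sc"
  unfolding L.orth_frame_def
proof (intro conjI ballI)
  show "openin (mtop M) U" by (rule U_open)
  show "finite J" by (simp add: J_def)
  have "card J = Suc (card (SIGMA i:{1..m}. {..<l i}))" unfolding J_def by (rule card_insert_disjoint) auto
  then show "card J = mdim M" unfolding mdim_M by simp
  fix \<alpha> assume \<alpha>: "\<alpha> \<in> J"
  show "smooth_vfield_on M U (x \<alpha>)"
  proof (rule J_cases[OF \<alpha>])
    assume "\<alpha> = (0, 0)"
    then have "x \<alpha> = \<tau>" by (simp add: x_def)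
    then show ?thesis using \<tau>_smooth by (simp only:)
  next
    fix i a assume a: "\<alpha> = (i, a)" "i \<in> {1..m}" "a < l i" "i \<noteq> 0"
    then have "x \<alpha> = lift i (e i a)" by (simp add: x_def)
    then show ?thesis using lift_smooth[OF a(2) e_facts(2)[OF a(2,3)]] by (simp only:)
  qed
  show "sg \<alpha> \<in> {1, - 1}" by (simp add: sg_def)
  show "0 < sc \<alpha> q" if "q \<in> U" for q using B_pos[OF U_fst[OF that]] by (simp add: sc_def)
  fix \<beta> q assume \<beta>: "\<beta> \<in> J" and q: "q \<in> U"
  show "g q (x \<alpha> q) (x \<beta> q) = (if \<alpha> = \<beta> then sg \<alpha> * sc \<alpha> q else 0)"
  proof (rule J_cases[OF \<alpha>])
    assume a: "\<alpha> = (0, 0)"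
    show ?thesis
      by (rule J_cases[OF \<beta>]) (simp_all add: a x_def sg_def sc_def g_\<tau>_\<tau>[OF q] g_\<tau>_lift[OF q])
  next
    fix i a assume a: "\<alpha> = (i, a)" "i \<in> {1..m}" "a < l i" "i \<noteq> 0"
    show ?thesis
    proof (rule J_cases[OF \<beta>])
      assume "\<beta> = (0, 0)"
      then show ?thesis using a g_\<tau>_lift[OF q a(2)] by (simp add: x_def)
    next
      fix j b assume b: "\<beta> = (j, b)" "j \<in> {1..m}" "b < l j" "j \<noteq> 0"
      show ?thesis
        using g_lift_lift[OF q a(2) b(2) e_facts(2)[OF a(2,3)] e_facts(2)[OF b(2,3)]]
          e_facts(3)[OF a(2,3) _ U_proj[OF q a(2)], of b] a b by (auto simp: x_def sg_def sc_def)
    qed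
  qed
qed

text \<open>The Koszul formula yields a vector only through its products with test fields. Since the
  test fields include the frame, \<open>orth_frame_expansion\<close> recovers the vector.\<close>

lemma nondegenerate:
  assumes q: "q \<in> U" and v: "v \<in> tangent_space M q" and w: "w \<in> tangent_space M q"
    and t: "g q v (\<tau> q) = g q w (\<tau> q)"
    and lft: "\<And>k Z. k \<in> {1..m} \<Longrightarrow> vfF k Z \<Longrightarrow> g q v (lift k Z q) = g q w (lift k Z q)"
  shows "v = w"
proof -
  have "g q v (x \<alpha> q) = g q w (x \<alpha> q)" if \<alpha>: "\<alpha> \<in> J" for \<alpha>
    by (rule J_cases[OF \<alpha>]) (simp_all add: x_def t lft e_facts(2))
  then have "(\<lambda>f. \<Sum>\<alpha>\<in>J. sg \<alpha> / sc \<alpha> q * g q v (x \<alpha> q) * x \<alpha> q f) =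
     (\<lambda>f. \<Sum>\<alpha>\<in>J. sg \<alpha> / sc \<alpha> q * g q w (x \<alpha> q) * x \<alpha> q f)"
    by (intro ext sum.cong refl) simp
  then show ?thesis
    using L.orth_frame_expansion[OF frame q v] L.orth_frame_expansion[OF frame q w] by simp
qed

text \<open>Against a lift, the Koszul formula is \<open>B i\<close> times that of fibre i if all
  three indices agree, and zero otherwise. Against \<partial>/\<partial>t it keeps only minus the
  t-derivative of B_i g_F(X, Y), that is -2 H_i B_i g_F(X, Y) when i = j; as \<partial>/\<partial>t
  has square -1, the coefficient of \<partial>/\<partial>t is +H_i B_i g_F(X, Y).\<close>

lemma D_lift_lift:
  assumes q: "q \<in> U" and i: "i \<in> {1..m}" and j: "j \<in> {1..m}" and X: "vfF i X" and Y: "vfF j Y"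
  shows "D (lift i X) (lift j Y) q = (if i = j then
    (\<lambda>f. lift i (DF i X Y) q f + H i (fst q) * B i (fst q) * gF i (snd q i) (X (snd q i)) (Y (snd q i)) * \<tau> q f) else (\<lambda>f. 0))"
proof (rule nondegenerate[OF q])
  note qt = subsetD[OF U_top q]
  note lX = lift_smooth[OF i X] and lY = lift_smooth[OF j Y]
  interpret Fi: lc_mfd "F i" "gF i" "DF i" by (rule fib_lc[OF i])
  note t = lift_U_tangent[OF q] and d = \<tau>_U_tangent[OF q]
  show "D (lift i X) (lift j Y) q \<in> tangent_space M q" by (rule M.vf_tangent[OF L.D_smooth[OF lX lY] q])
  show "(if i = j then
    (\<lambda>f. lift i (DF i X Y) q f + H i (fst q) * B i (fst q) * gF i (snd q i) (X (snd q i)) (Y (snd q i)) * \<tau> q f) else (\<lambda>f. 0))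
    \<in> tangent_space M q" using M.tv_plus[OF t[OF i] M.tv_scaled[OF d]] M.tv_zero by (cases "i = j") simp_all
  have b: "g q (lie_bracket M (lift i X) (lift j Y) q) (\<tau> q) = 0"
    unfolding bracket_lift[OF q i j X Y] using g_\<tau>_lift(2)[OF q i] g_0[OF q d] by (cases "i = j") simp_all
  have "2 * g q (D (lift i X) (lift j Y) q) (\<tau> q) =
      - (if i = j then 2 * H i (fst q) * B i (fst q) * gF i (snd q i) (X (snd q i)) (Y (snd q i)) else 0)"
    unfolding L.koszul[OF lX lY \<tau>_smooth q] \<tau>_g[OF q i j X Y] b deriv_g_\<tau>(1)[OF q t[OF i] j] deriv_g_\<tau>(1)[OF q t[OF j] i]
      bracket_lift_\<tau>[OF q i X] bracket_lift_\<tau>[OF q j Y] g_0[OF q t[OF i]] g_0[OF q t[OF j]] by simp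
  then show "g q (D (lift i X) (lift j Y) q) (\<tau> q) = g q (if i = j then
    (\<lambda>f. lift i (DF i X Y) q f + H i (fst q) * B i (fst q) * gF i (snd q i) (X (snd q i)) (Y (snd q i)) * \<tau> q f) else (\<lambda>f. 0)) (\<tau> q)"
    using L.g_add(1)[OF qt t[OF i] M.tv_scaled[OF d] d] L.g_scale(1)[OF qt d d] g_\<tau>_\<tau>[OF q] g_\<tau>_lift(2)[OF q i] g_0[OF q d]
    by (cases "i = j") simp_all
  fix k Z assume k: "k \<in> {1..m}" and Z: "vfF k Z"
  note lZ = lift_smooth[OF k Z]
  \<comment> \<open>Stated with fresh indices, to serve for the three brackets of the Koszul
    formula.\<close>
  have br: "g q (lie_bracket M (lift i' X') (lift j' Y') q) (lift k' Z' q) =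
     (if i' = j' \<and> j' = k' then B i' (fst q) * gF i' (snd q i') (lie_bracket (F i') X' Y' (snd q i')) (Z' (snd q i')) else 0)"
    if h: "i' \<in> {1..m}" "j' \<in> {1..m}" "k' \<in> {1..m}" "vfF i' X'" "vfF j' Y'" "vfF k' Z'" for i' j' k' X' Y' Z'
  proof (cases "i' = j'")
    case True
    interpret Fi': lc_mfd "F i'" "gF i'" "DF i'" by (rule fib_lc[OF h(1)])
    have "vfF i' (lie_bracket (F i') X' Y')" using Fi'.bracket_smooth[OF h(4)] h(5) True by simp
    then show ?thesis using bracket_lift[OF q h(1,2,4,5)] g_lift_lift[OF q h(1,3) _ h(6)] True by simp
  next
    case False
    then show ?thesis using bracket_lift[OF q h(1,2,4,5)] g_0[OF q t[OF h(3)]] by simp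
  qed
  have K: "2 * g q (D (lift i X) (lift j Y) q) (lift k Z q) =
    (if i = j \<and> j = k then 2 * (B i (fst q) * gF i (snd q i) (DF i X Y (snd q i)) (Z (snd q i))) else 0)"
  proof (cases "i = j \<and> j = k")
    case True
    then have Y': "vfF i Y" and Z': "vfF i Z" using Y Z by simp_all
    show ?thesis
      unfolding L.koszul[OF lX lY lZ q] lift_g[OF q i j k X Y Z] lift_g[OF q j i k Y X Z] lift_g[OF q k i j Z X Y]
        br[OF i j k X Y Z] br[OF i k j X Z Y] br[OF j k i Y Z X]
      using arg_cong[OF Fi.koszul[OF X Y' Z' U_proj[OF q i]], of "\<lambda>r. B i (fst q) * r"] True
      by (simp add: algebra_simps)
  next
    case False
    then show ?thesis
      unfolding L.koszul[OF lX lY lZ q] lift_g[OF q i j k X Y Z] lift_g[OF q j i k Y X Z] lift_g[OF q k i j Z X Y]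
        br[OF i j k X Y Z] br[OF i k j X Z Y] br[OF j k i Y Z X] by auto
  qed
  show "g q (D (lift i X) (lift j Y) q) (lift k Z q) = g q (if i = j then
    (\<lambda>f. lift i (DF i X Y) q f + H i (fst q) * B i (fst q) * gF i (snd q i) (X (snd q i)) (Y (snd q i)) * \<tau> q f) else (\<lambda>f. 0)) (lift k Z q)"
  proof (cases "i = j")
    case True
    then have "vfF i (DF i X Y)" using Fi.D_smooth[OF X] Y by simp
    from g_lift_lift[OF q i k this Z] show ?thesis
      using K True L.g_add(1)[OF qt t[OF i] M.tv_scaled[OF d] t[OF k]] L.g_scale(1)[OF qt d t[OF k]] g_\<tau>_lift(1)[OF q k]
      by (cases "j = k") simp_all
  next
    case False
    then show ?thesis using K g_0[OF q t[OF k]] by simp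
  qed
qed

text \<open>\<partial>/\<partial>t commutes with lifts and is orthogonal to their brackets, so
  against a lift only the t-derivative of the metric survives; on fibre j it multiplies the metric
  by 2 H_j.\<close>

lemma D_\<tau>_lift:
  assumes q: "q \<in> U" and j: "j \<in> {1..m}" and Y: "vfF j Y"
  shows "D \<tau> (lift j Y) q = (\<lambda>f. H j (fst q) * lift j Y q f)"
proof (rule nondegenerate[OF q])
  note qt = subsetD[OF U_top q]
  note lY = lift_smooth[OF j Y]
  note t = lift_U_tangent[OF q] and d = \<tau>_U_tangent[OF q]
  show "D \<tau> (lift j Y) q \<in> tangent_space M q" by (rule M.vf_tangent[OF L.D_smooth[OF \<tau>_smooth lY] q])
  show "(\<lambda>f. H j (fst q) * lift j Y q f) \<in> tangent_space M q" by (rule M.tv_scaled[OF t[OF j]])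
  have tt: "lie_bracket M \<tau> \<tau> q = (\<lambda>f. 0)" by (simp add: lie_bracket_def fun_eq_iff)
  have "2 * g q (D \<tau> (lift j Y) q) (\<tau> q) = 0"
    unfolding L.koszul[OF \<tau>_smooth lY \<tau>_smooth q] deriv_g_\<tau>[OF q d j] deriv_g_\<tau>[OF q t[OF j] j] tt
      bracket_lift_\<tau>[OF q j Y] bracket_\<tau>_lift[OF q j Y] g_0[OF q d] g_0[OF q t[OF j]] by simp
  then show "g q (D \<tau> (lift j Y) q) (\<tau> q) = g q (\<lambda>f. H j (fst q) * lift j Y q f) (\<tau> q)"
    using L.g_scale(1)[OF qt t[OF j] d] g_\<tau>_lift(2)[OF q j] by simp
  fix k Z assume k: "k \<in> {1..m}" and Z: "vfF k Z"
  note lZ = lift_smooth[OF k Z]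
  have b: "g q (lie_bracket M (lift j Y) (lift k Z) q) (\<tau> q) = 0"
    unfolding bracket_lift[OF q j k Y Z] using g_\<tau>_lift(2)[OF q j] g_0[OF q d] by (cases "j = k") simp_all
  have "2 * g q (D \<tau> (lift j Y) q) (lift k Z q) = \<tau> q (\<lambda>q. g q (lift j Y q) (lift k Z q))"
    unfolding L.koszul[OF \<tau>_smooth lY lZ q] deriv_g_\<tau>[OF q t[OF j] k] deriv_g_\<tau>[OF q t[OF k] j]
      bracket_\<tau>_lift[OF q j Y] bracket_\<tau>_lift[OF q k Z] b g_0[OF q t[OF j]] g_0[OF q t[OF k]] by simp
  then show "g q (D \<tau> (lift j Y) q) (lift k Z q) = g q (\<lambda>f. H j (fst q) * lift j Y q f) (lift k Z q)"
    unfolding \<tau>_g[OF q j k Y Z] L.g_scale(1)[OF qt t[OF j] t[OF k]] g_lift_lift[OF q j k Y Z] by auto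
qed

lemma D_lift_\<tau>:
  assumes q: "q \<in> U" and j: "j \<in> {1..m}" and Y: "vfF j Y"
  shows "D (lift j Y) \<tau> q = (\<lambda>f. H j (fst q) * lift j Y q f)"
proof -
  have "lie_bracket M \<tau> (lift j Y) q = (\<lambda>h. D \<tau> (lift j Y) q h - D (lift j Y) \<tau> q h)"
    by (rule L.lc_torsion[OF \<tau>_smooth lift_smooth[OF j Y] q])
  then show ?thesis unfolding bracket_\<tau>_lift[OF assms] D_\<tau>_lift[OF assms] by (auto simp: fun_eq_iff)
qed

text \<open>Every term of the Koszul formula vanishes, the inner products being constant and the
  brackets zero: the t-lines are geodesics.\<close>

lemma D_\<tau>_\<tau>:
  assumes q: "q \<in> U"
  shows "D \<tau> \<tau> q = (\<lambda>f. 0)"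
proof (rule nondegenerate[OF q])
  note t = lift_U_tangent[OF q] and d = \<tau>_U_tangent[OF q]
  show "D \<tau> \<tau> q \<in> tangent_space M q" by (rule M.vf_tangent[OF L.D_smooth[OF \<tau>_smooth \<tau>_smooth] q])
  show "(\<lambda>f. 0) \<in> tangent_space M q" by (rule M.tv_zero)
  have tt: "lie_bracket M \<tau> \<tau> q = (\<lambda>f. 0)" by (simp add: lie_bracket_def fun_eq_iff)
  have z: "v (\<lambda>q. g q (\<tau> q) (\<tau> q)) = 0" if v: "v \<in> tangent_space M q" for v
    using M.tv_cong[OF v U_open q g_\<tau>_\<tau>, of "\<lambda>q. q"] M.tv_const[OF v] by simp
  have "2 * g q (D \<tau> \<tau> q) (\<tau> q) = 0"
    unfolding L.koszul[OF \<tau>_smooth \<tau>_smooth \<tau>_smooth q] tt z[OF d] g_0[OF q d] by simp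
  then show "g q (D \<tau> \<tau> q) (\<tau> q) = g q (\<lambda>f. 0) (\<tau> q)" using g_0[OF q d] by simp
  fix k Z assume k: "k \<in> {1..m}" and Z: "vfF k Z"
  have "2 * g q (D \<tau> \<tau> q) (lift k Z q) = 0"
    unfolding L.koszul[OF \<tau>_smooth \<tau>_smooth lift_smooth[OF k Z] q] tt z[OF t[OF k]] deriv_g_\<tau>[OF q d k]
      bracket_\<tau>_lift[OF q k Z] g_0[OF q d] g_0[OF q t[OF k]] by simp
  then show "g q (D \<tau> \<tau> q) (lift k Z q) = g q (\<lambda>f. 0) (lift k Z q)" using g_0[OF q t[OF k]] by simp
qed

end

lemma (in metric_affine) g_curvature:
  assumes X: "smooth_vfield_on M U X" and Y: "smooth_vfield_on M U Y" and Z: "smooth_vfield_on M U Z"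
    and q: "q \<in> U" and v: "v \<in> tangent_space M q"
  shows "g q (R X Y Z q) v = g q (D X (D Y Z) q) v - g q (D Y (D X Z) q) v - g q (D (lie_bracket M X Y) Z q) v"
proof -
  have qt: "q \<in> topspace (mtop M)" by (rule opn_topspace[OF vf_openin[OF X] q])
  note t = vf_tangent[OF D_smooth[OF X D_smooth[OF Y Z]] q] vf_tangent[OF D_smooth[OF Y D_smooth[OF X Z]] q]
    vf_tangent[OF D_smooth[OF bracket_smooth[OF X Y] Z] q]
  show ?thesis
    unfolding curvature_def g_diff(1)[OF qt tv_sub[OF t(1,2)] t(3) v] g_diff(1)[OF qt t(1,2) v] by (rule refl)
qed

lemma (in affine) D_zero:
  assumes "smooth_vfield_on M U X" "q \<in> U"
  shows "D X (\<lambda>q f. 0) q = (\<lambda>f. 0)" "D (\<lambda>q f. 0) X q = (\<lambda>f. 0)"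
  using D_scale2[OF assms(1,1) smooth_on_const[OF vf_openin[OF assms(1)], of 0] assms(2)]
    D_scale1[OF assms(1,1) smooth_on_const[OF vf_openin[OF assms(1)], of 0] assms(2)]
    tv_const[OF vf_tangent[OF assms]] by simp_all

section \<open>The quarter-symmetric connection of a Kasner space-time\<close>

locale kasner_qs = kasner_region I m F gF DF \<phi> p V \<psi> D A e
  for I m and F :: "nat \<Rightarrow> 'a mfd" and gF DF \<phi> p V \<psi> D A e +
  fixes l1 l2 :: real
begin

abbreviation "DB \<equiv> quarter_symmetric g D \<tau> l1 l2"

end

sublocale kasner_qs \<subseteq> Q: metric_affine "kasner_manifold I m F" "kasner_metric m F gF \<phi> p"
  "quarter_symmetric (kasner_metric m F gF \<phi> p) D (d_dt (kasner_manifold I m F)) l1 l2"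
  by unfold_locales (rule L.quarter_symmetric_affine[OF d_dt_smooth], rule L.bracket_smooth)

context kasner_qs
begin

abbreviation "RB \<equiv> curvature M DB"

text \<open>The coefficient of \<partial>/\<partial>t in \<open>DB_lift_lift\<close>: H_i B_i is the
  Levi-Civita part, -\<lambda>2 B_i the correction along P.\<close>

definition K :: "nat \<Rightarrow> real \<Rightarrow> real" where "K i t = (H i t - l2) * B i t"

lemma K_smooth: "smooth_on M U (\<lambda>q. K i (fst q))"
  unfolding K_def by (intro M.smooth_on_mult M.smooth_on_diff H_smooth M.smooth_on_const[OF U_open] smooth_on_U_fst[OF B_smooth])

text \<open>Both correction terms point along \<partial>/\<partial>t here, and its square -1 gives
  them the coefficients -\<lambda>1 and +\<lambda>2.\<close>

lemma DB_\<tau>_\<tau>: "q \<in> U \<Longrightarrow> DB \<tau> \<tau> q = (\<lambda>f. (l2 - l1) * \<tau> q f)"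
  unfolding quarter_symmetric_def D_\<tau>_\<tau> g_\<tau>_\<tau> by (simp add: algebra_simps)

lemma DB_\<tau>_lift: "q \<in> U \<Longrightarrow> i \<in> {1..m} \<Longrightarrow> vfF i Y \<Longrightarrow> DB \<tau> (lift i Y) q = (\<lambda>f. H i (fst q) * lift i Y q f)"
  unfolding quarter_symmetric_def D_\<tau>_lift g_\<tau>_lift by simp

lemma DB_lift_\<tau>: "q \<in> U \<Longrightarrow> i \<in> {1..m} \<Longrightarrow> vfF i X \<Longrightarrow> DB (lift i X) \<tau> q = (\<lambda>f. (H i (fst q) - l1) * lift i X q f)"
  unfolding quarter_symmetric_def D_lift_\<tau> g_\<tau>_lift g_\<tau>_\<tau> by (simp add: algebra_simps)

lemma DB_lift_lift:
  assumes q: "q \<in> U" and i: "i \<in> {1..m}" and X: "vfF i X" and Y: "vfF i Y"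
  shows "DB (lift i X) (lift i Y) q =
    (\<lambda>f. lift i (DF i X Y) q f + K i (fst q) * gF i (snd q i) (X (snd q i)) (Y (snd q i)) * \<tau> q f)"
  using D_lift_lift[OF q i i X Y] g_lift_lift[OF q i i X Y] g_\<tau>_lift(2)[OF q i]
  by (simp add: quarter_symmetric_def K_def algebra_simps)

lemma DB_lift_lift_neq:
  assumes q: "q \<in> U" and i: "i \<in> {1..m}" and j: "j \<in> {1..m}" and "i \<noteq> j" and X: "vfF i X" and Y: "vfF j Y"
  shows "DB (lift i X) (lift j Y) q = (\<lambda>f. 0)"
  using D_lift_lift[OF q i j X Y] g_lift_lift[OF q i j X Y] g_\<tau>_lift(2)[OF q j] \<open>i \<noteq> j\<close>
  by (simp add: quarter_symmetric_def)

text \<open>Covariant derivatives of lifts along the same fibre have the shape lift plus c(t)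
  \<partial>/\<partial>t, so second derivatives need the action on such sums. As c depends on t
  alone, a lift does not differentiate it.\<close>

lemma DB_lift_sum:
  assumes q: "q \<in> U" and i: "i \<in> {1..m}" and j: "j \<in> {1..m}" and X: "vfF j X" and Y: "vfF i Y"
    and c: "smooth_on M U (\<lambda>q. c (fst q))"
  shows "DB (lift j X) (\<lambda>q f. lift i Y q f + c (fst q) * \<tau> q f) q =
    (\<lambda>f. DB (lift j X) (lift i Y) q f + c (fst q) * (H j (fst q) - l1) * lift j X q f)"
  unfolding Q.D_add2[OF lift_smooth[OF j X] lift_smooth[OF i Y] M.vf_scale[OF \<tau>_smooth c] q]
    Q.D_scale2[OF lift_smooth[OF j X] \<tau>_smooth c q] DB_lift_\<tau>[OF q j X]
    lift_fst_fun[OF UW[OF q] j M.smooth_at_on[OF c q]] by (simp add: mult.assoc)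

lemma DB_\<tau>_sum:
  assumes q: "q \<in> U" and i: "i \<in> {1..m}" and Y: "vfF i Y" and c: "smooth_on M U (\<lambda>q. c (fst q))"
    and c': "(c has_field_derivative c') (at (fst q))"
  shows "DB \<tau> (\<lambda>q f. lift i Y q f + c (fst q) * \<tau> q f) q =
    (\<lambda>f. H i (fst q) * lift i Y q f + (c' + c (fst q) * (l2 - l1)) * \<tau> q f)"
  unfolding Q.D_add2[OF \<tau>_smooth lift_smooth[OF i Y] M.vf_scale[OF \<tau>_smooth c] q]
    Q.D_scale2[OF \<tau>_smooth \<tau>_smooth c q] DB_\<tau>_lift[OF q i Y] DB_\<tau>_\<tau>[OF q]
    d_dt_fst_fun[OF UW[OF q] M.smooth_at_on[OF c q]] DERIV_imp_deriv[OF c'] by (simp add: algebra_simps)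

lemma g_combination:
  assumes q: "q \<in> U" and i: "i \<in> {1..m}" and X: "vfF i X" and Y: "vfF i Y" and Z: "vfF i Z"
  shows "g q (\<lambda>f. lift i X q f + r * \<tau> q f) (lift i Z q) = B i (fst q) * gF i (snd q i) (X (snd q i)) (Z (snd q i))"
    "g q (\<lambda>f. lift i X q f + r * \<tau> q f + s * lift i Y q f) (lift i Z q) =
      B i (fst q) * gF i (snd q i) (X (snd q i)) (Z (snd q i)) + s * (B i (fst q) * gF i (snd q i) (Y (snd q i)) (Z (snd q i)))"
proof -
  note qt = subsetD[OF U_top q]
  note t = lift_U_tangent[OF q i] and d = \<tau>_U_tangent[OF q]
  show *: "g q (\<lambda>f. lift i X q f + r * \<tau> q f) (lift i Z q) = B i (fst q) * gF i (snd q i) (X (snd q i)) (Z (snd q i))"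
    using L.g_add(1)[OF qt t M.tv_scaled[OF d] t] L.g_scale(1)[OF qt d t] g_\<tau>_lift(1)[OF q i] g_lift_lift[OF q i i X Z] by simp
  show "g q (\<lambda>f. lift i X q f + r * \<tau> q f + s * lift i Y q f) (lift i Z q) =
      B i (fst q) * gF i (snd q i) (X (snd q i)) (Z (snd q i)) + s * (B i (fst q) * gF i (snd q i) (Y (snd q i)) (Z (snd q i)))"
    using L.g_add(1)[OF qt M.tv_plus[OF t M.tv_scaled[OF d]] M.tv_scaled[OF t] t] L.g_scale(1)[OF qt t t] *
      g_lift_lift[OF q i i Y Z] by simp
qed

section \<open>Curvature components in the adapted frame\<close>

abbreviation "ex i a \<equiv> lift i (e i a)"

lemma ex_smooth: "i \<in> {1..m} \<Longrightarrow> a < l i \<Longrightarrow> smooth_vfield_on M U (ex i a)"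
  by (rule lift_smooth[OF _ e_facts(2)])

lemma DB_ex:
  assumes q: "q \<in> U" and i: "i \<in> {1..m}" and a: "a < l i" and b: "b < l i"
  shows "DB (ex i a) (ex i b) q =
    (\<lambda>f. lift i (DF i (e i a) (e i b)) q f + (\<lambda>t. K i t * (if a = b then 1 else 0)) (fst q) * \<tau> q f)"
  using DB_lift_lift[OF q i e_facts(2)[OF i a] e_facts(2)[OF i b]] e_facts(3)[OF i a b U_proj[OF q i]] by simp

text \<open>A Gauss equation: besides the fibre curvature scaled by B_i, the second derivative turns
  the \<partial>/\<partial>t part K_i of the first one into K_i (H_i - \<lambda>1) times a frame
  field. The Kronecker delta stems from D_a D_b e_a, the -1 from D_b D_a e_a.\<close>

lemma curvature_same:
  assumes q: "q \<in> U" and i: "i \<in> {1..m}" and a: "a < l i" and b: "b < l i"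
  shows "g q (RB (ex i a) (ex i b) (ex i a) q) (ex i b q) =
    B i (fst q) * gF i (snd q i) (curvature (F i) (DF i) (e i a) (e i b) (e i a) (snd q i)) (e i b (snd q i))
    + K i (fst q) * (H i (fst q) - l1) * B i (fst q) * ((if a = b then 1 else 0) - 1)"
proof -
  interpret Fi: lc_mfd "F i" "gF i" "DF i" by (rule fib_lc[OF i])
  let ?x = "snd q i"
  let ?c = "\<lambda>a b t. K i t * (if a = b then 1 else 0 :: real)"
  have c: "smooth_on M U (\<lambda>q. ?c a b (fst q))" for a b
    by (intro M.smooth_on_mult K_smooth M.smooth_on_const[OF U_open])
  note ea = e_facts(2)[OF i a] and eb = e_facts(2)[OF i b]
  note xa = ex_smooth[OF i a] and xb = ex_smooth[OF i b]
  note t = lift_U_tangent[OF q i]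
  have "DB (ex i a) (DB (ex i b) (ex i a)) q = DB (ex i a) (\<lambda>q f. lift i (DF i (e i b) (e i a)) q f + ?c b a (fst q) * \<tau> q f) q"
    by (rule Q.D_cong[OF xa Q.D_smooth[OF xb xa] q refl]) (rule DB_ex[OF _ i b a])
  also have "\<dots> = (\<lambda>f. lift i (DF i (e i a) (DF i (e i b) (e i a))) q f
      + K i (fst q) * gF i ?x (e i a ?x) (DF i (e i b) (e i a) ?x) * \<tau> q f + ?c b a (fst q) * (H i (fst q) - l1) * ex i a q f)"
    unfolding DB_lift_sum[where c = "?c b a", OF q i i ea Fi.D_smooth[OF eb ea] c] DB_lift_lift[OF q i ea Fi.D_smooth[OF eb ea]]
    by (rule refl)
  finally have 1: "g q (DB (ex i a) (DB (ex i b) (ex i a)) q) (ex i b q) =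
      B i (fst q) * gF i ?x (DF i (e i a) (DF i (e i b) (e i a)) ?x) (e i b ?x)
      + ?c b a (fst q) * (H i (fst q) - l1) * (B i (fst q) * gF i ?x (e i a ?x) (e i b ?x))"
    by (simp only: g_combination(2)[OF q i Fi.D_smooth[OF ea Fi.D_smooth[OF eb ea]] ea eb])
  have "DB (ex i b) (DB (ex i a) (ex i a)) q = DB (ex i b) (\<lambda>q f. lift i (DF i (e i a) (e i a)) q f + ?c a a (fst q) * \<tau> q f) q"
    by (rule Q.D_cong[OF xb Q.D_smooth[OF xa xa] q refl]) (rule DB_ex[OF _ i a a])
  also have "\<dots> = (\<lambda>f. lift i (DF i (e i b) (DF i (e i a) (e i a))) q f
      + K i (fst q) * gF i ?x (e i b ?x) (DF i (e i a) (e i a) ?x) * \<tau> q f + ?c a a (fst q) * (H i (fst q) - l1) * ex i b q f)"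
    unfolding DB_lift_sum[where c = "?c a a", OF q i i eb Fi.D_smooth[OF ea ea] c] DB_lift_lift[OF q i eb Fi.D_smooth[OF ea ea]]
    by (rule refl)
  finally have 2: "g q (DB (ex i b) (DB (ex i a) (ex i a)) q) (ex i b q) =
      B i (fst q) * gF i ?x (DF i (e i b) (DF i (e i a) (e i a)) ?x) (e i b ?x)
      + ?c a a (fst q) * (H i (fst q) - l1) * (B i (fst q) * gF i ?x (e i b ?x) (e i b ?x))"
    by (simp only: g_combination(2)[OF q i Fi.D_smooth[OF eb Fi.D_smooth[OF ea ea]] eb eb])
  note br = Fi.bracket_smooth[OF ea eb]
  have "DB (lie_bracket M (ex i a) (ex i b)) (ex i a) q = DB (lift i (lie_bracket (F i) (e i a) (e i b))) (ex i a) q"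
  proof (rule Q.D_cong[OF L.bracket_smooth[OF xa xb] xa q _ refl])
    show "lie_bracket M (ex i a) (ex i b) q = lift i (lie_bracket (F i) (e i a) (e i b)) q" if "q \<in> U" for q
      using bracket_lift[OF that i i ea eb] by simp
  qed
  then have 3: "g q (DB (lie_bracket M (ex i a) (ex i b)) (ex i a) q) (ex i b q) =
      B i (fst q) * gF i ?x (DF i (lie_bracket (F i) (e i a) (e i b)) (e i a) ?x) (e i b ?x)"
    by (simp only: DB_lift_lift[OF q i br ea] g_combination(1)[OF q i Fi.D_smooth[OF br ea] ea eb])
  have F: "gF i ?x (Fi.R (e i a) (e i b) (e i a) ?x) (e i b ?x) = gF i ?x (DF i (e i a) (DF i (e i b) (e i a)) ?x) (e i b ?x)
     - gF i ?x (DF i (e i b) (DF i (e i a) (e i a)) ?x) (e i b ?x)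
     - gF i ?x (DF i (lie_bracket (F i) (e i a) (e i b)) (e i a) ?x) (e i b ?x)"
    by (rule Fi.g_curvature[OF ea eb ea U_proj[OF q i] Fi.vf_tangent[OF eb U_proj[OF q i]]])
  show ?thesis
    unfolding Q.g_curvature[OF xa xb xa q t] 1 2 3 F e_facts(3)[OF i a b U_proj[OF q i]] e_facts(3)[OF i b b U_proj[OF q i]]
    by (cases "a = b") (simp_all add: algebra_simps)
qed

text \<open>Only D_b D_a e_a contributes: the \<partial>/\<partial>t part K_i of D_a e_a becomes K_i
  (H_j - \<lambda>1) e_b. The other terms vanish because lifts from different fibres have zero
  derivative along each other and commute.\<close>

lemma curvature_diff:
  assumes q: "q \<in> U" and i: "i \<in> {1..m}" and j: "j \<in> {1..m}" and ij: "i \<noteq> j" and a: "a < l i" and b: "b < l j"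
  shows "g q (RB (ex i a) (ex j b) (ex i a) q) (ex j b q) = - K i (fst q) * (H j (fst q) - l1) * B j (fst q)"
proof -
  interpret Fi: lc_mfd "F i" "gF i" "DF i" by (rule fib_lc[OF i])
  note ea = e_facts(2)[OF i a] and eb = e_facts(2)[OF j b]
  note xa = ex_smooth[OF i a] and xb = ex_smooth[OF j b]
  note t = lift_U_tangent[OF q j]
  have "DB (ex i a) (DB (ex j b) (ex i a)) q = DB (ex i a) (\<lambda>q f. 0) q"
    by (rule Q.D_cong[OF xa Q.D_smooth[OF xb xa] q refl]) (rule DB_lift_lift_neq[OF _ j i ij[symmetric] eb ea])
  then have 1: "DB (ex i a) (DB (ex j b) (ex i a)) q = (\<lambda>f. 0)" using Q.D_zero(1)[OF xa q] by simp
  have "DB (ex j b) (DB (ex i a) (ex i a)) q = DB (ex j b) (\<lambda>q f. lift i (DF i (e i a) (e i a)) q f + K i (fst q) * \<tau> q f) q"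
    by (rule Q.D_cong[OF xb Q.D_smooth[OF xa xa] q refl]) (use DB_ex[OF _ i a a] in simp)
  also have "\<dots> = (\<lambda>f. (K i (fst q) * (H j (fst q) - l1)) * ex j b q f)"
    unfolding DB_lift_sum[OF q i j eb Fi.D_smooth[OF ea ea] K_smooth] DB_lift_lift_neq[OF q j i ij[symmetric] eb Fi.D_smooth[OF ea ea]]
    by simp
  finally have 2: "g q (DB (ex j b) (DB (ex i a) (ex i a)) q) (ex j b q) = K i (fst q) * (H j (fst q) - l1) * B j (fst q)"
    using L.g_scale(1)[OF subsetD[OF U_top q] t t] g_lift_lift[OF q j j eb eb] e_facts(3)[OF j b b U_proj[OF q j]] by simp
  have "DB (lie_bracket M (ex i a) (ex j b)) (ex i a) q = DB (\<lambda>q f. 0) (ex i a) q"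
  proof (rule Q.D_cong[OF L.bracket_smooth[OF xa xb] xa q _ refl])
    show "lie_bracket M (ex i a) (ex j b) q = (\<lambda>f. 0)" if "q \<in> U" for q
      using bracket_lift[OF that i j ea eb] ij by simp
  qed
  then have 3: "DB (lie_bracket M (ex i a) (ex j b)) (ex i a) q = (\<lambda>f. 0)" using Q.D_zero(2)[OF xa q] by simp
  show ?thesis unfolding Q.g_curvature[OF xa xb xa q t] 1 2 3 g_0[OF q t] by simp
qed

text \<open>The derivative of \<open>H i\<close>, by \<open>H_deriv\<close>.\<close>

definition H' :: "nat \<Rightarrow> real \<Rightarrow> real" where
  "H' i t = p i * (deriv (deriv \<phi>) t / \<phi> t - (deriv \<phi> t / \<phi> t)\<^sup>2)"

text \<open>H' + (H - \<lambda>1) H comes from differentiating (H - \<lambda>1) e_a along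
  \<partial>/\<partial>t. The remaining -(\<lambda>2 - \<lambda>1)(H - \<lambda>1) arises because,
  unlike for the Levi-Civita connection, \<partial>/\<partial>t need not be parallel along
  itself.\<close>

lemma curvature_\<tau>_ex:
  assumes q: "q \<in> U" and i: "i \<in> {1..m}" and a: "a < l i"
  shows "g q (RB \<tau> (ex i a) \<tau> q) (ex i a q) =
    (H' i (fst q) + (H i (fst q) - l1) * (H i (fst q) - l2 + l1)) * B i (fst q)"
proof -
  note ea = e_facts(2)[OF i a]
  note xa = ex_smooth[OF i a]
  note t = lift_U_tangent[OF q i]
  have c: "smooth_on M U (\<lambda>q. H i (fst q) - l1)" by (intro M.smooth_on_diff H_smooth M.smooth_on_const[OF U_open])
  have "((\<lambda>t. H i t - l1) has_field_derivative H' i (fst q)) (at (fst q))"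
    using DERIV_diff[OF H_deriv[OF U_fst[OF q]] DERIV_const[of l1]] by (simp add: H'_def)
  note c' = DERIV_imp_deriv[OF this]
  have "DB \<tau> (DB (ex i a) \<tau>) q = DB \<tau> (\<lambda>q f. (H i (fst q) - l1) * ex i a q f) q"
    by (rule Q.D_cong[OF \<tau>_smooth Q.D_smooth[OF xa \<tau>_smooth] q refl]) (rule DB_lift_\<tau>[OF _ i ea])
  also have "\<dots> = (\<lambda>f. (H' i (fst q) + (H i (fst q) - l1) * H i (fst q)) * ex i a q f)"
    unfolding Q.D_scale2[OF \<tau>_smooth xa c q] DB_\<tau>_lift[OF q i ea]
      d_dt_fst_fun[OF UW[OF q] M.smooth_at_on[OF c q]] c' by (simp add: algebra_simps)
  finally have 1: "DB \<tau> (DB (ex i a) \<tau>) q = (\<lambda>f. (H' i (fst q) + (H i (fst q) - l1) * H i (fst q)) * ex i a q f)" .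
  have k: "smooth_on M U (\<lambda>q. l2 - l1)" by (rule M.smooth_on_const[OF U_open])
  have "DB (ex i a) (DB \<tau> \<tau>) q = DB (ex i a) (\<lambda>q f. (l2 - l1) * \<tau> q f) q"
    by (rule Q.D_cong[OF xa Q.D_smooth[OF \<tau>_smooth \<tau>_smooth] q refl]) (rule DB_\<tau>_\<tau>)
  also have "\<dots> = (\<lambda>f. ((l2 - l1) * (H i (fst q) - l1)) * ex i a q f)"
    unfolding Q.D_scale2[OF xa \<tau>_smooth k q] DB_lift_\<tau>[OF q i ea] M.tv_const[OF t] by (simp add: algebra_simps)
  finally have 2: "DB (ex i a) (DB \<tau> \<tau>) q = (\<lambda>f. ((l2 - l1) * (H i (fst q) - l1)) * ex i a q f)" .
  have "DB (lie_bracket M \<tau> (ex i a)) \<tau> q = DB (\<lambda>q f. 0) \<tau> q"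
    by (rule Q.D_cong[OF L.bracket_smooth[OF \<tau>_smooth xa] \<tau>_smooth q _ refl]) (rule bracket_\<tau>_lift[OF _ i ea])
  then have 3: "DB (lie_bracket M \<tau> (ex i a)) \<tau> q = (\<lambda>f. 0)" using Q.D_zero(2)[OF \<tau>_smooth q] by simp
  show ?thesis
    unfolding Q.g_curvature[OF \<tau>_smooth xa \<tau>_smooth q t] 1 2 3 g_0[OF q t] L.g_scale(1)[OF subsetD[OF U_top q] t t]
    using g_lift_lift[OF q i i ea ea] e_facts(3)[OF i a a U_proj[OF q i]] by (simp add: algebra_simps)
qed

text \<open>The fibre part \<open>?W\<close> is orthogonal to \<partial>/\<partial>t and drops out,
  while the t-derivative of K_i brings in H' and 2 H. The result is that of
  \<open>curvature_\<tau>_ex\<close> with \<lambda>1 and \<lambda>2 exchanged.\<close>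

lemma curvature_ex_\<tau>:
  assumes q: "q \<in> U" and i: "i \<in> {1..m}" and a: "a < l i"
  shows "g q (RB (ex i a) \<tau> (ex i a) q) (\<tau> q) =
    (H' i (fst q) + (H i (fst q) - l2) * (H i (fst q) + l2 - l1)) * B i (fst q)"
proof -
  interpret Fi: lc_mfd "F i" "gF i" "DF i" by (rule fib_lc[OF i])
  note ea = e_facts(2)[OF i a]
  note xa = ex_smooth[OF i a]
  note W = Fi.D_smooth[OF ea ea]
  note t = lift_U_tangent[OF q i] and d = \<tau>_U_tangent[OF q]
  note qt = subsetD[OF U_top q]
  let ?W = "lift i (DF i (e i a) (e i a))"
  have D: "DB (ex i a) (ex i a) q = (\<lambda>f. ?W q f + K i (fst q) * \<tau> q f)" if "q \<in> U" for q
    using DB_ex[OF that i a a] by simp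
  have "(K i has_field_derivative H' i (fst q) * B i (fst q) + (H i (fst q) - l2) * (2 * H i (fst q) * B i (fst q))) (at (fst q))"
    unfolding K_def[abs_def]
    by (rule DERIV_cong[OF DERIV_mult[OF DERIV_diff[OF H_deriv[OF U_fst[OF q]] DERIV_const] B_deriv[OF U_fst[OF q]]]])
      (simp add: H'_def)
  note K' = this
  have "DB (ex i a) (DB \<tau> (ex i a)) q = DB (ex i a) (\<lambda>q f. H i (fst q) * ex i a q f) q"
    by (rule Q.D_cong[OF xa Q.D_smooth[OF \<tau>_smooth xa] q refl]) (rule DB_\<tau>_lift[OF _ i ea])
  also have "\<dots> = (\<lambda>f. H i (fst q) * (?W q f + K i (fst q) * \<tau> q f))"
    unfolding Q.D_scale2[OF xa xa H_smooth q] D[OF q] lift_fst_fun[OF UW[OF q] i M.smooth_at_on[OF H_smooth q]] by simp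
  finally have 1: "DB (ex i a) (DB \<tau> (ex i a)) q = (\<lambda>f. H i (fst q) * (?W q f + K i (fst q) * \<tau> q f))" .
  have "DB \<tau> (DB (ex i a) (ex i a)) q = DB \<tau> (\<lambda>q f. ?W q f + K i (fst q) * \<tau> q f) q"
    by (rule Q.D_cong[OF \<tau>_smooth Q.D_smooth[OF xa xa] q refl D])
  also have "\<dots> = (\<lambda>f. H i (fst q) * ?W q f + (H' i (fst q) * B i (fst q)
      + (H i (fst q) - l2) * (2 * H i (fst q) * B i (fst q)) + K i (fst q) * (l2 - l1)) * \<tau> q f)"
    by (rule DB_\<tau>_sum[OF q i W K_smooth K'])
  finally have 2: "DB \<tau> (DB (ex i a) (ex i a)) q = (\<lambda>f. H i (fst q) * ?W q f + (H' i (fst q) * B i (fst q)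
      + (H i (fst q) - l2) * (2 * H i (fst q) * B i (fst q)) + K i (fst q) * (l2 - l1)) * \<tau> q f)" .
  have "DB (lie_bracket M (ex i a) \<tau>) (ex i a) q = DB (\<lambda>q f. 0) (ex i a) q"
    by (rule Q.D_cong[OF L.bracket_smooth[OF xa \<tau>_smooth] xa q _ refl]) (rule bracket_lift_\<tau>[OF _ i ea])
  then have 3: "DB (lie_bracket M (ex i a) \<tau>) (ex i a) q = (\<lambda>f. 0)" using Q.D_zero(2)[OF xa q] by simp
  have g1: "g q (\<lambda>f. r * (?W q f + s * \<tau> q f)) (\<tau> q) = - (r * s)" for r s
    using L.g_scale(1)[OF qt M.tv_plus[OF t M.tv_scaled[OF d]] d] L.g_add(1)[OF qt t M.tv_scaled[OF d] d]
      L.g_scale(1)[OF qt d d] g_\<tau>_\<tau>[OF q] g_\<tau>_lift(2)[OF q i] by simp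
  have g2: "g q (\<lambda>f. r * ?W q f + s * \<tau> q f) (\<tau> q) = - s" for r s
    using L.g_lin[OF qt t d d] g_\<tau>_\<tau>[OF q] g_\<tau>_lift(2)[OF q i] by simp
  show ?thesis
    unfolding Q.g_curvature[OF xa \<tau>_smooth xa q d] 1 2 3 g_0[OF q d] g1 g2 by (simp add: K_def algebra_simps)
qed

lemma curvature_\<tau>_\<tau>:
  assumes q: "q \<in> U"
  shows "g q (RB \<tau> \<tau> \<tau> q) (\<tau> q) = 0"
proof -
  have "RB \<tau> \<tau> \<tau> q f = - RB \<tau> \<tau> \<tau> q f" for f
    using Q.curvature_swap[OF \<tau>_smooth \<tau>_smooth \<tau>_smooth q] by (rule fun_cong)
  then have "RB \<tau> \<tau> \<tau> q = (\<lambda>f. 0)" by (simp add: fun_eq_iff)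
  then show ?thesis using g_0[OF q \<tau>_U_tangent[OF q]] by simp
qed

section \<open>Summation of the curvature components\<close>

lemma sum_J: "(\<Sum>\<alpha>\<in>J. f \<alpha>) = f (0, 0) + (\<Sum>i\<in>{1..m}. \<Sum>a\<in>{..<l i}. f (i, a))" for f :: "nat \<times> nat \<Rightarrow> real"
proof -
  have "(\<Sum>\<alpha>\<in>J. f \<alpha>) = f (0, 0) + (\<Sum>\<alpha>\<in>(SIGMA i:{1..m}. {..<l i}). f \<alpha>)"
    unfolding J_def by (rule sum.insert) auto
  then show ?thesis by (simp add: sum.Sigma)
qed

lemma fibre_scalar_curvature:
  assumes q: "q \<in> U" and i: "i \<in> {1..m}"
  shows "scalar_curvature (F i) (gF i) (DF i) (snd q i) =
    (\<Sum>a\<in>{..<l i}. \<Sum>b\<in>{..<l i}. gF i (snd q i) (curvature (F i) (DF i) (e i a) (e i b) (e i a) (snd q i)) (e i b (snd q i)))"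
proof -
  interpret Fi: lc_mfd "F i" "gF i" "DF i" by (rule fib_lc[OF i])
  show ?thesis using Fi.scalar_curvature_orth_frame[OF e_frame[OF i] U_proj[OF q i]] by simp
qed

text \<open>Division by the lengths \<open>sc\<close> cancels the factors B in all components,
  except for one 1 / B_i that stays with the fibre curvature. Pairs involving \<partial>/\<partial>t
  once acquire a minus sign from \<open>sg\<close>.\<close>

lemma scalar_curvature_DB:
  assumes q: "q \<in> U"
  defines "h \<equiv> deriv \<phi> (fst q) / \<phi> (fst q)" and "\<zeta> \<equiv> \<Sum>i\<in>{1..m}. l i * p i" and "\<eta> \<equiv> \<Sum>i\<in>{1..m}. l i * (p i)\<^sup>2"
    and "k \<equiv> real (\<Sum>i\<in>{1..m}. l i)"
  shows "scalar_curvature M g DB q = (\<Sum>i\<in>{1..m}. scalar_curvature (F i) (gF i) (DF i) (snd q i) / B i (fst q))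
    - 2 * \<zeta> * (deriv (deriv \<phi>) (fst q) / \<phi> (fst q) - h\<^sup>2) - \<eta> * h\<^sup>2 + k * (l1\<^sup>2 + l2\<^sup>2 - l1 * l2)
    - (\<zeta> * h - k * l2) * (\<zeta> * h - k * l1)"
proof -
  let ?t = "fst q" and ?x = "\<lambda>i. snd q i"
  define T where "T \<alpha> \<beta> = sg \<alpha> / sc \<alpha> q * (sg \<beta> / sc \<beta> q * g q (RB (x \<alpha>) (x \<beta>) (x \<alpha>) q) (x \<beta> q))" for \<alpha> \<beta>
  define h' where "h' = deriv (deriv \<phi>) ?t / \<phi> ?t - h\<^sup>2"
  have Hh: "H i ?t = p i * h" "H' i ?t = p i * h'" for i by (simp_all add: H_def H'_def h_def h'_def)
  have Bp: "B i ?t > 0" for i by (rule B_pos[OF U_fst[OF q]])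
  define S where "S i a b = gF i (?x i) (curvature (F i) (DF i) (e i a) (e i b) (e i a) (?x i)) (e i b (?x i))" for i a b
  have T00: "T (0, 0) (0, 0) = 0" using curvature_\<tau>_\<tau>[OF q] by (simp add: T_def x_def)
  have T0: "T (0, 0) (i, a) = - (p i * h' + (p i * h - l1) * (p i * h - l2 + l1))"
    if i: "i \<in> {1..m}" and a: "a \<in> {..<l i}" for i a
    using curvature_\<tau>_ex[OF q i, of a] a i Bp[of i] by (simp add: T_def x_def sg_def sc_def Hh)
  have T1: "T (i, a) (0, 0) = - (p i * h' + (p i * h - l2) * (p i * h + l2 - l1))"
    if i: "i \<in> {1..m}" and a: "a \<in> {..<l i}" for i a
    using curvature_ex_\<tau>[OF q i, of a] a i Bp[of i] by (simp add: T_def x_def sg_def sc_def Hh)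
  \<comment> \<open>One formula for equal and distinct fibres: the -1 in
    \<open>curvature_same\<close> has the shape of the value for distinct fibres, so that the sum
    may run over all directions, and the delta becomes a correction on the diagonal.\<close>
  have T2: "T (i, a) (j, b) = - ((p i * h - l2) * (p j * h - l1)) +
      (if j = i then S i a b / B i ?t + (if b = a then (p i * h - l2) * (p i * h - l1) else 0) else 0)"
    if ia: "i \<in> {1..m}" "a \<in> {..<l i}" and jb: "j \<in> {1..m}" "b \<in> {..<l j}" for i a j b
  proof (cases "j = i")
    case True
    have "T (i, a) (j, b) = 1 / B i ?t * (1 / B i ?t * (B i ?t * S i a b + K i ?t * (H i ?t - l1) * B i ?t * ((if a = b then 1 else 0) - 1)))"
      using curvature_same[OF q ia(1), of a b] ia jb True by (simp add: T_def x_def sg_def sc_def S_def)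
    also have "\<dots> = S i a b / B i ?t + (p i * h - l2) * (p i * h - l1) * ((if a = b then 1 else 0) - 1)"
      using Bp[of i] by (simp add: K_def Hh field_simps)
    finally show ?thesis using True by (cases "a = b") simp_all
  next
    case False
    have "T (i, a) (j, b) = 1 / B i ?t * (1 / B j ?t * (- K i ?t * (H j ?t - l1) * B j ?t))"
      using curvature_diff[OF q ia(1) jb(1) False[symmetric], of a b] ia jb by (simp add: T_def x_def sg_def sc_def)
    also have "\<dots> = - ((p i * h - l2) * (p j * h - l1))"
      using Bp[of i] Bp[of j] by (simp add: K_def Hh)
    finally show ?thesis using False by simp
  qed
  \<comment> \<open>The common product sums over all fibre directions to \<zeta> h - k \<lambda>1 in
    its second factor; the diagonal correction is met exactly once, at \<open>b = a\<close> in fibre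
    i.\<close>
  have row: "(\<Sum>j\<in>{1..m}. \<Sum>b\<in>{..<l j}. T (i, a) (j, b)) =
      - ((p i * h - l2) * (\<zeta> * h - k * l1)) + (\<Sum>b\<in>{..<l i}. S i a b) / B i ?t + (p i * h - l2) * (p i * h - l1)"
    if i: "i \<in> {1..m}" and a: "a \<in> {..<l i}" for i a
  proof -
    have "(\<Sum>j\<in>{1..m}. \<Sum>b\<in>{..<l j}. T (i, a) (j, b)) = (\<Sum>j\<in>{1..m}. l j * - ((p i * h - l2) * (p j * h - l1)) +
        (if j = i then (\<Sum>b\<in>{..<l i}. S i a b) / B i ?t + (p i * h - l2) * (p i * h - l1) else 0))"
    proof (rule sum.cong[OF refl])
      fix j assume j: "j \<in> {1..m}"
      have "(\<Sum>b\<in>{..<l j}. T (i, a) (j, b)) = (\<Sum>b\<in>{..<l j}. - ((p i * h - l2) * (p j * h - l1)) +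
          (if j = i then S i a b / B i ?t + (if b = a then (p i * h - l2) * (p i * h - l1) else 0) else 0))"
        by (rule sum.cong[OF refl]) (rule T2[OF i a j])
      also have "\<dots> = l j * - ((p i * h - l2) * (p j * h - l1)) +
        (if j = i then (\<Sum>b\<in>{..<l i}. S i a b) / B i ?t + (p i * h - l2) * (p i * h - l1) else 0)"
      proof (cases "j = i")
        case True
        have d: "(\<Sum>b\<in>{..<l i}. if b = a then (p i * h - l2) * (p i * h - l1) else 0) = (p i * h - l2) * (p i * h - l1)"
          using a by simp
        show ?thesis unfolding sum.distrib using True d by (simp add: sum.distrib sum_divide_distrib)
      qed simp
      finally show "(\<Sum>b\<in>{..<l j}. T (i, a) (j, b)) = l j * - ((p i * h - l2) * (p j * h - l1)) +
        (if j = i then (\<Sum>b\<in>{..<l i}. S i a b) / B i ?t + (p i * h - l2) * (p i * h - l1) else 0)" .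
    qed
    also have "\<dots> = (\<Sum>j\<in>{1..m}. l j * - ((p i * h - l2) * (p j * h - l1)))
        + ((\<Sum>b\<in>{..<l i}. S i a b) / B i ?t + (p i * h - l2) * (p i * h - l1))"
      unfolding sum.distrib using i by (simp add: sum.delta)
    also have "(\<Sum>j\<in>{1..m}. l j * - ((p i * h - l2) * (p j * h - l1))) =
        (\<Sum>j\<in>{1..m}. - (p i * h - l2) * h * (l j * p j) + (p i * h - l2) * l1 * l j)"
      by (intro sum.cong refl) (simp add: algebra_simps)
    also have "\<dots> = - ((p i * h - l2) * (\<zeta> * h - k * l1))"
      unfolding sum.distrib \<zeta>_def k_def of_nat_sum sum_distrib_left[symmetric] by (simp add: algebra_simps)
    finally show ?thesis by simp
  qed
  have "scalar_curvature M g DB q = (\<Sum>\<alpha>\<in>J. \<Sum>\<beta>\<in>J. T \<alpha> \<beta>)"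
    unfolding T_def by (rule Q.scalar_curvature_orth_frame[OF frame q])
  also have "\<dots> = (\<Sum>i\<in>{1..m}. \<Sum>a\<in>{..<l i}. T (0, 0) (i, a)) +
      (\<Sum>i\<in>{1..m}. \<Sum>a\<in>{..<l i}. T (i, a) (0, 0) + (\<Sum>j\<in>{1..m}. \<Sum>b\<in>{..<l j}. T (i, a) (j, b)))"
    unfolding sum_J T00 by simp
  also have "\<dots> = (\<Sum>i\<in>{1..m}. \<Sum>a\<in>{..<l i}. - (p i * h' + (p i * h - l1) * (p i * h - l2 + l1))) +
      (\<Sum>i\<in>{1..m}. \<Sum>a\<in>{..<l i}. - (p i * h' + (p i * h - l2) * (p i * h + l2 - l1)) +
       (- ((p i * h - l2) * (\<zeta> * h - k * l1)) + (\<Sum>b\<in>{..<l i}. S i a b) / B i ?t + (p i * h - l2) * (p i * h - l1)))"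
    by (intro arg_cong2[of _ _ _ _ "(+)"] sum.cong refl) (simp_all only: T0 T1 row)
  \<comment> \<open>The two components with \<partial>/\<partial>t and the diagonal correction
    combine: their terms linear in h cancel, and each direction keeps -(p_i h)^2 + \<lambda>1^2 +
    \<lambda>2^2 - \<lambda>1 \<lambda>2 besides -2 p_i h'.\<close>
  also have "\<dots> = (\<Sum>i\<in>{1..m}. \<Sum>a\<in>{..<l i}. (\<Sum>b\<in>{..<l i}. S i a b) / B i ?t +
      (- 2 * h' * p i - h\<^sup>2 * (p i)\<^sup>2 + (l1\<^sup>2 + l2\<^sup>2 - l1 * l2) - (\<zeta> * h - k * l1) * h * p i + (\<zeta> * h - k * l1) * l2))"
    unfolding sum.distrib[symmetric] by (intro sum.cong refl) (simp add: algebra_simps power2_eq_square)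
  also have "\<dots> = (\<Sum>i\<in>{1..m}. (\<Sum>a\<in>{..<l i}. \<Sum>b\<in>{..<l i}. S i a b) / B i ?t +
      (- 2 * h' * (l i * p i) + - (h\<^sup>2) * (l i * (p i)\<^sup>2) + (l1\<^sup>2 + l2\<^sup>2 - l1 * l2) * l i
       + - (\<zeta> * h - k * l1) * h * (l i * p i) + (\<zeta> * h - k * l1) * l2 * l i))"
    by (intro sum.cong refl, unfold sum.distrib[of _ "\<lambda>_. _"] sum_divide_distrib[symmetric] sum_constant card_lessThan)
      (simp add: algebra_simps)
  also have "\<dots> = (\<Sum>i\<in>{1..m}. (\<Sum>a\<in>{..<l i}. \<Sum>b\<in>{..<l i}. S i a b) / B i ?t) +
      (- 2 * h' * \<zeta> + - (h\<^sup>2) * \<eta> + (l1\<^sup>2 + l2\<^sup>2 - l1 * l2) * k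
       + - (\<zeta> * h - k * l1) * h * \<zeta> + (\<zeta> * h - k * l1) * l2 * k)"
    unfolding sum.distrib sum_distrib_left[symmetric] by (simp only: \<zeta>_def[symmetric] \<eta>_def[symmetric] k_def of_nat_sum)
  also have "(\<Sum>i\<in>{1..m}. (\<Sum>a\<in>{..<l i}. \<Sum>b\<in>{..<l i}. S i a b) / B i ?t) =
      (\<Sum>i\<in>{1..m}. scalar_curvature (F i) (gF i) (DF i) (?x i) / B i ?t)"
    by (intro sum.cong refl) (simp only: fibre_scalar_curvature[OF q] S_def)
  finally show ?thesis by (simp add: h'_def algebra_simps)
qed

end

text \<open>Charts and orthonormal frames of the fibres near the components of the given point
  furnish an instance of \<open>kasner_qs\<close>. The formula of \<open>scalar_curvature_DB\<close>
  mentions neither, so it holds at every point.\<close>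

lemma (in kasner) scalar_curvature_quarter_symmetric:
  assumes D: "levi_civita M g D" and q: "q \<in> topspace (mtop M)"
  defines "h \<equiv> deriv \<phi> (fst q) / \<phi> (fst q)" and "\<zeta> \<equiv> \<Sum>i\<in>{1..m}. l i * p i" and "\<eta> \<equiv> \<Sum>i\<in>{1..m}. l i * (p i)\<^sup>2"
    and "k \<equiv> real (\<Sum>i\<in>{1..m}. l i)"
  shows "scalar_curvature M g (quarter_symmetric g D (d_dt M) l1 l2) q =
    (\<Sum>i\<in>{1..m}. scalar_curvature (F i) (gF i) (DF i) (snd q i) / B i (fst q))
    - 2 * \<zeta> * (deriv (deriv \<phi>) (fst q) / \<phi> (fst q) - h\<^sup>2) - \<eta> * h\<^sup>2 + k * (l1\<^sup>2 + l2\<^sup>2 - l1 * l2)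
    - (\<zeta> * h - k * l2) * (\<zeta> * h - k * l1)"
proof -
  obtain V \<psi> where c: "\<forall>i\<in>{1..m}. (V i, \<psi> i) \<in> atlas (F i)" and qV: "q \<in> I \<times> (\<Pi>\<^sub>E i\<in>{1..m}. V i)"
    using q by (rule chart_family)
  have "\<exists>z. fst z \<subseteq> V i \<and> snd q i \<in> fst z \<and>
      metric_mfd.orth_frame (F i) (gF i) (fst z) {..<l i} (snd z) (\<lambda>_. 1) (\<lambda>_ _. 1)" if i: "i \<in> {1..m}" for i
  proof -
    interpret Fi: riemannian_mfd "F i" "gF i" by (rule fib_riem[OF i])
    obtain O' e where e: "snd q i \<in> O'" "Fi.orth_frame O' {..<l i} e (\<lambda>_. 1) (\<lambda>_ _. 1)"
      using Fi.orth_frame_at[OF proj_topspace[OF q i]] .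
    \<comment> \<open>The Gram-Schmidt frame may live on another domain than the chosen chart, so it
      is cut down to \<open>V i\<close>, where lifts are formed.\<close>
    have "openin (mtop (F i)) (O' \<inter> V i)"
      using Fi.orth_frameD(1)[OF e(2)] Fi.chart_open[OF bspec[OF c i]] by blast
    from Fi.orth_frame_subset[OF e(2) this Int_lower1] show ?thesis
      using e(1) qV i by (intro exI[of _ "(O' \<inter> V i, e)"]) auto
  qed
  then obtain z where z: "\<And>i. i \<in> {1..m} \<Longrightarrow> fst (z i) \<subseteq> V i \<and> snd q i \<in> fst (z i) \<and>
      metric_mfd.orth_frame (F i) (gF i) (fst (z i)) {..<l i} (snd (z i)) (\<lambda>_. 1) (\<lambda>_ _. 1)" by metis
  interpret S: kasner_qs I m F gF DF \<phi> p V \<psi> D "\<lambda>i. fst (z i)" "\<lambda>i. snd (z i)" l1 l2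
    by unfold_locales (use c D z in blast)+
  have "q \<in> I \<times> (\<Pi>\<^sub>E i\<in>{1..m}. fst (z i))" using qV z unfolding mem_Times_iff PiE_iff by blast
  from S.scalar_curvature_DB[OF this] show ?thesis unfolding h_def \<zeta>_def \<eta>_def k_def .
qed

section \<open>From the pointwise formula to the equivalence\<close>

lemma riemannian_metric_mfd:
  assumes "smooth_manifold M" "riemannian_metric M g"
  shows "riemannian_mfd M g"
proof -
  interpret charted M by (rule smooth_manifold_charted[OF assms(1)])
  have *: "g p u v = g p v u \<and> (\<forall>w \<in> tangent_space M p. \<forall>a b.
           g p (\<lambda>f. a * u f + b * v f) w = a * g p u w + b * g p v w) \<and> (u \<noteq> (\<lambda>f. 0) \<longrightarrow> g p u u > 0)"
    if "p \<in> topspace (mtop M)" "u \<in> tangent_space M p" "v \<in> tangent_space M p" for p u v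
    using assms(2) that unfolding riemannian_metric_def by blast
  show ?thesis
  proof
    fix p u v assume p: "p \<in> topspace (mtop M)" and u: "u \<in> tangent_space M p"
    show "g p u u > 0" if "u \<noteq> (\<lambda>f. 0)" using *[OF p u u] that by blast
    assume v: "v \<in> tangent_space M p"
    show "g p u v = g p v u" using *[OF p u v] by blast
    show "g p (\<lambda>f. a * u f + b * v f) w = a * g p u w + b * g p v w" if "w \<in> tangent_space M p" for w a b
      using *[OF p u v] that by blast
  next
    show "smooth_on M U (\<lambda>p. g p (X p) (Y p))" if "smooth_vfield_on M U X" "smooth_vfield_on M U Y" for U X Y
      using assms(2) that unfolding riemannian_metric_def by blast
  qed
qed

theorem proposition4p17:
  fixes F :: "nat \<Rightarrow> 'a mfd" and gF :: "nat \<Rightarrow> 'a metric" and DF :: "nat \<Rightarrow> 'a conn"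
    and m n :: nat and l :: "nat \<Rightarrow> nat"
    and t1 t2 :: ereal and I :: "real set"
    and \<phi> :: "real \<Rightarrow> real" and p :: "nat \<Rightarrow> real"
    and M :: "(real \<times> (nat \<Rightarrow> 'a)) mfd" and g :: "(real \<times> (nat \<Rightarrow> 'a)) metric"
    and D Dbar :: "(real \<times> (nat \<Rightarrow> 'a)) conn"
    and \<zeta> \<eta> lam1 lam2 Sbar :: real
  assumes "1 \<le> m"
    and "t1 < t2" and "I = einterval t1 t2"
    and "smooth_real_on I \<phi>" and "\<forall>t\<in>I. \<phi> t > 0"
    and "\<forall>i\<in>{1..m}. smooth_manifold (F i) \<and> riemannian_metric (F i) (gF i) \<and>
           levi_civita (F i) (gF i) (DF i)"
    and "M = kasner_manifold I m F" and "g = kasner_metric m F gF \<phi> p"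
    and "n = mdim M" and "\<forall>i\<in>{1..m}. l i = mdim (F i)"
    and "\<zeta> = (\<Sum>i\<in>{1..m}. l i * p i)" and "\<eta> = (\<Sum>i\<in>{1..m}. l i * (p i)\<^sup>2)"
    and "lam1 \<noteq> 0" and "lam2 \<noteq> 0"
    and "levi_civita M g D"
    and "Dbar = quarter_symmetric g D (d_dt M) lam1 lam2"
  shows "has_constant_scalar_curvature M g Dbar Sbar \<longleftrightarrow>
    (\<exists>SF :: nat \<Rightarrow> real.
       (\<forall>i\<in>{1..m}. has_constant_scalar_curvature (F i) (gF i) (DF i) (SF i)) \<and>
       (\<forall>t\<in>I. Sbar =
          (\<Sum>i\<in>{1..m}. SF i / \<phi> t powr (2 * p i))
          - 2 * \<zeta> * (deriv (deriv \<phi>) t / \<phi> t)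
          - (\<eta> + \<zeta>\<^sup>2 - 2 * \<zeta>) * ((deriv \<phi> t)\<^sup>2 / (\<phi> t)\<^sup>2)
          + (lam1 + lam2) * \<zeta> * (real n - 1) * (deriv \<phi> t / \<phi> t)
          + (real n - 1) * (lam1\<^sup>2 + lam2\<^sup>2 - real n * lam1 * lam2)))"
proof -
  have fibre: "smooth_manifold (F i)" "riemannian_metric (F i) (gF i)" "levi_civita (F i) (gF i) (DF i)"
    if "i \<in> {1..m}" for i using assms(6) that by blast+
  have riem: "riemannian_mfd (F i) (gF i)" if "i \<in> {1..m}" for i by (rule riemannian_metric_mfd[OF fibre(1,2)[OF that]])
  interpret kasner I m F gF DF \<phi> p
  proof (rule kasner.intro[OF product_base.intro kasner_axioms.intro])
    show "riemannian_mfd (F i) (gF i)" if "i \<in> {1..m}" for i by (rule riem[OF that])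
    show "open I" unfolding assms(3) by (rule open_einterval)
    show "smooth_real_on I \<phi>" by (rule assms(4))
    show "\<phi> t > 0" if "t \<in> I" for t using assms(5) that by blast
    show "charted (F i)" if "i \<in> {1..m}" for i by (rule smooth_manifold_charted[OF fibre(1)[OF that]])
    show "lc_mfd (F i) (gF i) (DF i)" if "i \<in> {1..m}" for i
      using riemannian_mfd.axioms(1)[OF riem[OF that]] fibre(3)[OF that] by (simp add: lc_mfd_def lc_mfd_axioms_def)
  qed
  define S where "S i y = scalar_curvature (F i) (gF i) (DF i) y" for i y
  define c where "c t = - 2 * \<zeta> * (deriv (deriv \<phi>) t / \<phi> t)
          - (\<eta> + \<zeta>\<^sup>2 - 2 * \<zeta>) * ((deriv \<phi> t)\<^sup>2 / (\<phi> t)\<^sup>2)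
          + (lam1 + lam2) * \<zeta> * (real n - 1) * (deriv \<phi> t / \<phi> t)
          + (real n - 1) * (lam1\<^sup>2 + lam2\<^sup>2 - real n * lam1 * lam2)" for t
  have dims: "(\<Sum>i\<in>{1..m}. real (mdim (F i)) * p i) = \<zeta>" "(\<Sum>i\<in>{1..m}. real (mdim (F i)) * (p i)\<^sup>2) = \<eta>"
    "real (\<Sum>i\<in>{1..m}. mdim (F i)) = real n - 1"
    using assms(9-12) mdim_M assms(7) by simp_all
  have scal: "scalar_curvature M g Dbar (t, x) = (\<Sum>i\<in>{1..m}. S i (x i) / \<phi> t powr (2 * p i)) + c t"
    if "t \<in> I" "x \<in> (\<Pi>\<^sub>E i\<in>{1..m}. topspace (mtop (F i)))" for t x
  proof -
    have q: "(t, x) \<in> topspace (mtop (kasner_manifold I m F))" unfolding topspace_M using that by simp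
    have lc: "levi_civita (kasner_manifold I m F) (kasner_metric m F gF \<phi> p) D" using assms(7,8,15) by simp
    \<comment> \<open>With k = n - 1 the products \<lambda>1 \<lambda>2 collect the coefficient -(k
      + k^2) = -n (n - 1), and 2 \<zeta> h^2 from the derivative of h is merged into the coefficient
      of h^2.\<close>
    have alg: "a - 2 * \<zeta> * (s - h\<^sup>2) - \<eta> * h\<^sup>2 + (real n - 1) * (lam1\<^sup>2 + lam2\<^sup>2 - lam1 * lam2)
        - (\<zeta> * h - (real n - 1) * lam2) * (\<zeta> * h - (real n - 1) * lam1) =
      a + (- 2 * \<zeta> * s - (\<eta> + \<zeta>\<^sup>2 - 2 * \<zeta>) * h\<^sup>2 + (lam1 + lam2) * \<zeta> * (real n - 1) * h
          + (real n - 1) * (lam1\<^sup>2 + lam2\<^sup>2 - real n * lam1 * lam2))" for a s h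
      by (simp add: algebra_simps power2_eq_square)
    show ?thesis
      using scalar_curvature_quarter_symmetric[OF lc q, of lam1 lam2]
      unfolding assms(7,8,16) dims fst_conv snd_conv c_def S_def B_def alg by (simp only: power_divide)
  qed
  \<comment> \<open>One time is enough for the forward direction, since the factors multiplying the
    fibre curvatures there are nonzero.\<close>
  obtain t0 where t0: "t0 \<in> I" using einterval_nonempty[OF assms(2)] unfolding assms(3) by blast
  have "\<exists>y. y \<in> topspace (mtop (F i))" if "i \<in> {1..m}" for i
    using fibre(1)[OF that] unfolding smooth_manifold_def by blast
  then obtain y where y: "\<And>i. i \<in> {1..m} \<Longrightarrow> y i \<in> topspace (mtop (F i))" by metis
  define x0 where "x0 = restrict y {1..m}"
  have x0: "x0 \<in> (\<Pi>\<^sub>E i\<in>{1..m}. topspace (mtop (F i)))" unfolding x0_def using y by (simp add: restrict_PiE_iff)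
  have top: "topspace (mtop M) = I \<times> (\<Pi>\<^sub>E i\<in>{1..m}. topspace (mtop (F i)))" unfolding assms(7) by (rule topspace_M)
  show ?thesis (is "_ \<longleftrightarrow> (\<exists>SF. ?P SF)")
  proof
    assume "has_constant_scalar_curvature M g Dbar Sbar"
    then have const: "(\<Sum>i\<in>{1..m}. S i (x i) / \<phi> t powr (2 * p i)) + c t = Sbar"
      if "t \<in> I" "x \<in> (\<Pi>\<^sub>E i\<in>{1..m}. topspace (mtop (F i)))" for t x
      using scal[OF that] that unfolding has_constant_scalar_curvature_def top by auto
    have "S i z = S i (x0 i)" if i: "i \<in> {1..m}" and z: "z \<in> topspace (mtop (F i))" for i z
    proof -
      have "x0(i := z) \<in> (\<Pi>\<^sub>E i\<in>{1..m}. topspace (mtop (F i)))"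
        using x0 z i by (auto simp: PiE_iff extensional_def)
      from const[OF t0 this] const[OF t0 x0]
      have "(\<Sum>j\<in>{1..m}. S j ((x0(i := z)) j) / \<phi> t0 powr (2 * p j)) = (\<Sum>j\<in>{1..m}. S j (x0 j) / \<phi> t0 powr (2 * p j))"
        by simp
      moreover have "(\<Sum>j\<in>{1..m} - {i}. S j ((x0(i := z)) j) / \<phi> t0 powr (2 * p j)) =
          (\<Sum>j\<in>{1..m} - {i}. S j (x0 j) / \<phi> t0 powr (2 * p j))"
        by (rule sum.cong) auto
      ultimately have "S i z / \<phi> t0 powr (2 * p i) = S i (x0 i) / \<phi> t0 powr (2 * p i)"
        using sum.remove[OF finite_atLeastAtMost i, of "\<lambda>j. S j ((x0(i := z)) j) / \<phi> t0 powr (2 * p j)"]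
          sum.remove[OF finite_atLeastAtMost i, of "\<lambda>j. S j (x0 j) / \<phi> t0 powr (2 * p j)"] by simp
      then show ?thesis using phi_pos[OF t0] by simp
    qed
    \<comment> \<open>Each fibre constant is read off at the base point \<open>x0\<close>; constancy
      of the total curvature at the points (t, x0) is then the required identity for all t.\<close>
    then have "?P (\<lambda>i. S i (x0 i))"
      using const[OF _ x0] unfolding has_constant_scalar_curvature_def S_def[symmetric] c_def by (simp add: algebra_simps)
    then show "\<exists>SF. ?P SF" by (rule exI[of ?P])
  next
    assume "\<exists>SF. ?P SF"
    then obtain SF where SF: "?P SF" by (rule exE)
    show "has_constant_scalar_curvature M g Dbar Sbar"
      unfolding has_constant_scalar_curvature_def top
    proof
      fix q assume "q \<in> I \<times> (\<Pi>\<^sub>E i\<in>{1..m}. topspace (mtop (F i)))"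
      then obtain t x where q: "q = (t, x)" "t \<in> I" "x \<in> (\<Pi>\<^sub>E i\<in>{1..m}. topspace (mtop (F i)))" by blast
      have "S i (x i) = SF i" if "i \<in> {1..m}" for i
        using SF that q(3) unfolding has_constant_scalar_curvature_def S_def by (blast dest: PiE_mem)
      then have "(\<Sum>i\<in>{1..m}. S i (x i) / \<phi> t powr (2 * p i)) = (\<Sum>i\<in>{1..m}. SF i / \<phi> t powr (2 * p i))"
        by (intro sum.cong refl) (simp only:)
      then have "scalar_curvature M g Dbar q = (\<Sum>i\<in>{1..m}. SF i / \<phi> t powr (2 * p i)) + c t"
        unfolding q(1) scal[OF q(2,3)] by simp
      then show "scalar_curvature M g Dbar q = Sbar" using SF q(2) unfolding c_def by simp
    qed
  qed
qed

end
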